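(* Let $H^{(v)}$ be a rooted graph on $m$ vertices satisfying simultaneously: (C1) either $\det A(H)=\pm1$ and $\det A(H-v)=0$, or $\det A(H)=0$ and $\det A(H-v)=\pm1$; (C2) $\operatorname{Res}(\chi(H;x),\chi(H-v;x))=\pm1$; (C3) $\det[e,B(\lambda)e,\dots,B(\lambda)^{m-1}e]=\pm\lambda^k$ for some integer $k\ge0$, as a polynomial in $\lambda$, where $B(\lambda)=A(H)+\lambda D_v$. Then $G\circ H^{(v)}\in\mathcal{G}$ for every $G\in\mathcal{G}$.
   Context: Graphs are simple; $A(\cdot)$ is the adjacency matrix, $\chi(H;x)=\det(xI-A(H))$, $e$ the all-ones vector, $J$ the all-ones matrix, $H-v$ the graph obtained by deleting $v$, $\operatorname{Res}$ the resultant, $D_v$ the $m\times m$ diagonal matrix with a single nonzero entry $1$ in the position of $v$. A rooted graph $H^{(v)}$ is a graph $H$ with distinguished vertex $v$; for an $n$-vertex graph $G$, the rooted product $G\circ H^{(v)}$ is obtained from $G$ and $n$ copies of $H$ by identifying the root of the $i$-th copy with the $i$-th vertex of $G$. The walk matrix is $W(G)=[e,Ae,\dots,A^{n-1}e]$. For a prime $p$, $\Phi_p(G;x)=\gcd(\chi(A;x),\chi(A+J;x))$, monic gcd in $\mathbb{F}_p[x]$; $\operatorname{nullity}_p$ is nullity over $\mathbb{F}_p$. For even $n$, $\mathcal{G}_n$ is the set of $n$-vertex graphs $G$ with (i) $\det A(G)=\pm1$; (ii) $W(G)$ non-singular with square-free last invariant factor (last diagonal entry of its Smith normal form); (iii)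 $\deg\Phi_p(G;x)=2\operatorname{nullity}_p(W(G))$ for each odd prime factor $p$ of $\det W(G)$. $\mathcal{G}=\bigcup_{n\text{ even}}\mathcal{G}_n$. *)

theory Defs
  imports
    Graph_Theory.Pair_Digraph
    Jordan_Normal_Form.Char_Poly
    Jordan_Normal_Form.VS_Connect
    Subresultants.Resultant_Prelim
    Berlekamp_Zassenhaus.Poly_Mod
    "HOL-Number_Theory.Residues"
    "HOL-Computational_Algebra.Squarefree"
begin

section \<open>Graphs and their matrices\<close>

text \<open>A finite simple graph is a \<^locale>\<open>pair_graph\<close>: a finite vertex set with a symmetric,
  irreflexive set of arcs. Matrices are indexed by \<open>{0..<n}\<close>, so an enumeration of the vertices
  is fixed once for each graph; another choice conjugates adjacency matrices by a permutation
  matrix and permutes the rows of walk matrices.\<close>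

definition vertex_list :: "'a pair_pre_digraph \<Rightarrow> 'a list" where
  "vertex_list G = (SOME xs. distinct xs \<and> set xs = pverts G)"

definition adjacency_mat :: "'a pair_pre_digraph \<Rightarrow> int mat" where
  "adjacency_mat G = (let n = card (pverts G); vs = vertex_list G in
     mat n n (\<lambda>(i, j). if (vs ! i, vs ! j) \<in> parcs G then 1 else 0))"

definition root_mat :: "'a pair_pre_digraph \<Rightarrow> 'a \<Rightarrow> int mat" where
  "root_mat H v = (let m = card (pverts H); vs = vertex_list H in
     mat m m (\<lambda>(i, j). if i = j \<and> vs ! i = v then 1 else 0))"

definition delete_vertex :: "'a pair_pre_digraph \<Rightarrow> 'a \<Rightarrow> 'a pair_pre_digraph" where
  "delete_vertex H v =
     \<lparr> pverts = pverts H - {v}, parcs = {a \<in> parcs H. fst a \<noteq> v \<and> snd a \<noteq> v} \<rparr>"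

text \<open>Vertex \<open>(g, h)\<close> is the copy of \<open>h\<close> in the copy of \<open>H\<close> attached at \<open>g\<close>;
  the vertex \<open>g\<close> of \<open>G\<close> itself is \<open>(g, v)\<close>.\<close>

definition rooted_product ::
  "'a pair_pre_digraph \<Rightarrow> 'b pair_pre_digraph \<Rightarrow> 'b \<Rightarrow> ('a \<times> 'b) pair_pre_digraph" where
  "rooted_product G H v =
     \<lparr> pverts = pverts G \<times> pverts H,
       parcs = {((g, h), (g', h')).
         g = g' \<and> g \<in> pverts G \<and> (h, h') \<in> parcs H \<or>
         h = v \<and> h' = v \<and> (g, g') \<in> parcs G} \<rparr>"

definition all_ones_mat :: "nat \<Rightarrow> int mat" where
  "all_ones_mat n = mat n n (\<lambda>_. 1)"

definition walk_mat :: "'r :: comm_ring_1 mat \<Rightarrow> 'r mat" where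
  "walk_mat A = (let n = dim_row A in
     mat n n (\<lambda>(i, j). ((A ^\<^sub>m j) *\<^sub>v vec n (\<lambda>_. 1)) $ i))"

text \<open>The matrix \<open>A(H) + \<lambda> D\<^sub>v\<close>, with the polynomial variable playing the role of \<open>\<lambda>\<close>.\<close>

definition weighted_root_mat :: "'a pair_pre_digraph \<Rightarrow> 'a \<Rightarrow> int poly mat" where
  "weighted_root_mat H v =
     map_mat (\<lambda>a. [:a:]) (adjacency_mat H) + [:0, 1:] \<cdot>\<^sub>m map_mat (\<lambda>a. [:a:]) (root_mat H v)"

section \<open>Smith normal form\<close>

text \<open>Over the integers, \<^const>\<open>invertible_mat\<close> means unimodular. As the diagonal entries are
  required to be nonnegative, the form \<open>S\<close> is uniquely determined by \<open>M\<close>.\<close>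

definition is_smith_normal_form :: "int mat \<Rightarrow> int mat \<Rightarrow> bool" where
  "is_smith_normal_form M S \<longleftrightarrow>
     square_mat M \<and>
     (\<exists>P Q. P \<in> carrier_mat (dim_row M) (dim_row M) \<and> invertible_mat P \<and>
            Q \<in> carrier_mat (dim_row M) (dim_row M) \<and> invertible_mat Q \<and> S = P * M * Q) \<and>
     diagonal_mat S \<and>
     (\<forall>i < dim_row S. S $$ (i, i) \<ge> 0) \<and>
     (\<forall>i. Suc i < dim_row S \<longrightarrow> S $$ (i, i) dvd S $$ (Suc i, Suc i))"

definition squarefree_last_invariant_factor :: "int mat \<Rightarrow> bool" where
  "squarefree_last_invariant_factor M \<longleftrightarrow>
     (\<exists>S. is_smith_normal_form M S \<and> squarefree (S $$ (dim_row M - 1, dim_row M - 1)))"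

section \<open>Linear algebra and polynomials over the prime fields\<close>

text \<open>The prime \<open>p\<close> varies inside the statement, so the prime field cannot be a type. Its elements
  are represented by the integers \<open>{0..<p}\<close>, as in \<^const>\<open>residue_ring\<close> and \<^locale>\<open>poly_mod\<close>.\<close>

definition kernel_mod :: "nat \<Rightarrow> int mat \<Rightarrow> (int, int vec) module" where
  "kernel_mod p M =
     \<lparr> carrier = {x \<in> carrier_vec (dim_col M).
         (\<forall>i < dim_col M. x $ i \<in> {0 ..< int p}) \<and>
         (\<forall>i < dim_row M. int p dvd (M *\<^sub>v x) $ i)},
       mult = undefined,
       one = undefined,
       zero = 0\<^sub>v (dim_col M),
       add = (\<lambda>x y. map_vec (\<lambda>a. a mod int p) (x + y)),
       smult = (\<lambda>c x. map_vec (\<lambda>a. a mod int p) (c \<cdot>\<^sub>v x)) \<rparr>"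

definition nullity_mod :: "nat \<Rightarrow> int mat \<Rightarrow> nat" where
  "nullity_mod p M = vectorspace.dim (residue_ring (int p)) (kernel_mod p M)"

definition is_monic_gcd_mod :: "nat \<Rightarrow> int poly \<Rightarrow> int poly \<Rightarrow> int poly \<Rightarrow> bool" where
  "is_monic_gcd_mod p d f g \<longleftrightarrow>
     poly_mod.Mp (int p) d = d \<and> lead_coeff d = 1 \<and>
     poly_mod.dvdm (int p) d f \<and> poly_mod.dvdm (int p) d g \<and>
     (\<forall>h. poly_mod.dvdm (int p) h f \<and> poly_mod.dvdm (int p) h g \<longrightarrow> poly_mod.dvdm (int p) h d)"

definition Phi :: "nat \<Rightarrow> 'a pair_pre_digraph \<Rightarrow> int poly" where
  "Phi p G = (THE d. is_monic_gcd_mod p d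
     (char_poly (adjacency_mat G))
     (char_poly (adjacency_mat G + all_ones_mat (card (pverts G)))))"

section \<open>The graph family\<close>

definition graph_family_of_order :: "nat \<Rightarrow> 'a pair_pre_digraph set" where
  "graph_family_of_order n = {G.
     pair_graph G \<and> card (pverts G) = n \<and>
     det (adjacency_mat G) \<in> {1, -1} \<and>
     det (walk_mat (adjacency_mat G)) \<noteq> 0 \<and>
     squarefree_last_invariant_factor (walk_mat (adjacency_mat G)) \<and>
     (\<forall>p. prime p \<and> odd p \<and> int p dvd det (walk_mat (adjacency_mat G)) \<longrightarrow>
        degree (Phi p G) = 2 * nullity_mod p (walk_mat (adjacency_mat G)))}"

text \<open>As usual, graphs have at least one vertex, which excludes \<open>n = 0\<close>.\<close>

definition graph_family :: "'a pair_pre_digraph set" where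
  "graph_family = (\<Union>n \<in> {n. even n \<and> n > 0}. graph_family_of_order n)"

end

theory Submission
  imports Defs "Subresultants.Subresultant"
begin

text \<open>Over \<open>\<int>[\<lambda>]\<close> the rooted product is the matrix \<open>B(\<lambda>) = A(H) + \<lambda> D\<^sub>v\<close>, evaluated at
  \<open>\<lambda> = A(G) = A\<close>; evaluation is a ring homomorphism into integer block matrices, so a matrix over \<open>\<int>[\<lambda>]\<close>
  with determinant \<open>\<plusminus>\<lambda>\<^sup>k\<close> becomes unimodular because \<open>det A = \<plusminus>1\<close>. Since
  \<open>det B(\<lambda>) = det A(H) + \<lambda> det A(H - v)\<close>, (C1) gives condition (i).

  By (C3) the walk matrix of \<open>B(\<lambda>)\<close> evaluates at \<open>A\<close> to a unimodular matrix \<open>U\<close>. The columns of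
  \<open>U (W(G) \<otimes> I)\<close> are the vectors \<open>A\<^sup>i B(A)\<^sup>j e\<close>; they span the same lattice as the walk vectors \<open>B(A)\<^sup>j e\<close>,
  because (C2) makes \<open>A \<otimes> I\<close> a polynomial in \<open>B(A)\<close>. Hence the walk matrix of the product is
  \<open>U (W(G) \<otimes> I) T\<close> with \<open>U\<close> and \<open>T\<close> unimodular, which gives (ii) and multiplies the nullity modulo \<open>p\<close>
  by \<open>m\<close>.

  For (iii), \<open>deg \<Phi>\<^sub>p\<close> is the nullity modulo \<open>p\<close> of the Gram matrix \<open>W\<^sup>T W\<close> (Kronecker's theorem on Hankel
  matrices). The middle factor \<open>U\<^sup>T U\<close> of the Gram matrix of the product is again an evaluation at \<open>A\<close>, and
  \<open>A W = W C\<close> for the companion matrix \<open>C\<close> moves it past \<open>W \<otimes> I\<close>, so that this nullity is also multiplied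
  by \<open>m\<close>. Nullities are compared through the cardinalities \<open>p\<^sup>d\<close> of the kernels.\<close>

hide_const (open) up_ring.coeff up_ring.monom module.smult

section \<open>Polynomials in a matrix\<close>

text \<open>Of the two nullities in (iii), that of the Gram matrix is the harder one. In
  \<open>T^T (W^T \<otimes> I) U^T U (W \<otimes> I) T\<close> the unimodular factor
  \<open>U^T U\<close> stands in the middle, where it cannot be cancelled. It has to move to the
  right end, where it becomes the evaluation of the same matrix at C, and it stays unimodular there:
  \<open>A W = W C\<close> with W non-singular gives \<open>det C = det A\<close>. The Gram matrix
  enters through \<open>\<chi>(A + J) = \<chi>(A) - k\<close> with
  \<open>k = e^T adj(xI - A) e\<close>. The expansion of \<open>k / \<chi>(A)\<close> at infinity
  has the coefficients \<open>e^T A^l e\<close>, and as A is symmetric, \<open>W^T W\<close> is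
  their n x n Hankel matrix. A vector in its kernel modulo p is the coefficient list of a polynomial
  c of degree below n such that \<chi>(A) divides \<open>c k\<close>; the number of such c is p to
  the degree of the gcd. Because p varies, F_p[x] is handled by integer polynomials and congruences.
  The matrix algebra is done over commutative rings, since both \<int> and \<int>[\<lambda>] occur
  as coefficients.\<close>

lemma smult_one_mat_mult_vec:
  fixes u :: "'a::comm_ring_1 vec"
  shows "u \<in> carrier_vec n \<Longrightarrow> (a \<cdot>\<^sub>m 1\<^sub>m n) *\<^sub>v u = a \<cdot>\<^sub>v u"
  by (rule eq_vecI) auto

lemma mult_mat_unit_vec:
  fixes A :: "'a::comm_ring_1 mat"
  shows "A \<in> carrier_mat nr n \<Longrightarrow> j < n \<Longrightarrow> A *\<^sub>v unit_vec n j = col A j"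
  by (rule eq_vecI) auto

lemma pow_mat_Suc_left:
  fixes A :: "'a::comm_ring_1 mat"
  assumes A: "A \<in> carrier_mat n n"
  shows "A ^\<^sub>m Suc k = A * A ^\<^sub>m k"
proof (induction k)
  case 0
  then show ?case using A by auto
next
  case (Suc k)
  have P: "A ^\<^sub>m k \<in> carrier_mat n n" using A by simp
  have "A ^\<^sub>m Suc (Suc k) = A * A ^\<^sub>m k * A" using Suc by simp
  also have "\<dots> = A * A ^\<^sub>m Suc k" using A P by (simp add: assoc_mult_mat[of _ n n _ n _ n])
  finally show ?case .
qed

lemma ex_mat_factor:
  fixes X V :: "'a::comm_ring_1 mat"
  assumes X: "X \<in> carrier_mat r k" and V: "V \<in> carrier_mat r n"
    and col: "\<And>j. j < k \<Longrightarrow> \<exists>c \<in> carrier_vec n. col X j = V *\<^sub>v c"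
  shows "\<exists>T \<in> carrier_mat n k. X = V * T"
proof -
  from col obtain c where c: "\<And>j. j < k \<Longrightarrow> c j \<in> carrier_vec n \<and> col X j = V *\<^sub>v c j"
    by metis
  define T where "T = mat n k (\<lambda>(i, j). c j $ i)"
  have T: "T \<in> carrier_mat n k" by (simp add: T_def)
  have colT: "col T j = c j" if "j < k" for j
    using c[OF that] that by (intro eq_vecI) (auto simp: T_def)
  have "X = V * T"
  proof (rule mat_col_eqI)
    fix j assume "j < dim_col (V * T)"
    then have j: "j < k" using T by simp
    then show "col X j = col (V * T) j"
      using c[OF j] unfolding col_mult2[OF V T j] colT[OF j] by simp
  qed (use X V T in auto)
  then show ?thesis using T by blast
qed

text \<open>Horner evaluation in the matrix ring. The coefficients only form a commutative ring, so
  that it serves for integer matrices and for matrices over \<int>[\<lambda>].\<close>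

definition poly_mat :: "'a::comm_ring_1 poly \<Rightarrow> 'a mat \<Rightarrow> 'a mat" where
  "poly_mat p A = fold_coeffs (\<lambda>a M. a \<cdot>\<^sub>m 1\<^sub>m (dim_row A) + A * M) p (0\<^sub>m (dim_row A) (dim_row A))"

lemma poly_mat_0 [simp]: "A \<in> carrier_mat n n \<Longrightarrow> poly_mat 0 A = 0\<^sub>m n n"
  by (auto simp: poly_mat_def)

lemma poly_mat_dim [simp]:
  "dim_row (poly_mat p A) = dim_row A" "dim_col (poly_mat p A) = dim_row A"
proof -
  have "dim_row (poly_mat p A) = dim_row A \<and> dim_col (poly_mat p A) = dim_row A"
  proof (induction p)
    case (pCons a p)
    then show ?case
      by (cases "a = 0 \<and> p = 0") (auto simp: poly_mat_def)
  qed (simp add: poly_mat_def)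
  then show "dim_row (poly_mat p A) = dim_row A" "dim_col (poly_mat p A) = dim_row A" by auto
qed

lemma poly_mat_pCons:
  assumes A: "A \<in> carrier_mat n n"
  shows "poly_mat (pCons a p) A = a \<cdot>\<^sub>m 1\<^sub>m n + A * poly_mat p A"
proof (cases "a = 0 \<and> p = 0")
  case True
  then have "poly_mat (pCons a p) A = 0\<^sub>m n n" "poly_mat p A = 0\<^sub>m n n"
    using A by auto
  then show ?thesis using True A by (auto intro!: eq_matI)
next
  case False
  then show ?thesis using A by (auto simp: poly_mat_def)
qed

lemma poly_mat_carrier [simp]:
  "A \<in> carrier_mat n n \<Longrightarrow> poly_mat p A \<in> carrier_mat n n"
  by (induction p) (auto simp: poly_mat_pCons)

lemma poly_mat_const:
  "A \<in> carrier_mat n n \<Longrightarrow> poly_mat [:a:] A = a \<cdot>\<^sub>m 1\<^sub>m n"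
  by (subst poly_mat_pCons, assumption) (auto intro!: eq_matI)

lemma poly_mat_1 [simp]: "A \<in> carrier_mat n n \<Longrightarrow> poly_mat 1 A = 1\<^sub>m n"
  using poly_mat_const[of A n 1] by (auto simp: pCons_one intro!: eq_matI)

lemma poly_mat_X: "A \<in> carrier_mat n n \<Longrightarrow> poly_mat [:0, 1:] A = A"
  by (subst poly_mat_pCons, assumption, subst poly_mat_const, assumption) (auto intro!: eq_matI)

lemma poly_mat_smult:
  assumes A: "A \<in> carrier_mat n n"
  shows "poly_mat (smult c p) A = c \<cdot>\<^sub>m poly_mat p A"
proof (induction p)
  case 0
  then show ?case using A by (auto intro!: eq_matI)
next
  case (pCons a p)
  have P: "poly_mat p A \<in> carrier_mat n n" using A by simp
  have "A * (c \<cdot>\<^sub>m poly_mat p A) = c \<cdot>\<^sub>m (A * poly_mat p A)"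
    using A P by (rule mult_smult_distrib)
  then show ?case using A P pCons
    by (auto simp: poly_mat_pCons distrib_left intro!: eq_matI)
qed

lemma poly_mat_add:
  assumes A: "A \<in> carrier_mat n n"
  shows "poly_mat (p + q) A = poly_mat p A + poly_mat q A"
proof (induction p q rule: poly_induct2)
  case 0
  then show ?case using A by (auto intro!: eq_matI)
next
  case (pCons a p b q)
  have P: "poly_mat p A \<in> carrier_mat n n" "poly_mat q A \<in> carrier_mat n n" using A by auto
  have "A * (poly_mat p A + poly_mat q A) = A * poly_mat p A + A * poly_mat q A"
    using A P by (rule mult_add_distrib_mat)
  then show ?case using A P pCons
    by (auto simp: poly_mat_pCons distrib_right simp del: index_mult_mat(1) intro!: eq_matI)
qed

lemma poly_mat_mult:
  assumes A: "A \<in> carrier_mat n n"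
  shows "poly_mat (p * q) A = poly_mat p A * poly_mat q A"
proof (induction p)
  case 0
  then show ?case using A by (auto intro!: eq_matI simp: left_mult_zero_mat[of _ n n])
next
  case (pCons a p)
  have P: "poly_mat p A \<in> carrier_mat n n" "poly_mat q A \<in> carrier_mat n n"
    "A * poly_mat p A \<in> carrier_mat n n" using A by auto
  have "poly_mat (pCons a p * q) A = a \<cdot>\<^sub>m poly_mat q A + A * (poly_mat p A * poly_mat q A)"
  proof -
    have "0 \<cdot>\<^sub>m 1\<^sub>m n + A * (poly_mat p A * poly_mat q A) = A * (poly_mat p A * poly_mat q A)"
      using A P by (auto simp del: index_mult_mat(1) intro!: eq_matI)
    then show ?thesis using A pCons by (simp add: poly_mat_add poly_mat_smult poly_mat_pCons)
  qed
  also have "\<dots> = a \<cdot>\<^sub>m 1\<^sub>m n * poly_mat q A + (A * poly_mat p A) * poly_mat q A"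
    using A P by (simp add: assoc_mult_mat[of _ n n _ n _ n] mult_smult_assoc_mat[of _ n n _ n])
  also have "\<dots> = (a \<cdot>\<^sub>m 1\<^sub>m n + A * poly_mat p A) * poly_mat q A"
    using A P by (intro add_mult_distrib_mat[symmetric, of _ n n]) auto
  finally show ?case using A by (simp add: poly_mat_pCons)
qed

lemma poly_mat_power:
  assumes A: "A \<in> carrier_mat n n"
  shows "poly_mat (p ^ k) A = poly_mat p A ^\<^sub>m k"
proof (induction k)
  case 0
  have "poly_mat p A \<in> carrier_mat n n" using A by simp
  then show ?case using A by auto
next
  case (Suc k)
  then show ?case by (simp only: power_Suc2 poly_mat_mult[OF A] pow_mat.simps)
qed

text \<open>The relation passes through each Horner step. Two instances matter: a walk matrix
  \<open>W\<close> with a companion matrix \<open>C\<close>, and \<open>A = W = C\<close>, which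
  says that \<open>p(A)\<close> commutes with \<open>A\<close>.\<close>

lemma poly_mat_intertwine:
  assumes A: "A \<in> carrier_mat n n" and C: "C \<in> carrier_mat m m" and W: "W \<in> carrier_mat n m"
    and AW: "A * W = W * C"
  shows "poly_mat p A * W = W * poly_mat p C"
proof (induction p)
  case 0
  then show ?case using A C W by auto
next
  case (pCons a p)
  have P: "poly_mat p A \<in> carrier_mat n n" "poly_mat p C \<in> carrier_mat m m" using A C by auto
  have "A * poly_mat p A * W = A * (W * poly_mat p C)"
    using A P W pCons by (simp add: assoc_mult_mat[of _ n n _ n _ m])
  also have "\<dots> = W * (C * poly_mat p C)"
    using A P W C AW by (simp add: assoc_mult_mat[of _ n n _ m _ m, symmetric]
        assoc_mult_mat[of _ n m _ m _ m, symmetric])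
  finally have *: "A * poly_mat p A * W = W * (C * poly_mat p C)" .
  have "poly_mat (pCons a p) A * W = a \<cdot>\<^sub>m 1\<^sub>m n * W + A * poly_mat p A * W"
    unfolding poly_mat_pCons[OF A] using A P W by (intro add_mult_distrib_mat[of _ n n]) auto
  also have "\<dots> = W * (a \<cdot>\<^sub>m 1\<^sub>m m) + W * (C * poly_mat p C)"
    unfolding * using W by (simp add: mult_smult_distrib[of _ n m _ m] mult_smult_assoc_mat[of _ n n _ m])
  also have "\<dots> = W * poly_mat (pCons a p) C"
    unfolding poly_mat_pCons[OF C] using C P W
    by (intro mult_add_distrib_mat[symmetric, of _ n m]) auto
  finally show ?case .
qed

lemma poly_mat_commute:
  assumes A: "A \<in> carrier_mat n n"
  shows "poly_mat p A * A = A * poly_mat p A"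
  by (rule poly_mat_intertwine) (use A in auto)

text \<open>The bound \<open>d\<close> is free so that a fixed range, \<open>n\<close> or
  \<open>Suc n\<close>, can be summed over whatever the degree is. The vector is generalised because
  the Horner step moves one factor \<open>A\<close> onto it.\<close>

lemma poly_mat_mult_vec:
  assumes A: "A \<in> carrier_mat n n" and u: "u \<in> carrier_vec n" and i: "i < n" and d: "degree p < d"
  shows "(poly_mat p A *\<^sub>v u) $ i = (\<Sum>k<d. coeff p k * (A ^\<^sub>m k *\<^sub>v u) $ i)"
  using u d
proof (induction p arbitrary: u d)
  case 0
  then show ?case using A i by auto
next
  case (pCons a p)
  obtain d' where d': "d = Suc d'" using pCons.prems by (cases d) auto
  have P: "poly_mat p A \<in> carrier_mat n n" using A by simp
  have p: "p = 0 \<or> degree p < d'" using pCons d' by (cases "p = 0") auto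
  have "(poly_mat (pCons a p) A *\<^sub>v u) $ i = ((a \<cdot>\<^sub>m 1\<^sub>m n + poly_mat p A * A) *\<^sub>v u) $ i"
    using A by (simp add: poly_mat_pCons poly_mat_commute)
  also have "\<dots> = ((a \<cdot>\<^sub>m 1\<^sub>m n) *\<^sub>v u) $ i + (poly_mat p A *\<^sub>v (A *\<^sub>v u)) $ i"
    using A P i pCons.prems
    by (simp add: add_mult_distrib_mat_vec[of _ n n] mult_carrier_mat[of _ n n _ n]
        assoc_mult_mat_vec[of _ n n _ n] del: index_mult_mat_vec)
  also have "((a \<cdot>\<^sub>m 1\<^sub>m n) *\<^sub>v u) $ i = a * u $ i"
    using i pCons.prems by (simp add: smult_one_mat_mult_vec)
  also have "(poly_mat p A *\<^sub>v (A *\<^sub>v u)) $ i = (\<Sum>k<d'. coeff p k * (A ^\<^sub>m k *\<^sub>v (A *\<^sub>v u)) $ i)"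
  proof (cases "p = 0")
    case True
    then show ?thesis using A i pCons.prems by auto
  next
    case False
    then show ?thesis using A pCons.prems p by (intro pCons.IH) auto
  qed
  also have "\<dots> = (\<Sum>k<d'. coeff p k * (A ^\<^sub>m Suc k *\<^sub>v u) $ i)"
    using A pCons.prems by (simp add: assoc_mult_mat_vec[of _ n n _ n])
  finally show ?case using A i pCons.prems by (simp add: d' sum.lessThan_Suc_shift del: pow_mat.simps(2) sum.lessThan_Suc)
qed

text \<open>\<open>poly_shift k p\<close> is the quotient of \<open>p\<close> by x^k. Evaluated at a
  matrix, this Horner step is the recursion that the coefficients of the adjugate obey.\<close>

lemma poly_shift_eq_pCons:
  "poly_shift k p = pCons (coeff p k) (poly_shift (Suc k) p)"
  by (rule poly_eqI) (auto simp: coeff_poly_shift coeff_pCons split: nat.split)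

lemma poly_shift_eq_0: "degree p < k \<Longrightarrow> poly_shift k p = 0"
  by (rule poly_eqI) (auto simp: coeff_poly_shift coeff_eq_0)

text \<open>Comparing coefficients in \<open>(xI - A) adj(xI - A) = \<chi>\<^sub>A(x) I\<close> from the top degree
  downwards determines the adjugate; the constant coefficient is then the Cayley--Hamilton theorem.\<close>

lemma
  fixes A :: "'a::comm_ring_1 mat"
  assumes A: "A \<in> carrier_mat n n"
  shows coeff_adj_char_poly_matrix: "\<And>i j. i < n \<Longrightarrow> j < n \<Longrightarrow>
      coeff (adj_mat (char_poly_matrix A) $$ (i, j)) k =
        poly_mat (poly_shift (Suc k) (char_poly A)) A $$ (i, j)"
    and poly_mat_char_poly: "poly_mat (char_poly A) A = 0\<^sub>m n n"
proof -
  define M where "M = char_poly_matrix A"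
  define N where "N = adj_mat M"
  define X where "X = char_poly A"
  have M: "M \<in> carrier_mat n n" using A by (simp add: M_def)
  have N: "N \<in> carrier_mat n n" and MN: "M * N = X \<cdot>\<^sub>m 1\<^sub>m n"
    using adj_mat[OF M] by (auto simp: N_def X_def char_poly_def M_def)
  define C where "C = (\<lambda>k. mat n n (\<lambda>(i, j). coeff (N $$ (i, j)) k))"
  have C: "C k \<in> carrier_mat n n" for k by (simp add: C_def)
  have entry: "(if i = j then X else 0) =
      pCons 0 (N $$ (i, j)) - (\<Sum>l<n. smult (A $$ (i, l)) (N $$ (l, j)))"
    if ij: "i < n" "j < n" for i j
  proof -
    have "(if i = j then X else 0) = (M * N) $$ (i, j)" unfolding MN using ij by auto
    also have "\<dots> = (\<Sum>l<n. M $$ (i, l) * N $$ (l, j))"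
      using ij M N by (auto simp: scalar_prod_def atLeast0LessThan)
    also have "\<dots> = (\<Sum>l<n. (if l = i then pCons 0 (N $$ (l, j)) else 0)
        - smult (A $$ (i, l)) (N $$ (l, j)))"
      using ij A by (intro sum.cong) (auto simp: M_def char_poly_matrix_def algebra_simps)
    also have "\<dots> = pCons 0 (N $$ (i, j)) - (\<Sum>l<n. smult (A $$ (i, l)) (N $$ (l, j)))"
      using ij by (simp add: sum_subtractf)
    finally show ?thesis .
  qed
  have rec: "C k = coeff X (Suc k) \<cdot>\<^sub>m 1\<^sub>m n + A * C (Suc k)" for k
  proof (rule eq_matI)
    fix i j assume "i < dim_row (coeff X (Suc k) \<cdot>\<^sub>m 1\<^sub>m n + A * C (Suc k))"
      "j < dim_col (coeff X (Suc k) \<cdot>\<^sub>m 1\<^sub>m n + A * C (Suc k))"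
    then have ij: "i < n" "j < n" using A C[of "Suc k"] by auto
    have "coeff (if i = j then X else 0) (Suc k) =
        coeff (N $$ (i, j)) k - (\<Sum>l<n. A $$ (i, l) * coeff (N $$ (l, j)) (Suc k))"
      unfolding entry[OF ij] by (simp add: coeff_sum)
    then show "C k $$ (i, j) = (coeff X (Suc k) \<cdot>\<^sub>m 1\<^sub>m n + A * C (Suc k)) $$ (i, j)"
      using ij A by (auto simp: C_def scalar_prod_def atLeast0LessThan algebra_simps)
  qed (use A C in \<open>auto simp: C_def\<close>)
  have base: "0\<^sub>m n n = coeff X 0 \<cdot>\<^sub>m 1\<^sub>m n + A * C 0"
  proof (rule eq_matI)
    fix i j assume "i < dim_row (coeff X 0 \<cdot>\<^sub>m 1\<^sub>m n + A * C 0)"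
      "j < dim_col (coeff X 0 \<cdot>\<^sub>m 1\<^sub>m n + A * C 0)"
    then have ij: "i < n" "j < n" using A C[of 0] by auto
    have "coeff (if i = j then X else 0) 0 = - (\<Sum>l<n. A $$ (i, l) * coeff (N $$ (l, j)) 0)"
      unfolding entry[OF ij] by (simp add: coeff_sum)
    then show "0\<^sub>m n n $$ (i, j) = (coeff X 0 \<cdot>\<^sub>m 1\<^sub>m n + A * C 0) $$ (i, j)"
      using ij A by (auto simp: C_def scalar_prod_def atLeast0LessThan algebra_simps)
  qed (use A C in \<open>auto simp: C_def\<close>)
  \<comment> \<open>Beyond \<open>D\<close> both sides vanish, which starts the downward
    induction.\<close>
  define D where "D = (\<Sum>i<n. \<Sum>j<n. degree (N $$ (i, j))) + degree X"
  have D: "degree (N $$ (i, j)) \<le> D" if "i < n" "j < n" for i j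
  proof -
    have "degree (N $$ (i, j)) \<le> (\<Sum>j<n. degree (N $$ (i, j)))"
      using that by (intro member_le_sum) auto
    also have "\<dots> \<le> (\<Sum>i<n. \<Sum>j<n. degree (N $$ (i, j)))"
      using that by (intro member_le_sum[of i]) auto
    finally show ?thesis by (simp add: D_def)
  qed
  have large: "C k = 0\<^sub>m n n" "poly_mat (poly_shift (Suc k) X) A = 0\<^sub>m n n" if "D < k" for k
  proof -
    show "C k = 0\<^sub>m n n"
    proof (rule eq_matI)
      fix i j assume "i < dim_row (0\<^sub>m n n :: 'a mat)" "j < dim_col (0\<^sub>m n n :: 'a mat)"
      then show "C k $$ (i, j) = 0\<^sub>m n n $$ (i, j)"
        using le_less_trans[OF D that] by (simp add: C_def coeff_eq_0)
    qed (auto simp: C_def)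
    have "poly_shift (Suc k) X = 0" using that by (intro poly_shift_eq_0) (simp add: D_def)
    then show "poly_mat (poly_shift (Suc k) X) A = 0\<^sub>m n n" using A by simp
  qed
  have main: "C k = poly_mat (poly_shift (Suc k) X) A" for k
  proof (cases "D < k")
    case True
    then show ?thesis by (simp add: large)
  next
    case False
    then have "k \<le> Suc D" by simp
    then show ?thesis
    proof (induction k rule: inc_induct)
      case base
      then show ?case by (simp add: large)
    next
      case (step k)
      then show ?case
        using rec[of k] poly_shift_eq_pCons[of "Suc k" X] A by (metis poly_mat_pCons)
    qed
  qed
  show "coeff (adj_mat (char_poly_matrix A) $$ (i, j)) k =
      poly_mat (poly_shift (Suc k) (char_poly A)) A $$ (i, j)" if "i < n" "j < n" for i j
    using arg_cong[OF main[of k], of "\<lambda>Z. Z $$ (i, j)"] that by (simp add: C_def N_def M_def X_def)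
  have "poly_mat X A = coeff X 0 \<cdot>\<^sub>m 1\<^sub>m n + A * poly_mat (poly_shift (Suc 0) X) A"
    using poly_shift_eq_pCons[of 0 X] A by (metis poly_mat_pCons poly_shift_id)
  then show "poly_mat (char_poly A) A = 0\<^sub>m n n"
    using base main[of 0] by (simp add: X_def)
qed

lemma coeff_0_char_poly:
  fixes A :: "'a::comm_ring_1 mat"
  assumes A: "A \<in> carrier_mat n n"
  shows "coeff (char_poly A) 0 = (- 1) ^ n * det A"
proof -
  have "poly (char_poly A) 0 = det ((- 1) \<cdot>\<^sub>m A)"
    unfolding char_poly_def by (rule poly_det_cong[of _ n]) (use A in \<open>auto simp: char_poly_matrix_def\<close>)
  then show ?thesis using A by (simp add: poly_0_coeff_0)
qed

text \<open>Cayley--Hamilton has the form \<open>0 = \<chi>(0) I + P A\<close> with \<open>P\<close>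
  a polynomial in \<open>A\<close>, and the constant coefficient \<chi>(0) is a unit. That the
  inverse is a polynomial in \<open>A\<close> is what the application needs.\<close>

lemma inverse_as_poly_mat:
  fixes A :: "'a::comm_ring_1 mat"
  assumes A: "A \<in> carrier_mat n n" and det: "det A * u = 1"
  shows "\<exists>q. poly_mat q A * A = 1\<^sub>m n"
proof -
  \<comment> \<open>\<open>?c\<close> is minus the inverse of the constant coefficient
    \<open>(-1)^n det A\<close>.\<close>
  let ?X = "char_poly A" and ?c = "- ((- 1) ^ n * u)"
  define P where "P = poly_mat (poly_shift 1 ?X) A"
  have P: "P \<in> carrier_mat n n" using A by (simp add: P_def)
  have c: "?c * coeff ?X 0 = - 1"
  proof -
    have "?c * coeff ?X 0 = - (((- 1) ^ n * (- 1) ^ n) * (det A * u))"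
      unfolding coeff_0_char_poly[OF A] by (simp add: ac_simps)
    then show ?thesis by (simp add: det flip: power_add)
  qed
  have *: "0\<^sub>m n n = coeff ?X 0 \<cdot>\<^sub>m 1\<^sub>m n + P * A"
    using poly_shift_eq_pCons[of 0 ?X] A poly_mat_char_poly[OF A]
    by (metis One_nat_def P_def poly_mat_pCons poly_mat_commute poly_shift_id)
  have "?c \<cdot>\<^sub>m P * A = 1\<^sub>m n"
  proof (rule eq_matI)
    fix i j assume "i < dim_row (1\<^sub>m n :: 'a mat)" "j < dim_col (1\<^sub>m n :: 'a mat)"
    then have ij: "i < n" "j < n" by auto
    have "0 = coeff ?X 0 * 1\<^sub>m n $$ (i, j) + (P * A) $$ (i, j)"
      using arg_cong[OF *, of "\<lambda>M. M $$ (i, j)"] ij A P by simp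
    from arg_cong[OF this, of "\<lambda>z. ?c * z"]
    have "?c * 0 = (?c * coeff ?X 0) * 1\<^sub>m n $$ (i, j) + ?c * (P * A) $$ (i, j)"
      by (simp only: distrib_left mult.assoc)
    moreover have "z = y" if "?c * 0 = - 1 * y + z" for y z
      using that by simp
    ultimately have "?c * (P * A) $$ (i, j) = 1\<^sub>m n $$ (i, j)" unfolding c by blast
    then show "(?c \<cdot>\<^sub>m P * A) $$ (i, j) = 1\<^sub>m n $$ (i, j)"
      using ij A P by (simp add: mult_smult_assoc_mat[of _ n n _ n])
  qed (use A P in auto)
  then show ?thesis using A by (metis P_def poly_mat_smult)
qed

section \<open>Walk matrices\<close>

lemma walk_mat_dim [simp]: "dim_row (walk_mat A) = dim_row A" "dim_col (walk_mat A) = dim_row A"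
  by (simp_all add: walk_mat_def Let_def)

lemma walk_mat_carrier [simp]: "A \<in> carrier_mat n n \<Longrightarrow> walk_mat A \<in> carrier_mat n n"
  by (simp add: walk_mat_def Let_def)

lemma col_walk_mat:
  "A \<in> carrier_mat n n \<Longrightarrow> j < n \<Longrightarrow> col (walk_mat A) j = A ^\<^sub>m j *\<^sub>v vec n (\<lambda>_. 1)"
  by (rule eq_vecI) (auto simp: walk_mat_def Let_def)

text \<open>For monic \<open>p\<close>, multiplication by x on the quotient ring modulo
  \<open>p\<close>, in the basis 1, x, x^2, ...; the last column reduces the power whose exponent is
  the degree.\<close>

definition companion_mat :: "'a::comm_ring_1 poly \<Rightarrow> 'a mat" where
  "companion_mat p = mat (degree p) (degree p)
     (\<lambda>(i, j). if Suc j < degree p then (if i = Suc j then 1 else 0) else - coeff p i)"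

lemma companion_mat_char_poly_carrier [simp]:
  "A \<in> carrier_mat n n \<Longrightarrow> companion_mat (char_poly A) \<in> carrier_mat n n"
  by (simp add: companion_mat_def degree_monic_char_poly)

text \<open>Multiplication by \<open>A\<close> shifts each column \<open>A^j e\<close> to the next
  one; beyond the last column, Cayley--Hamilton rewrites \<open>A^n e\<close> in terms of the
  columns.\<close>

lemma walk_mat_companion:
  fixes A :: "'a::comm_ring_1 mat"
  assumes A: "A \<in> carrier_mat n n"
  shows "A * walk_mat A = walk_mat A * companion_mat (char_poly A)"
proof (rule mat_col_eqI)
  let ?e = "vec n (\<lambda>_. 1 :: 'a)" and ?W = "walk_mat A" and ?X = "char_poly A"
  let ?C = "companion_mat ?X"
  have X: "degree ?X = n" "coeff ?X n = 1" using degree_monic_char_poly[OF A] by auto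
  have W: "?W \<in> carrier_mat n n" and C: "?C \<in> carrier_mat n n" using A by auto
  fix j assume "j < dim_col (?W * ?C)"
  then have j: "j < n" using C by simp
  have "col (A * ?W) j = A *\<^sub>v (A ^\<^sub>m j *\<^sub>v ?e)"
    using A j W by (simp add: col_mult2[of _ n n _ n] col_walk_mat)
  also have "\<dots> = A ^\<^sub>m Suc j *\<^sub>v ?e"
    using A by (subst pow_mat_Suc_left[OF A]) (simp add: assoc_mult_mat_vec[of _ n n _ n])
  also have "\<dots> = ?W *\<^sub>v col ?C j"
  proof (cases "Suc j < n")
    case True
    then have "col ?C j = unit_vec n (Suc j)"
      using j X by (intro eq_vecI) (auto simp: companion_mat_def)
    then show ?thesis using True A W by (simp add: mult_mat_unit_vec[of _ n] col_walk_mat del: pow_mat.simps)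
  next
    case False
    then have j': "Suc j = n" using j by simp
    show ?thesis unfolding j'
    proof (rule eq_vecI)
      fix i assume "i < dim_vec (?W *\<^sub>v col ?C j)"
      then have i: "i < n" using A by simp
      have "0 = (poly_mat ?X A *\<^sub>v ?e) $ i" using i A by (simp add: poly_mat_char_poly)
      also have "\<dots> = (\<Sum>k<Suc n. coeff ?X k * (A ^\<^sub>m k *\<^sub>v ?e) $ i)"
        using A i X by (intro poly_mat_mult_vec) auto
      also have "\<dots> = (\<Sum>k<n. coeff ?X k * (A ^\<^sub>m k *\<^sub>v ?e) $ i) + (A ^\<^sub>m n *\<^sub>v ?e) $ i"
        using X by (simp del: index_mult_mat_vec)
      finally have "(A ^\<^sub>m n *\<^sub>v ?e) $ i = (\<Sum>k<n. - coeff ?X k * (A ^\<^sub>m k *\<^sub>v ?e) $ i)"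
        by (simp add: sum_negf eq_neg_iff_add_eq_0 add.commute del: index_mult_mat_vec)
      also have "\<dots> = (\<Sum>k<n. ?W $$ (i, k) * ?C $$ (k, j))"
        using i A X False j
        by (intro sum.cong) (auto simp: walk_mat_def Let_def companion_mat_def simp del: index_mult_mat_vec)
      also have "\<dots> = (?W *\<^sub>v col ?C j) $ i"
        using i j A carrier_matD[OF C] by (simp add: scalar_prod_def atLeast0LessThan)
      finally show "(A ^\<^sub>m n *\<^sub>v ?e) $ i = (?W *\<^sub>v col ?C j) $ i" .
    qed (use A W in auto)
  qed
  also have "\<dots> = col (?W * ?C) j" unfolding col_mult2[OF W C j] ..
  finally show "col (A * ?W) j = col (?W * ?C) j" .
qed (use A degree_monic_char_poly[OF A] in \<open>auto simp: companion_mat_def\<close>)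

text \<open>As \<open>e\<close> is column 0 of the walk matrix (hence \<open>0 < n\<close>),
  intertwining with the companion matrix expresses every \<open>p(A) e\<close> in the walk vectors,
  with coefficients in the ring and for \<open>p\<close> of any degree.\<close>

lemma poly_mat_mult_ones:
  fixes A :: "'a::comm_ring_1 mat"
  assumes A: "A \<in> carrier_mat n n" and n: "0 < n"
  shows "poly_mat p A *\<^sub>v vec n (\<lambda>_. 1) =
    walk_mat A *\<^sub>v (poly_mat p (companion_mat (char_poly A)) *\<^sub>v unit_vec n 0)"
proof -
  let ?W = "walk_mat A" and ?C = "companion_mat (char_poly A)"
  have W: "?W \<in> carrier_mat n n" and C: "?C \<in> carrier_mat n n" using A by auto
  have P: "poly_mat p A \<in> carrier_mat n n" "poly_mat p ?C \<in> carrier_mat n n" using A C by auto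
  have "vec n (\<lambda>_. 1) = ?W *\<^sub>v unit_vec n 0"
    using A W n by (simp add: mult_mat_unit_vec[of _ n] col_walk_mat)
  then have "poly_mat p A *\<^sub>v vec n (\<lambda>_. 1) = (poly_mat p A * ?W) *\<^sub>v unit_vec n 0"
    using P W by (simp add: assoc_mult_mat_vec[of _ n n _ n])
  also have "poly_mat p A * ?W = ?W * poly_mat p ?C"
    using poly_mat_intertwine[OF A C W walk_mat_companion[OF A]] .
  also have "(?W * poly_mat p ?C) *\<^sub>v unit_vec n 0 = ?W *\<^sub>v (poly_mat p ?C *\<^sub>v unit_vec n 0)"
    using P W by (simp add: assoc_mult_mat_vec[of _ n n _ n])
  finally show ?thesis .
qed

section \<open>Block matrices\<close>

lemma poly_mat_sum:
  assumes A: "A \<in> carrier_mat n n" and "i < n" "j < n"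
  shows "poly_mat (\<Sum>l\<in>S. p l) A $$ (i, j) = (\<Sum>l\<in>S. poly_mat (p l) A $$ (i, j))"
  using assms by (induction S rule: infinite_finite_induct) (auto simp: poly_mat_add)

lemma poly_mat_transpose:
  assumes A: "A \<in> carrier_mat n n"
  shows "(poly_mat p A)\<^sup>T = poly_mat p A\<^sup>T"
proof (induction p)
  case 0
  then show ?case using A by (simp add: poly_mat_0[of _ n])
next
  case (pCons a p)
  have P: "poly_mat p A \<in> carrier_mat n n" and AT: "A\<^sup>T \<in> carrier_mat n n" using A by auto
  have "(poly_mat (pCons a p) A)\<^sup>T = (a \<cdot>\<^sub>m 1\<^sub>m n + poly_mat p A * A)\<^sup>T"
    using A by (simp add: poly_mat_pCons poly_mat_commute)
  also have "\<dots> = (a \<cdot>\<^sub>m 1\<^sub>m n)\<^sup>T + (poly_mat p A * A)\<^sup>T"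
    using A P by (intro transpose_add[of _ n n]) auto
  also have "(a \<cdot>\<^sub>m 1\<^sub>m n)\<^sup>T = a \<cdot>\<^sub>m 1\<^sub>m n" by (rule eq_matI) auto
  also have "(poly_mat p A * A)\<^sup>T = A\<^sup>T * poly_mat p A\<^sup>T"
    using transpose_mult[OF P A] pCons by simp
  finally show ?case by (simp add: poly_mat_pCons[OF AT])
qed

lemma poly_mat_pcompose:
  assumes A: "A \<in> carrier_mat n n"
  shows "poly_mat p (poly_mat q A) = poly_mat (pcompose p q) A"
proof (induction p)
  case 0
  then show ?case using A by (simp add: poly_mat_0[of _ n])
next
  case (pCons a p)
  have "poly_mat q A \<in> carrier_mat n n" using A by simp
  then show ?case using A pCons
    by (simp add: poly_mat_pCons[of "poly_mat q A" n] pcompose_pCons poly_mat_add poly_mat_mult poly_mat_const)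
qed

text \<open>Rows and columns of an \<open>N \<times> N\<close> matrix are indexed by pairs \<open>(i, h)\<close> with \<open>i < n\<close> and
  \<open>h < m\<close>, through arbitrary enumerations of these pairs. Rows and columns may use different ones,
  so that the vertex order of a rooted product never has to be permuted into a standard order.\<close>

definition block_mat ::
  "nat \<Rightarrow> (nat \<Rightarrow> nat \<times> nat) \<Rightarrow> (nat \<Rightarrow> nat \<times> nat) \<Rightarrow> (nat \<times> nat \<Rightarrow> nat \<times> nat \<Rightarrow> 'a) \<Rightarrow> 'a mat" where
  "block_mat N s t f = mat N N (\<lambda>(I, J). f (s I) (t J))"

definition block_vec :: "nat \<Rightarrow> (nat \<Rightarrow> nat \<times> nat) \<Rightarrow> (nat \<times> nat \<Rightarrow> 'a) \<Rightarrow> 'a vec" where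
  "block_vec N s x = vec N (\<lambda>I. x (s I))"

lemma block_mat_carrier [simp]: "block_mat N s t f \<in> carrier_mat N N"
  by (simp add: block_mat_def)

lemma block_mat_dim [simp]: "dim_row (block_mat N s t f) = N" "dim_col (block_mat N s t f) = N"
  by (simp_all add: block_mat_def)

lemma block_vec_carrier [simp]: "block_vec N s x \<in> carrier_vec N"
  by (simp add: block_vec_def)

lemma block_mat_mult:
  assumes t: "bij_betw t {..<N} ({..<n} \<times> {..<m})"
  shows "block_mat N s t f * block_mat N t r g =
    block_mat N s r (\<lambda>a c. \<Sum>b\<in>{..<n} \<times> {..<m}. f a b * g b c)"
proof (rule eq_matI)
  fix I J assume "I < dim_row (block_mat N s r (\<lambda>a c. \<Sum>b\<in>{..<n} \<times> {..<m}. f a b * g b c))"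
    "J < dim_col (block_mat N s r (\<lambda>a c. \<Sum>b\<in>{..<n} \<times> {..<m}. f a b * g b c))"
  then have "I < N" "J < N" by auto
  moreover have "(\<Sum>K<N. f (s I) (t K) * g (t K) (r J)) =
      (\<Sum>b\<in>{..<n} \<times> {..<m}. f (s I) b * g b (r J))"
    by (rule sum.reindex_bij_betw[OF t])
  ultimately show "(block_mat N s t f * block_mat N t r g) $$ (I, J) =
      block_mat N s r (\<lambda>a c. \<Sum>b\<in>{..<n} \<times> {..<m}. f a b * g b c) $$ (I, J)"
    by (simp add: block_mat_def scalar_prod_def atLeast0LessThan)
qed auto

lemma block_mat_mult_vec:
  assumes t: "bij_betw t {..<N} ({..<n} \<times> {..<m})"
  shows "block_mat N s t f *\<^sub>v block_vec N t x =
    block_vec N s (\<lambda>a. \<Sum>b\<in>{..<n} \<times> {..<m}. f a b * x b)"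
proof (rule eq_vecI)
  fix I assume "I < dim_vec (block_vec N s (\<lambda>a. \<Sum>b\<in>{..<n} \<times> {..<m}. f a b * x b))"
  then have "I < N" by (simp add: block_vec_def)
  moreover have "(\<Sum>K<N. f (s I) (t K) * x (t K)) = (\<Sum>b\<in>{..<n} \<times> {..<m}. f (s I) b * x b)"
    by (rule sum.reindex_bij_betw[OF t])
  ultimately show "(block_mat N s t f *\<^sub>v block_vec N t x) $ I =
      block_vec N s (\<lambda>a. \<Sum>b\<in>{..<n} \<times> {..<m}. f a b * x b) $ I"
    by (simp add: block_mat_def block_vec_def scalar_prod_def atLeast0LessThan)
qed (simp add: block_vec_def)

lemma block_mat_cong:
  assumes "bij_betw s {..<N} P" "bij_betw t {..<N} Q"
    and "\<And>a b. a \<in> P \<Longrightarrow> b \<in> Q \<Longrightarrow> f a b = g a b"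
  shows "block_mat N s t f = block_mat N s t g"
  by (rule eq_matI) (use assms(3) bij_betwE[OF assms(1)] bij_betwE[OF assms(2)] in \<open>simp_all add: block_mat_def\<close>)

lemma block_vec_cong:
  assumes "bij_betw s {..<N} P" and "\<And>a. a \<in> P \<Longrightarrow> x a = y a"
  shows "block_vec N s x = block_vec N s y"
  by (rule eq_vecI) (use assms(2) bij_betwE[OF assms(1)] in \<open>simp_all add: block_vec_def\<close>)

lemma block_mat_one:
  assumes "bij_betw s {..<N} P"
  shows "block_mat N s s (\<lambda>a b. if a = b then 1 else 0) = 1\<^sub>m N"
  using assms by (intro eq_matI) (auto simp: block_mat_def bij_betw_def inj_on_def)

lemma sum_pair_delta:
  fixes f :: "nat \<Rightarrow> 'a::comm_monoid_add" and h m n :: nat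
  assumes "h < m"
  shows "(\<Sum>b\<in>{..<n} \<times> {..<m}. if snd b = h then f (fst b) else 0) = (\<Sum>i<n. f i)"
proof -
  have "(\<Sum>b\<in>{..<n} \<times> {..<m}. if snd b = h then f (fst b) else 0) =
      (\<Sum>i<n. \<Sum>k<m. if k = h then f i else 0)"
    unfolding sum.cartesian_product' by (simp cong: if_cong)
  then show ?thesis using assms by simp
qed

text \<open>The Kronecker product \<open>W \<otimes> I\<close> in the coordinates (i, h). The size m
  of the identity enters only through the enumerations.\<close>

definition kron_id ::
  "nat \<Rightarrow> (nat \<Rightarrow> nat \<times> nat) \<Rightarrow> (nat \<Rightarrow> nat \<times> nat) \<Rightarrow> 'a::comm_ring_1 mat \<Rightarrow> 'a mat" where
  "kron_id N s t W = block_mat N s t (\<lambda>a b. if snd a = snd b then W $$ (fst a, fst b) else 0)"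

text \<open>Substitution of \<open>A\<close> for \<lambda> in every entry of \<open>M\<close>: the
  second coordinates select the entry, the first ones a position in the n x n matrix that it
  becomes.\<close>

definition block_eval ::
  "nat \<Rightarrow> (nat \<Rightarrow> nat \<times> nat) \<Rightarrow> (nat \<Rightarrow> nat \<times> nat) \<Rightarrow> 'a::comm_ring_1 mat \<Rightarrow> 'a poly mat \<Rightarrow> 'a mat" where
  "block_eval N s t A M = block_mat N s t
     (\<lambda>a b. poly_mat (M $$ (snd a, snd b)) A $$ (fst a, fst b))"

text \<open>Here \<lambda> acts as \<open>A\<close>, and the scalar 1 becomes the all-ones vector of
  length n. Walk vectors over the polynomial ring thus turn into walk vectors of the evaluated
  matrix.\<close>

definition block_eval_vec ::
  "nat \<Rightarrow> (nat \<Rightarrow> nat \<times> nat) \<Rightarrow> 'a::comm_ring_1 mat \<Rightarrow> 'a poly vec \<Rightarrow> 'a vec" where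
  "block_eval_vec N s A w = block_vec N s
     (\<lambda>a. (poly_mat (w $ snd a) A *\<^sub>v vec (dim_row A) (\<lambda>_. 1)) $ fst a)"

lemma kron_id_carrier [simp]: "kron_id N s t W \<in> carrier_mat N N"
  by (simp add: kron_id_def)

lemma block_eval_carrier [simp]: "block_eval N s t A M \<in> carrier_mat N N"
  by (simp add: block_eval_def)

lemma block_eval_vec_carrier [simp]: "block_eval_vec N s A w \<in> carrier_vec N"
  by (simp add: block_eval_vec_def)

lemma kron_id_dim [simp]: "dim_row (kron_id N s t W) = N" "dim_col (kron_id N s t W) = N"
  by (simp_all add: kron_id_def)

lemma block_eval_dim [simp]: "dim_row (block_eval N s t A M) = N" "dim_col (block_eval N s t A M) = N"
  by (simp_all add: block_eval_def)

lemma kron_id_transpose: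
  assumes W: "W \<in> carrier_mat n n"
    and s: "bij_betw s {..<N} ({..<n} \<times> {..<m})" and t: "bij_betw t {..<N} ({..<n} \<times> {..<m})"
  shows "(kron_id N s t W)\<^sup>T = kron_id N t s W\<^sup>T"
proof (rule eq_matI)
  fix I J assume "I < dim_row (kron_id N t s W\<^sup>T)" "J < dim_col (kron_id N t s W\<^sup>T)"
  then have IJ: "I < N" "J < N" by (auto simp: kron_id_def)
  then have "s J \<in> {..<n} \<times> {..<m}" "t I \<in> {..<n} \<times> {..<m}"
    using s t by (auto dest!: bij_betwE)
  then show "(kron_id N s t W)\<^sup>T $$ (I, J) = kron_id N t s W\<^sup>T $$ (I, J)"
    using IJ W by (auto simp: kron_id_def block_mat_def)
qed (auto simp: kron_id_def)

context
  fixes n m N :: nat and s :: "nat \<Rightarrow> nat \<times> nat"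
  assumes s: "bij_betw s {..<N} ({..<n} \<times> {..<m})"
begin

lemma kron_id_one: "kron_id N s s (1\<^sub>m n) = 1\<^sub>m N"
  unfolding kron_id_def
  by (subst block_mat_one[OF s, symmetric], rule block_mat_cong[OF s s]) (auto simp: prod_eq_iff)

lemma block_eval_one:
  assumes "A \<in> carrier_mat n n"
  shows "block_eval N s s A (1\<^sub>m m) = 1\<^sub>m N"
  unfolding block_eval_def
proof (subst block_mat_one[OF s, symmetric], rule block_mat_cong[OF s s])
  fix a b assume "a \<in> {..<n} \<times> {..<m}" "b \<in> {..<n} \<times> {..<m}"
  then show "poly_mat (1\<^sub>m m $$ (snd a, snd b)) A $$ (fst a, fst b) = (if a = b then 1 else 0)"
    using assms by (cases "snd a = snd b") (auto simp: prod_eq_iff)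
qed

end

context
  fixes n m N :: nat and s t :: "nat \<Rightarrow> nat \<times> nat"
  assumes s: "bij_betw s {..<N} ({..<n} \<times> {..<m})"
    and t: "bij_betw t {..<N} ({..<n} \<times> {..<m})"
begin

lemma block_eval_smult_one:
  assumes "A \<in> carrier_mat n n"
  shows "block_eval N s t A (p \<cdot>\<^sub>m 1\<^sub>m m) = kron_id N s t (poly_mat p A)"
  unfolding block_eval_def kron_id_def
proof (rule block_mat_cong[OF s t])
  fix a b assume "a \<in> {..<n} \<times> {..<m}" "b \<in> {..<n} \<times> {..<m}"
  then show "poly_mat ((p \<cdot>\<^sub>m 1\<^sub>m m) $$ (snd a, snd b)) A $$ (fst a, fst b) =
      (if snd a = snd b then poly_mat p A $$ (fst a, fst b) else 0)"
    using assms by (cases "snd a = snd b") auto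
qed

lemma block_eval_add:
  assumes A: "A \<in> carrier_mat n n" and M: "M \<in> carrier_mat m m" "M' \<in> carrier_mat m m"
  shows "block_eval N s t A (M + M') = block_eval N s t A M + block_eval N s t A M'"
proof -
  have "block_eval N s t A (M + M') = block_mat N s t
      (\<lambda>a b. poly_mat (M $$ (snd a, snd b)) A $$ (fst a, fst b) +
        poly_mat (M' $$ (snd a, snd b)) A $$ (fst a, fst b))"
    unfolding block_eval_def by (rule block_mat_cong[OF s t]) (use assms in \<open>auto simp: poly_mat_add\<close>)
  then show ?thesis
    by (auto simp: block_eval_def block_mat_def intro!: eq_matI)
qed

lemma block_eval_transpose:
  assumes A: "A \<in> carrier_mat n n" and M: "M \<in> carrier_mat m m"
  shows "(block_eval N s t A M)\<^sup>T = block_eval N t s A\<^sup>T M\<^sup>T"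
proof -
  have "block_eval N t s A\<^sup>T M\<^sup>T =
      block_mat N t s (\<lambda>b a. poly_mat (M $$ (snd a, snd b)) A $$ (fst a, fst b))"
    unfolding block_eval_def
  proof (rule block_mat_cong[OF t s])
    fix b a assume "b \<in> {..<n} \<times> {..<m}" "a \<in> {..<n} \<times> {..<m}"
    then show "poly_mat (M\<^sup>T $$ (snd b, snd a)) A\<^sup>T $$ (fst b, fst a) =
        poly_mat (M $$ (snd a, snd b)) A $$ (fst a, fst b)"
      using assms by (auto simp: poly_mat_transpose[OF A, symmetric])
  qed
  then show ?thesis
    by (auto simp: block_eval_def block_mat_def intro!: eq_matI)
qed

lemma block_eval_mult_vec:
  assumes A: "A \<in> carrier_mat n n" and M: "M \<in> carrier_mat m m" and w: "w \<in> carrier_vec m"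
  shows "block_eval N s t A M *\<^sub>v block_eval_vec N t A w = block_eval_vec N s A (M *\<^sub>v w)"
  unfolding block_eval_def block_eval_vec_def block_mat_mult_vec[OF t]
proof (rule block_vec_cong[OF s])
  let ?e = "vec (dim_row A) (\<lambda>_. 1 :: 'a)"
  fix a assume a: "a \<in> {..<n} \<times> {..<m}"
  have e: "?e \<in> carrier_vec n" using A by auto
  have "(\<Sum>b\<in>{..<n} \<times> {..<m}. poly_mat (M $$ (snd a, snd b)) A $$ (fst a, fst b) *
        (poly_mat (w $ snd b) A *\<^sub>v ?e) $ fst b) =
      (\<Sum>l<m. \<Sum>x<n. poly_mat (M $$ (snd a, l)) A $$ (fst a, x) * (poly_mat (w $ l) A *\<^sub>v ?e) $ x)"
    by (subst sum.swap) (simp add: sum.cartesian_product' del: index_mult_mat_vec)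
  also have "\<dots> = (\<Sum>l<m. (poly_mat (M $$ (snd a, l)) A *\<^sub>v (poly_mat (w $ l) A *\<^sub>v ?e)) $ fst a)"
    using a A by (intro sum.cong refl) (auto simp: scalar_prod_def atLeast0LessThan)
  also have "\<dots> = (\<Sum>l<m. (poly_mat (M $$ (snd a, l) * w $ l) A *\<^sub>v ?e) $ fst a)"
    using A e by (intro sum.cong refl) (simp add: poly_mat_mult[OF A] assoc_mult_mat_vec[of _ n n _ n])
  also have "\<dots> = (\<Sum>l<m. \<Sum>x<n. poly_mat (M $$ (snd a, l) * w $ l) A $$ (fst a, x))"
    using a A by (intro sum.cong refl) (auto simp: scalar_prod_def atLeast0LessThan)
  also have "\<dots> = (\<Sum>x<n. poly_mat (\<Sum>l<m. M $$ (snd a, l) * w $ l) A $$ (fst a, x))"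
    using a A by (subst sum.swap) (auto simp: poly_mat_sum)
  also have "\<dots> = (poly_mat ((M *\<^sub>v w) $ snd a) A *\<^sub>v ?e) $ fst a"
    using a A M w by (auto simp: scalar_prod_def atLeast0LessThan)
  finally show "(\<Sum>b\<in>{..<n} \<times> {..<m}. poly_mat (M $$ (snd a, snd b)) A $$ (fst a, fst b) *
        (poly_mat (w $ snd b) A *\<^sub>v ?e) $ fst b) = (poly_mat ((M *\<^sub>v w) $ snd a) A *\<^sub>v ?e) $ fst a" .
qed

end

context
  fixes n m N :: nat and s t r :: "nat \<Rightarrow> nat \<times> nat"
  assumes s: "bij_betw s {..<N} ({..<n} \<times> {..<m})"
    and t: "bij_betw t {..<N} ({..<n} \<times> {..<m})"
    and r: "bij_betw r {..<N} ({..<n} \<times> {..<m})"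
begin

lemma kron_id_mult:
  assumes W: "W \<in> carrier_mat n n" and V: "V \<in> carrier_mat n n"
  shows "kron_id N s t W * kron_id N t r V = kron_id N s r (W * V)"
  unfolding kron_id_def block_mat_mult[OF t]
proof (rule block_mat_cong[OF s r])
  fix a c assume a: "a \<in> {..<n} \<times> {..<m}" and c: "c \<in> {..<n} \<times> {..<m}"
  have "(\<Sum>b\<in>{..<n} \<times> {..<m}. (if snd a = snd b then W $$ (fst a, fst b) else 0) *
        (if snd b = snd c then V $$ (fst b, fst c) else 0)) =
      (\<Sum>b\<in>{..<n} \<times> {..<m}. if snd b = snd a then
        (if snd a = snd c then W $$ (fst a, fst b) * V $$ (fst b, fst c) else 0) else 0)"
    by (rule sum.cong) auto
  also have "\<dots> = (\<Sum>l<n. if snd a = snd c then W $$ (fst a, l) * V $$ (l, fst c) else 0)"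
    by (rule sum_pair_delta) (use a in auto)
  finally show "(\<Sum>b\<in>{..<n} \<times> {..<m}. (if snd a = snd b then W $$ (fst a, fst b) else 0) *
        (if snd b = snd c then V $$ (fst b, fst c) else 0)) =
      (if snd a = snd c then (W * V) $$ (fst a, fst c) else 0)"
    using a c W V by (auto simp: scalar_prod_def atLeast0LessThan)
qed

lemma block_eval_mult:
  assumes A: "A \<in> carrier_mat n n" and M: "M \<in> carrier_mat m m" "M' \<in> carrier_mat m m"
  shows "block_eval N s t A M * block_eval N t r A M' = block_eval N s r A (M * M')"
  unfolding block_eval_def block_mat_mult[OF t]
proof (rule block_mat_cong[OF s r])
  fix a c assume a: "a \<in> {..<n} \<times> {..<m}" and c: "c \<in> {..<n} \<times> {..<m}"
  have "(\<Sum>b\<in>{..<n} \<times> {..<m}. poly_mat (M $$ (snd a, snd b)) A $$ (fst a, fst b) *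
        poly_mat (M' $$ (snd b, snd c)) A $$ (fst b, fst c)) =
      (\<Sum>l<m. \<Sum>x<n. poly_mat (M $$ (snd a, l)) A $$ (fst a, x) * poly_mat (M' $$ (l, snd c)) A $$ (x, fst c))"
    by (subst sum.swap) (simp add: sum.cartesian_product')
  also have "\<dots> = (\<Sum>l<m. poly_mat (M $$ (snd a, l) * M' $$ (l, snd c)) A $$ (fst a, fst c))"
    using a c A by (intro sum.cong refl) (auto simp: poly_mat_mult scalar_prod_def atLeast0LessThan)
  also have "\<dots> = poly_mat ((M * M') $$ (snd a, snd c)) A $$ (fst a, fst c)"
    using a c A M by (auto simp: poly_mat_sum[symmetric] scalar_prod_def atLeast0LessThan)
  finally show "(\<Sum>b\<in>{..<n} \<times> {..<m}. poly_mat (M $$ (snd a, snd b)) A $$ (fst a, fst b) *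
        poly_mat (M' $$ (snd b, snd c)) A $$ (fst b, fst c)) =
      poly_mat ((M * M') $$ (snd a, snd c)) A $$ (fst a, fst c)" .
qed

text \<open>Block by block this is \<open>p(A) W = W p(C)\<close>, with \<open>p\<close> running
  over the entries of \<open>M\<close>: an evaluation passes through \<open>W \<otimes> I\<close> at
  the cost of replacing \<open>A\<close> by \<open>C\<close>.\<close>

lemma block_eval_mult_kron_id:
  assumes A: "A \<in> carrier_mat n n" and C: "C \<in> carrier_mat n n" and W: "W \<in> carrier_mat n n"
    and AW: "A * W = W * C"
  shows "block_eval N s t A M * kron_id N t r W = kron_id N s t W * block_eval N t r C M"
proof -
  have 1: "block_eval N s t A M * kron_id N t r W =
      block_mat N s r (\<lambda>a c. (poly_mat (M $$ (snd a, snd c)) A * W) $$ (fst a, fst c))"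
    unfolding block_eval_def kron_id_def block_mat_mult[OF t]
  proof (rule block_mat_cong[OF s r])
    fix a c assume a: "a \<in> {..<n} \<times> {..<m}" and c: "c \<in> {..<n} \<times> {..<m}"
    have "(\<Sum>b\<in>{..<n} \<times> {..<m}. poly_mat (M $$ (snd a, snd b)) A $$ (fst a, fst b) *
          (if snd b = snd c then W $$ (fst b, fst c) else 0)) =
        (\<Sum>b\<in>{..<n} \<times> {..<m}. if snd b = snd c then
          poly_mat (M $$ (snd a, snd c)) A $$ (fst a, fst b) * W $$ (fst b, fst c) else 0)"
      by (rule sum.cong) auto
    also have "\<dots> = (\<Sum>l<n. poly_mat (M $$ (snd a, snd c)) A $$ (fst a, l) * W $$ (l, fst c))"
      by (rule sum_pair_delta) (use c in auto)
    also have "\<dots> = (poly_mat (M $$ (snd a, snd c)) A * W) $$ (fst a, fst c)"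
      using a c A W by (auto simp: scalar_prod_def atLeast0LessThan)
    finally show "(\<Sum>b\<in>{..<n} \<times> {..<m}. poly_mat (M $$ (snd a, snd b)) A $$ (fst a, fst b) *
          (if snd b = snd c then W $$ (fst b, fst c) else 0)) =
        (poly_mat (M $$ (snd a, snd c)) A * W) $$ (fst a, fst c)" .
  qed
  have 2: "kron_id N s t W * block_eval N t r C M =
      block_mat N s r (\<lambda>a c. (W * poly_mat (M $$ (snd a, snd c)) C) $$ (fst a, fst c))"
    unfolding block_eval_def kron_id_def block_mat_mult[OF t]
  proof (rule block_mat_cong[OF s r])
    fix a c assume a: "a \<in> {..<n} \<times> {..<m}" and c: "c \<in> {..<n} \<times> {..<m}"
    have "(\<Sum>b\<in>{..<n} \<times> {..<m}. (if snd a = snd b then W $$ (fst a, fst b) else 0) *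
          poly_mat (M $$ (snd b, snd c)) C $$ (fst b, fst c)) =
        (\<Sum>b\<in>{..<n} \<times> {..<m}. if snd b = snd a then
          W $$ (fst a, fst b) * poly_mat (M $$ (snd a, snd c)) C $$ (fst b, fst c) else 0)"
      by (rule sum.cong) auto
    also have "\<dots> = (\<Sum>l<n. W $$ (fst a, l) * poly_mat (M $$ (snd a, snd c)) C $$ (l, fst c))"
      by (rule sum_pair_delta) (use a in auto)
    also have "\<dots> = (W * poly_mat (M $$ (snd a, snd c)) C) $$ (fst a, fst c)"
      using a c C W by (auto simp: scalar_prod_def atLeast0LessThan)
    finally show "(\<Sum>b\<in>{..<n} \<times> {..<m}. (if snd a = snd b then W $$ (fst a, fst b) else 0) *
          poly_mat (M $$ (snd b, snd c)) C $$ (fst b, fst c)) =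
        (W * poly_mat (M $$ (snd a, snd c)) C) $$ (fst a, fst c)" .
  qed
  show ?thesis unfolding 1 2 poly_mat_intertwine[OF A C W AW] ..
qed

end

section \<open>Unimodular factors of the walk matrix\<close>

lemma mult_mat_smult_vec:
  fixes A :: "'a::comm_ring_1 mat"
  shows "A \<in> carrier_mat nr n \<Longrightarrow> v \<in> carrier_vec n \<Longrightarrow> A *\<^sub>v (k \<cdot>\<^sub>v v) = k \<cdot>\<^sub>v (A *\<^sub>v v)"
  by (rule eq_vecI) (auto simp: scalar_prod_smult_distrib[of _ n])

lemma mat_inverse_of_unit_det:
  fixes P :: "'a::comm_ring_1 mat"
  assumes P: "P \<in> carrier_mat n n" and "det P dvd 1"
  obtains Q where "Q \<in> carrier_mat n n" "P * Q = 1\<^sub>m n" "Q * P = 1\<^sub>m n"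
proof -
  from \<open>det P dvd 1\<close> obtain u where u: "1 = det P * u" by (elim dvdE)
  note adj = adj_mat[OF P]
  have "u \<cdot>\<^sub>m (det P \<cdot>\<^sub>m 1\<^sub>m n) = 1\<^sub>m n"
    using u by (intro eq_matI) (auto simp: mult.commute)
  then have "P * (u \<cdot>\<^sub>m adj_mat P) = 1\<^sub>m n" "(u \<cdot>\<^sub>m adj_mat P) * P = 1\<^sub>m n"
    using adj P by (simp_all add: mult_smult_distrib[of _ n n _ n] mult_smult_assoc_mat[of _ n n _ n])
  with that[of "u \<cdot>\<^sub>m adj_mat P"] adj show ?thesis by simp
qed

lemma unit_det_of_right_inverse:
  fixes P :: "'a::comm_ring_1 mat"
  assumes "P \<in> carrier_mat n n" "Q \<in> carrier_mat n n" "P * Q = 1\<^sub>m n"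
  shows "det P dvd 1" "det Q dvd 1"
proof -
  have "det P * det Q = 1" using assms det_mult[OF assms(1,2)] by simp
  then show "det P dvd 1" "det Q dvd 1" by (metis dvd_triv_left, metis dvd_triv_right)
qed

lemma det_pow_mat:
  fixes A :: "'a::comm_ring_1 mat"
  assumes "A \<in> carrier_mat n n"
  shows "det (A ^\<^sub>m k) = det A ^ k"
  using assms by (induction k) (auto simp: det_mult[of _ n] mult.commute)

text \<open>Multiplication by the adjugate replaces \<open>V\<close> by the scalar
  \<open>det V\<close>, which cancels in an integral domain.\<close>

lemma mult_mat_left_cancel:
  fixes V :: "'a::idom mat"
  assumes V: "V \<in> carrier_mat n n" and P: "P \<in> carrier_mat n k" and Q: "Q \<in> carrier_mat n k"
    and det: "det V \<noteq> 0" and eq: "V * P = V * Q"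
  shows "P = Q"
proof -
  note adj = adj_mat[OF V]
  have *: "det V \<cdot>\<^sub>m R = adj_mat V * (V * R)" if R: "R \<in> carrier_mat n k" for R
    using adj V R by (simp add: assoc_mult_mat[of _ n n _ n _ k, symmetric] mult_smult_assoc_mat[of _ n n _ k])
  have "det V \<cdot>\<^sub>m P = det V \<cdot>\<^sub>m Q" using *[OF P] *[OF Q] eq by simp
  from arg_cong[OF this, of "\<lambda>M. M $$ (i, j)" for i j]
  have "det V * P $$ (i, j) = det V * Q $$ (i, j)" if "i < n" "j < k" for i j
    using that P Q by (metis carrier_matD index_smult_mat(1))
  then show ?thesis using P Q det by (intro eq_matI) auto
qed

lemma poly_mat_monom:
  assumes A: "A \<in> carrier_mat n n"
  shows "poly_mat (Polynomial.monom 1 k) A = A ^\<^sub>m k"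
  using A by (simp only: monom_altdef poly_mat_power[OF A] poly_mat_X[OF A] smult_1_left)

text \<open>Up to sign the value at \<open>A\<close> is a power of \<open>A\<close>. This is the
  point at which a unit determinant of \<open>A\<close> makes determinants of the form \<lambda>^k
  usable after evaluation.\<close>

lemma det_poly_mat_monom_dvd_1:
  fixes A :: "'a::comm_ring_1 mat"
  assumes A: "A \<in> carrier_mat n n" and det: "det A dvd 1"
    and p: "p \<in> {Polynomial.monom 1 k, - Polynomial.monom 1 k}"
  shows "det (poly_mat p A) dvd 1"
proof -
  have "p = smult 1 (Polynomial.monom 1 k) \<or> p = smult (- 1) (Polynomial.monom 1 k)"
    using p by auto
  then obtain c :: 'a where c: "c dvd 1" "p = smult c (Polynomial.monom 1 k)"
    by (metis dvd_refl minus_dvd_iff)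
  have "det (poly_mat p A) = c ^ n * det A ^ k"
    using A by (simp add: c poly_mat_smult poly_mat_monom det_pow_mat)
  moreover have "c ^ n * det A ^ k dvd 1 * 1"
    using c det by (intro mult_dvd_mono) (metis dvd_power_same power_one)+
  ultimately show ?thesis by simp
qed

lemma walk_mat_index:
  assumes "A \<in> carrier_mat n n" "j < n" "i < n"
  shows "walk_mat A $$ (i, j) = (A ^\<^sub>m j *\<^sub>v vec n (\<lambda>_. 1)) $ i"
  using assms by (simp add: walk_mat_def Let_def del: index_mult_mat_vec)

lemma det_kron_id_dvd_1:
  assumes s: "bij_betw s {..<N} ({..<n} \<times> {..<m})" and t: "bij_betw t {..<N} ({..<n} \<times> {..<m})"
    and P: "P \<in> carrier_mat n n" and det: "det P dvd 1"
  shows "det (kron_id N s t P) dvd 1"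
proof -
  from mat_inverse_of_unit_det[OF P det]
  obtain Q where Q: "Q \<in> carrier_mat n n" "P * Q = 1\<^sub>m n" by blast
  then have "kron_id N s t P * kron_id N t s Q = 1\<^sub>m N"
    using kron_id_mult[OF s t s P Q(1)] kron_id_one[OF s] by simp
  then show ?thesis by (intro unit_det_of_right_inverse[of _ N]) auto
qed

lemma kron_id_mult_vec:
  assumes s: "bij_betw s {..<N} ({..<n} \<times> {..<m})" and t: "bij_betw t {..<N} ({..<n} \<times> {..<m})"
  shows "kron_id N s t W *\<^sub>v block_vec N t x =
    block_vec N s (\<lambda>a. \<Sum>l<n. W $$ (fst a, l) * x (l, snd a))"
  unfolding kron_id_def block_mat_mult_vec[OF t]
proof (rule block_vec_cong[OF s])
  fix a assume a: "a \<in> {..<n} \<times> {..<m}"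
  have "(\<Sum>b\<in>{..<n} \<times> {..<m}. (if snd a = snd b then W $$ (fst a, fst b) else 0) * x b) =
      (\<Sum>b\<in>{..<n} \<times> {..<m}. if snd b = snd a then W $$ (fst a, fst b) * x (fst b, snd a) else 0)"
    by (rule sum.cong) auto
  also have "\<dots> = (\<Sum>l<n. W $$ (fst a, l) * x (l, snd a))"
    by (rule sum_pair_delta) (use a in auto)
  finally show "(\<Sum>b\<in>{..<n} \<times> {..<m}. (if snd a = snd b then W $$ (fst a, fst b) else 0) * x b) =
    (\<Sum>l<n. W $$ (fst a, l) * x (l, snd a))" .
qed

text \<open>Multiplication by \<open>adj(W) \<otimes> I\<close> gives \<open>det W\<close> times the
  identity of size N. The exact value is \<open>det W ^ m\<close>, but divisibility already controls
  non-vanishing and prime divisors.\<close>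

lemma det_kron_id_dvd:
  assumes s: "bij_betw s {..<N} ({..<n} \<times> {..<m})"
    and W: "W \<in> carrier_mat n n"
  shows "det (kron_id N s s W) dvd det W ^ N"
proof -
  note adj = adj_mat[OF W]
  have "kron_id N s s W * kron_id N s s (adj_mat W) = kron_id N s s (det W \<cdot>\<^sub>m 1\<^sub>m n)"
    using kron_id_mult[OF s s s W adj(1)] adj by simp
  also have "\<dots> = det W \<cdot>\<^sub>m kron_id N s s (1\<^sub>m n)"
  proof (rule eq_matI)
    fix I J assume "I < dim_row (det W \<cdot>\<^sub>m kron_id N s s (1\<^sub>m n))" "J < dim_col (det W \<cdot>\<^sub>m kron_id N s s (1\<^sub>m n))"
    then have IJ: "I < N" "J < N" by (auto simp: kron_id_def)
    then have "fst (s I) < n" "fst (s J) < n" using bij_betwE[OF s] by (auto simp: mem_Times_iff)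
    then show "kron_id N s s (det W \<cdot>\<^sub>m 1\<^sub>m n) $$ (I, J) = (det W \<cdot>\<^sub>m kron_id N s s (1\<^sub>m n)) $$ (I, J)"
      using IJ by (simp add: kron_id_def block_mat_def)
  qed (auto simp: kron_id_def)
  also have "\<dots> = det W \<cdot>\<^sub>m 1\<^sub>m N" by (simp add: kron_id_one[OF s])
  finally have "det (kron_id N s s W) * det (kron_id N s s (adj_mat W)) = det W ^ N"
    by (simp flip: det_mult[of _ N])
  then show ?thesis by (metis dvd_triv_left)
qed

lemma block_eval_vec_ones:
  assumes s: "bij_betw s {..<N} ({..<n} \<times> {..<m})"
    and A: "A \<in> carrier_mat n n"
  shows "block_eval_vec N s A (vec m (\<lambda>_. 1)) = vec N (\<lambda>_. 1)"
proof -
  have "s I \<in> {..<n} \<times> {..<m}" if "I < N" for I using s that by (auto dest!: bij_betwE)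
  then show ?thesis using A
    by (intro eq_vecI) (auto simp: block_eval_vec_def block_vec_def mem_Times_iff simp del: index_mult_mat_vec)
qed

lemma block_eval_pow:
  assumes s: "bij_betw s {..<N} ({..<n} \<times> {..<m})"
    and A: "A \<in> carrier_mat n n" and B: "B \<in> carrier_mat m m"
  shows "block_eval N s s A B ^\<^sub>m k = block_eval N s s A (B ^\<^sub>m k)"
proof (induction k)
  case 0
  then show ?case using B by (simp add: block_eval_one[OF s A])
next
  case (Suc k)
  then show ?case using B by (simp add: block_eval_mult[OF s s s A])
qed

lemma kron_id_pow:
  assumes s: "bij_betw s {..<N} ({..<n} \<times> {..<m})"
    and A: "A \<in> carrier_mat n n"
  shows "kron_id N s s A ^\<^sub>m k = kron_id N s s (A ^\<^sub>m k)"
proof (induction k)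
  case 0
  have "dim_row (kron_id N s s A) = N" by (simp add: kron_id_def)
  then show ?case using A by (simp add: kron_id_one[OF s])
next
  case (Suc k)
  then show ?case using A by (simp add: kron_id_mult[OF s s s])
qed

section \<open>Evaluation at A and the lattice spanned by the walk vectors\<close>

context
  fixes n m N :: nat and s t :: "nat \<Rightarrow> nat \<times> nat"
  assumes s: "bij_betw s {..<N} ({..<n} \<times> {..<m})"
    and t: "bij_betw t {..<N} ({..<n} \<times> {..<m})"
begin

text \<open>The identity \<open>M adj(M) = det(M) I\<close> over the polynomial ring survives
  evaluation, with right-hand side \<open>(det M)(A) \<otimes> I\<close>; so the determinant in
  question divides a unit.\<close>

lemma det_block_eval_dvd_1:
  assumes A: "A \<in> carrier_mat n n" and det: "det A dvd 1" and M: "M \<in> carrier_mat m m"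
    and p: "det M \<in> {Polynomial.monom 1 k, - Polynomial.monom 1 k}"
  shows "det (block_eval N s t A M) dvd 1"
proof -
  note adj = adj_mat[OF M]
  let ?P = "kron_id N s s (poly_mat (det M) A)"
  have "block_eval N s t A M * block_eval N t s A (adj_mat M) = ?P"
    using adj by (simp add: block_eval_mult[OF s t s A M] block_eval_smult_one[OF s s A])
  then have "det (block_eval N s t A M) * det (block_eval N t s A (adj_mat M)) = det ?P"
    by (simp flip: det_mult[of _ N])
  moreover have "det ?P dvd 1"
    using det_poly_mat_monom_dvd_1[OF A det p] A by (intro det_kron_id_dvd_1[OF s s]) auto
  ultimately show ?thesis by (metis dvd_mult_left)
qed

text \<open>The coefficients arise in two stages. Over the polynomial ring, \<open>B^j e\<close> is
  a combination of the first m walk vectors with coefficients \<open>c $ h\<close>, also for j \<ge>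
  m; then each \<open>c $ h\<close>, evaluated at \<open>A\<close> and applied to \<open>e\<close>,
  is a combination of the columns of \<open>walk_mat A\<close>. Both stages are
  \<open>poly_mat_mult_ones\<close>, so \<open>T\<close> has entries in the ring.\<close>

lemma walk_mat_block_eval_factor:
  assumes A: "A \<in> carrier_mat n n" and B: "B \<in> carrier_mat m m" and "0 < n" "0 < m"
  shows "\<exists>T \<in> carrier_mat N N. walk_mat (block_eval N s s A B) =
    block_eval N s t A (walk_mat B) * kron_id N t t (walk_mat A) * T"
proof (rule ex_mat_factor)
  let ?X = "block_eval N s s A B" and ?K = "kron_id N t t (walk_mat A)"
    and ?U = "block_eval N s t A (walk_mat B)"
  have X: "?X \<in> carrier_mat N N" by simp
  show "walk_mat ?X \<in> carrier_mat N N" "?U * ?K \<in> carrier_mat N N"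
    by (auto intro!: mult_carrier_mat[of _ N N])
  fix j assume j: "j < N"
  define c where "c = poly_mat (Polynomial.monom 1 j) (companion_mat (char_poly B)) *\<^sub>v unit_vec m 0"
  define d where "d = (\<lambda>h. poly_mat (c $ h) (companion_mat (char_poly A)) *\<^sub>v unit_vec n 0)"
  have c: "c \<in> carrier_vec m" unfolding c_def
    by (intro mult_mat_vec_carrier[of _ m m] poly_mat_carrier companion_mat_char_poly_carrier B unit_vec_carrier)
  have d: "d h \<in> carrier_vec n" for h
    unfolding d_def
    by (intro mult_mat_vec_carrier[of _ n n] poly_mat_carrier companion_mat_char_poly_carrier A unit_vec_carrier)
  have "col (walk_mat ?X) j = block_eval N s s A (B ^\<^sub>m j) *\<^sub>v vec N (\<lambda>_. 1)"
    using j by (simp add: col_walk_mat[OF X] block_eval_pow[OF s A B])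
  also have "\<dots> = block_eval_vec N s A (B ^\<^sub>m j *\<^sub>v vec m (\<lambda>_. 1))"
    using B by (simp add: block_eval_mult_vec[OF s s A] flip: block_eval_vec_ones[OF s A])
  also have "B ^\<^sub>m j *\<^sub>v vec m (\<lambda>_. 1) = walk_mat B *\<^sub>v c"
    using poly_mat_mult_ones[OF B \<open>0 < m\<close>, of "Polynomial.monom 1 j"]
    by (simp add: c_def poly_mat_monom[OF B])
  also have "block_eval_vec N s A (walk_mat B *\<^sub>v c) = ?U *\<^sub>v block_eval_vec N t A c"
    using B c by (simp add: block_eval_mult_vec[OF s t A])
  also have "block_eval_vec N t A c = ?K *\<^sub>v block_vec N t (\<lambda>a. d (snd a) $ fst a)"
    unfolding kron_id_mult_vec[OF t t] block_eval_vec_def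
  proof (rule block_vec_cong[OF t])
    fix a assume a: "a \<in> {..<n} \<times> {..<m}"
    have "poly_mat (c $ snd a) A *\<^sub>v vec (dim_row A) (\<lambda>_. 1) = walk_mat A *\<^sub>v d (snd a)"
      using poly_mat_mult_ones[OF A \<open>0 < n\<close>, of "c $ snd a"] A by (simp add: d_def)
    then show "(poly_mat (c $ snd a) A *\<^sub>v vec (dim_row A) (\<lambda>_. 1)) $ fst a =
        (\<Sum>l<n. walk_mat A $$ (fst a, l) * d (snd (l, snd a)) $ fst (l, snd a))"
      using a A d[of "snd a"] by (auto simp: scalar_prod_def atLeast0LessThan)
  qed
  also have "?U *\<^sub>v (?K *\<^sub>v block_vec N t (\<lambda>a. d (snd a) $ fst a)) =
      ?U * ?K *\<^sub>v block_vec N t (\<lambda>a. d (snd a) $ fst a)"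
    by (rule assoc_mult_mat_vec[symmetric, of _ N N _ N]) auto
  finally show "\<exists>c \<in> carrier_vec N. col (walk_mat ?X) j = ?U * ?K *\<^sub>v c" by auto
qed

text \<open>The column of index (i, j) is \<open>(A \<otimes> I)^i X^j e\<close> for the evaluated
  matrix X. As \<open>A \<otimes> I = q(X)\<close>, it is the polynomial \<open>q^i x^j\<close> at X
  applied to e, hence a combination of the walk vectors of X.\<close>

lemma block_eval_factor_walk_mat:
  assumes A: "A \<in> carrier_mat n n" and B: "B \<in> carrier_mat m m" and "0 < n" "0 < m"
    and q: "kron_id N s s A = poly_mat q (block_eval N s s A B)"
  shows "\<exists>T \<in> carrier_mat N N. block_eval N s t A (walk_mat B) * kron_id N t t (walk_mat A) =
    walk_mat (block_eval N s s A B) * T"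
proof (rule ex_mat_factor)
  let ?X = "block_eval N s s A B" and ?K = "kron_id N t t (walk_mat A)"
    and ?U = "block_eval N s t A (walk_mat B)"
  have X: "?X \<in> carrier_mat N N" by simp
  show "walk_mat ?X \<in> carrier_mat N N" "?U * ?K \<in> carrier_mat N N"
    by (auto intro!: mult_carrier_mat[of _ N N])
  fix J assume J: "J < N"
  define i j where "i = fst (t J)" and "j = snd (t J)"
  have ij: "i < n" "j < m" using bij_betwE[OF t] J by (auto simp: i_def j_def mem_Times_iff)
  define x :: "'a poly" where "x = Polynomial.monom 1 i"
  have "col (?U * ?K) J = ?U *\<^sub>v col ?K J"
    by (rule col_mult2[of _ N N _ N]) (use J in auto)
  \<comment> \<open>Column (i, j) of \<open>W \<otimes> I\<close> holds \<open>A^i e\<close> at the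
    positions with second coordinate j; it is the evaluation of \<lambda>^i times the j-th unit
    vector.\<close>
  also have "col ?K J = block_eval_vec N t A (x \<cdot>\<^sub>v unit_vec m j)"
  proof (rule eq_vecI)
    fix I assume "I < dim_vec (block_eval_vec N t A (x \<cdot>\<^sub>v unit_vec m j))"
    then have I: "I < N" by (simp add: block_eval_vec_def block_vec_def)
    then have tI: "fst (t I) < n" "snd (t I) < m" using bij_betwE[OF t] by (auto simp: mem_Times_iff)
    have "walk_mat A $$ (fst (t I), i) = (poly_mat x A *\<^sub>v vec n (\<lambda>_. 1)) $ fst (t I)"
      using tI ij A by (simp add: x_def poly_mat_monom[OF A] walk_mat_index[OF A] del: index_mult_mat_vec)
    then show "col ?K J $ I = block_eval_vec N t A (x \<cdot>\<^sub>v unit_vec m j) $ I"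
      using I J tI ij A
      by (auto simp: kron_id_def block_mat_def block_eval_vec_def block_vec_def i_def [symmetric]
          j_def [symmetric] simp del: index_mult_mat_vec) auto
  qed (simp add: block_eval_vec_def block_vec_def kron_id_def)
  also have "?U *\<^sub>v block_eval_vec N t A (x \<cdot>\<^sub>v unit_vec m j) =
      block_eval_vec N s A (walk_mat B *\<^sub>v (x \<cdot>\<^sub>v unit_vec m j))"
    using B by (intro block_eval_mult_vec[OF s t A]) auto
  also have "walk_mat B *\<^sub>v (x \<cdot>\<^sub>v unit_vec m j) = x \<cdot>\<^sub>v (B ^\<^sub>m j *\<^sub>v vec m (\<lambda>_. 1))"
    unfolding mult_mat_smult_vec[OF walk_mat_carrier[OF B] unit_vec_carrier]
      mult_mat_unit_vec[OF walk_mat_carrier[OF B] ij(2)] col_walk_mat[OF B ij(2)] ..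
  also have "\<dots> = ((x \<cdot>\<^sub>m 1\<^sub>m m) * B ^\<^sub>m j) *\<^sub>v vec m (\<lambda>_. 1)"
    using B smult_one_mat_mult_vec[OF mult_mat_vec_carrier[OF pow_carrier_mat[OF B] vec_carrier], of x j "\<lambda>_. 1"]
    by (simp add: assoc_mult_mat_vec[of _ m m _ m])
  also have "block_eval_vec N s A \<dots> =
      block_eval N s s A ((x \<cdot>\<^sub>m 1\<^sub>m m) * B ^\<^sub>m j) *\<^sub>v block_eval_vec N s A (vec m (\<lambda>_. 1))"
    using B by (intro block_eval_mult_vec[OF s s A, symmetric] mult_carrier_mat[of _ m m]) auto
  also have "block_eval N s s A ((x \<cdot>\<^sub>m 1\<^sub>m m) * B ^\<^sub>m j) = kron_id N s s A ^\<^sub>m i * ?X ^\<^sub>m j"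
    using A B by (simp add: block_eval_mult[OF s s s A, symmetric] block_eval_smult_one[OF s s A]
        kron_id_pow[OF s A] x_def poly_mat_monom[OF A] block_eval_pow[OF s A B])
  also have "\<dots> = poly_mat (q ^ i * Polynomial.monom 1 j) ?X"
    unfolding q by (simp add: poly_mat_mult[OF X] poly_mat_power[OF X] poly_mat_monom[OF X])
  also have "block_eval_vec N s A (vec m (\<lambda>_. 1)) = vec N (\<lambda>_. 1)"
    by (rule block_eval_vec_ones[OF s A])
  also have "poly_mat (q ^ i * Polynomial.monom 1 j) ?X *\<^sub>v \<dots> = walk_mat ?X *\<^sub>v
      (poly_mat (q ^ i * Polynomial.monom 1 j) (companion_mat (char_poly ?X)) *\<^sub>v unit_vec N 0)"
    by (rule poly_mat_mult_ones[OF X]) (use J in auto)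
  finally show "\<exists>c \<in> carrier_vec N. col (?U * ?K) J = walk_mat ?X *\<^sub>v c"
    by (rule bexI) (intro mult_mat_vec_carrier[of _ N N] poly_mat_carrier companion_mat_char_poly_carrier X
        unit_vec_carrier)
qed

text \<open>The two factorizations combine to \<open>V T T' = V\<close> with
  \<open>V = U (W \<otimes> I)\<close> non-singular, so \<open>T T' = I\<close>.\<close>

lemma walk_mat_block_eval_decomposition:
  fixes A :: "'a::idom mat"
  assumes A: "A \<in> carrier_mat n n" and B: "B \<in> carrier_mat m m" and "0 < n" "0 < m"
    and q: "kron_id N s s A = poly_mat q (block_eval N s s A B)"
    and det: "det A dvd 1" "det (walk_mat A) \<noteq> 0"
    and detB: "det (walk_mat B) \<in> {Polynomial.monom 1 k, - Polynomial.monom 1 k}"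
  shows "\<exists>T \<in> carrier_mat N N. det T dvd 1 \<and> walk_mat (block_eval N s s A B) =
    block_eval N s t A (walk_mat B) * kron_id N t t (walk_mat A) * T"
proof -
  let ?X = "walk_mat (block_eval N s s A B)" and ?K = "kron_id N t t (walk_mat A)"
    and ?U = "block_eval N s t A (walk_mat B)"
  have X: "?X \<in> carrier_mat N N" and U: "?U \<in> carrier_mat N N" and K: "?K \<in> carrier_mat N N" by auto
  have UK: "?U * ?K \<in> carrier_mat N N" using U K by (rule mult_carrier_mat)
  obtain T where T: "T \<in> carrier_mat N N" "?X = ?U * ?K * T"
    using walk_mat_block_eval_factor[OF A B \<open>0 < n\<close> \<open>0 < m\<close>] by blast
  obtain T' where T': "T' \<in> carrier_mat N N" "?U * ?K = ?X * T'"
    using block_eval_factor_walk_mat[OF A B \<open>0 < n\<close> \<open>0 < m\<close> q] by blast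
  have "det ?U dvd 1"
    using walk_mat_carrier[OF B] by (intro det_block_eval_dvd_1[OF A det(1) _ detB])
  then have "det ?U \<noteq> 0" by auto
  moreover have "det ?K dvd det (walk_mat A) ^ N"
    using A by (intro det_kron_id_dvd[OF t]) auto
  then have "det ?K \<noteq> 0" using det(2) by (auto simp: power_0_left split: if_splits)
  ultimately have nz: "det (?U * ?K) \<noteq> 0" using det_mult[OF U K] by simp
  have eq: "?U * ?K * (T * T') = ?U * ?K * 1\<^sub>m N"
    unfolding assoc_mult_mat[OF UK T(1) T'(1), symmetric] T(2)[symmetric] T'(2)[symmetric]
      right_mult_one_mat[OF UK] ..
  have "T * T' = 1\<^sub>m N"
    by (rule mult_mat_left_cancel[OF UK mult_carrier_mat[OF T(1) T'(1)] one_carrier_mat nz eq])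
  then have "det T dvd 1" by (rule unit_det_of_right_inverse(1)[OF T(1) T'(1)])
  with T show ?thesis by blast
qed

text \<open>Evaluation is an algebra homomorphism, with scalars embedded as constant polynomials. It
  transports identities such as Cayley--Hamilton from \<open>B\<close> to the evaluated
  matrix.\<close>

lemma poly_mat_block_eval:
  assumes A: "A \<in> carrier_mat n n" and B: "B \<in> carrier_mat m m"
  shows "poly_mat p (block_eval N s s A B) = block_eval N s s A (poly_mat (map_poly (\<lambda>a. [:a:]) p) B)"
proof (induction p)
  case 0
  have "block_eval N s s A (0\<^sub>m m m) = block_eval N s s A (0 \<cdot>\<^sub>m 1\<^sub>m m)"
    by (rule arg_cong[where f = "block_eval N s s A"]) (auto intro!: eq_matI)
  also have "\<dots> = kron_id N s s (0\<^sub>m n n)"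
    using A by (simp add: block_eval_smult_one[OF s s])
  also have "\<dots> = 0\<^sub>m N N"
  proof (rule eq_matI)
    fix I J assume "I < dim_row (0\<^sub>m N N :: 'a mat)" "J < dim_col (0\<^sub>m N N :: 'a mat)"
    then have IJ: "I < N" "J < N" by auto
    then have "fst (s I) < n" "fst (s J) < n" using bij_betwE[OF s] by (auto simp: mem_Times_iff)
    then show "kron_id N s s (0\<^sub>m n n) $$ (I, J) = (0\<^sub>m N N :: 'a mat) $$ (I, J)"
      using IJ by (simp add: kron_id_def block_mat_def)
  qed auto
  finally show ?case using B by (simp add: poly_mat_0[of _ N] poly_mat_0[of _ m])
next
  case (pCons a p)
  let ?h = "map_poly (\<lambda>a. [:a:])"
  have P: "poly_mat (?h p) B \<in> carrier_mat m m" using B by simp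
  have "[:a:] \<cdot>\<^sub>m 1\<^sub>m m \<in> carrier_mat m m" by simp
  then have "block_eval N s s A (poly_mat (?h (pCons a p)) B) =
      block_eval N s s A ([:a:] \<cdot>\<^sub>m 1\<^sub>m m) + block_eval N s s A (B * poly_mat (?h p) B)"
    using B P by (simp add: Polynomial.map_poly_pCons poly_mat_pCons block_eval_add[OF s s A])
  also have "block_eval N s s A ([:a:] \<cdot>\<^sub>m 1\<^sub>m m) = a \<cdot>\<^sub>m 1\<^sub>m N"
  proof -
    have "block_eval N s s A ([:a:] \<cdot>\<^sub>m 1\<^sub>m m) = kron_id N s s (a \<cdot>\<^sub>m 1\<^sub>m n)"
      using A by (simp add: block_eval_smult_one[OF s s] poly_mat_const)
    also have "\<dots> = a \<cdot>\<^sub>m kron_id N s s (1\<^sub>m n)"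
    proof (rule eq_matI)
      fix I J assume "I < dim_row (a \<cdot>\<^sub>m kron_id N s s (1\<^sub>m n))" "J < dim_col (a \<cdot>\<^sub>m kron_id N s s (1\<^sub>m n))"
      then have IJ: "I < N" "J < N" by auto
      then have "fst (s I) < n" "fst (s J) < n" using bij_betwE[OF s] by (auto simp: mem_Times_iff)
      then show "kron_id N s s (a \<cdot>\<^sub>m 1\<^sub>m n) $$ (I, J) = (a \<cdot>\<^sub>m kron_id N s s (1\<^sub>m n)) $$ (I, J)"
        using IJ by (simp add: kron_id_def block_mat_def)
    qed auto
    finally show ?thesis by (simp add: kron_id_one[OF s])
  qed
  also have "block_eval N s s A (B * poly_mat (?h p) B) =
      block_eval N s s A B * poly_mat p (block_eval N s s A B)"
    using B P pCons by (simp add: block_eval_mult[OF s s s A])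
  finally show ?case by (simp add: poly_mat_pCons[of _ N])
qed

text \<open>By Cayley--Hamilton \<open>f(X) = (A \<otimes> I) g(X)\<close>, and the Bezout identity makes \<open>g(X)\<close> invertible, with
  an inverse that is again a polynomial in \<open>X\<close>.\<close>

lemma kron_id_as_poly_mat:
  assumes A: "A \<in> carrier_mat n n" and B: "B \<in> carrier_mat m m"
    and char_poly: "char_poly B =
      map_poly (\<lambda>a. [:a:]) f - smult [:0, 1:] (map_poly (\<lambda>a. [:a:]) g)"
    and bezout: "a * f + b * g = 1"
  shows "\<exists>q. kron_id N s s A = poly_mat q (block_eval N s s A B)"
proof -
  let ?X = "block_eval N s s A B" and ?K = "kron_id N s s A" and ?h = "map_poly (\<lambda>a. [:a:])"
  define G where "G = poly_mat g ?X"
  have X: "?X \<in> carrier_mat N N" and K: "?K \<in> carrier_mat N N" by auto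
  have G: "G \<in> carrier_mat N N" by (simp add: G_def)
  have P: "poly_mat p ?X \<in> carrier_mat N N" for p using X by simp
  have "?h f = char_poly B + smult [:0, 1:] (?h g)" using char_poly by simp
  then have "poly_mat (?h f) B = 0\<^sub>m m m + [:0, 1:] \<cdot>\<^sub>m poly_mat (?h g) B"
    using B by (simp add: poly_mat_add poly_mat_smult poly_mat_char_poly)
  also have "\<dots> = ([:0, 1:] \<cdot>\<^sub>m 1\<^sub>m m) * poly_mat (?h g) B"
    using B by (simp add: mult_smult_assoc_mat[of _ m m _ m] left_add_zero_mat[of _ m m])
  finally have "poly_mat (?h f) B = ([:0, 1:] \<cdot>\<^sub>m 1\<^sub>m m) * poly_mat (?h g) B" .
  then have fX: "poly_mat f ?X = ?K * G"
    using A B unfolding G_def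
    by (simp add: poly_mat_block_eval[OF A B] block_eval_mult[OF s s s A, symmetric]
        block_eval_smult_one[OF s s A] poly_mat_X[OF A, unfolded pCons_one])
  have "1\<^sub>m N = poly_mat (a * f + b * g) ?X" unfolding bezout poly_mat_1[OF X] ..
  also have "\<dots> = poly_mat a ?X * (?K * G) + poly_mat b ?X * G"
    by (simp add: poly_mat_add[OF X] poly_mat_mult[OF X] fX G_def)
  also have "\<dots> = (poly_mat a ?X * ?K + poly_mat b ?X) * G"
    using P[of a] P[of b] K G
    by (simp add: add_mult_distrib_mat[of _ N N _ _ N] assoc_mult_mat[of _ N N _ N _ N] mult_carrier_mat[of _ N N])
  \<comment> \<open>The Bezout identity has become
    \<open>(a(X) (A \<otimes> I) + b(X)) G = I\<close>, so \<open>G\<close> has a left inverse over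
    the ring.\<close>
  finally have "det G dvd 1"
    using P[of a] P[of b] K G by (intro unit_det_of_right_inverse(2)[of _ N]) (auto intro!: mult_carrier_mat[of _ N N])
  then obtain u where "det G * u = 1" by (metis dvdE)
  from inverse_as_poly_mat[OF G this] obtain r where r: "poly_mat r G * G = 1\<^sub>m N" by blast
  have "?K = ?K * (G * poly_mat r G)" using r K by (simp add: poly_mat_commute[OF G, symmetric] right_mult_one_mat[of _ N N])
  also have "\<dots> = poly_mat f ?X * poly_mat r G"
    using K G by (simp add: fX assoc_mult_mat[of _ N N _ N _ N])
  also have "\<dots> = poly_mat (f * pcompose r g) ?X"
    by (simp add: G_def poly_mat_pcompose[OF X] poly_mat_mult[OF X])
  finally show ?thesis by blast
qed

end

section \<open>Kernels over prime fields\<close>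

lemma mem_kernel_mod_iff:
  "x \<in> carrier (kernel_mod p M) \<longleftrightarrow> x \<in> carrier_vec (dim_col M) \<and>
    (\<forall>i < dim_col M. x $ i \<in> {0 ..< int p}) \<and> (\<forall>i < dim_row M. int p dvd (M *\<^sub>v x) $ i)"
  by (simp add: kernel_mod_def)

lemma mult_mat_vec_cong:
  fixes M :: "int mat"
  assumes "x \<in> carrier_vec (dim_col M)" "y \<in> carrier_vec (dim_col M)" "i < dim_row M"
    and "\<And>j. j < dim_col M \<Longrightarrow> [x $ j = y $ j] (mod q)"
  shows "[(M *\<^sub>v x) $ i = (M *\<^sub>v y) $ i] (mod q)"
  using assms by (auto simp: scalar_prod_def intro!: cong_sum cong_mult)

lemma dvd_mult_mat_vec_mod:
  fixes M :: "int mat"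
  assumes "x \<in> carrier_vec (dim_col M)" "i < dim_row M"
  shows "q dvd (M *\<^sub>v map_vec (\<lambda>a. a mod q) x) $ i \<longleftrightarrow> q dvd (M *\<^sub>v x) $ i"
proof -
  have "[(M *\<^sub>v map_vec (\<lambda>a. a mod q) x) $ i = (M *\<^sub>v x) $ i] (mod q)"
    using assms by (intro mult_mat_vec_cong) (auto simp: cong_def)
  then show ?thesis by (simp add: cong_dvd_iff)
qed

lemma dvd_mult_mat_vec:
  fixes M :: "int mat"
  assumes "x \<in> carrier_vec (dim_col M)" "i < dim_row M" "\<And>j. j < dim_col M \<Longrightarrow> q dvd x $ j"
  shows "q dvd (M *\<^sub>v x) $ i"
  using assms by (auto simp: scalar_prod_def intro!: dvd_sum dvd_mult)

lemma finite_vecs_in: "finite S \<Longrightarrow> finite {x \<in> carrier_vec n. \<forall>i < n. x $ i \<in> S}"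
proof (rule finite_subset)
  show "{x \<in> carrier_vec n. \<forall>i < n. x $ i \<in> S} \<subseteq> vec n ` ({..<n} \<rightarrow>\<^sub>E S)"
  proof
    fix x assume x: "x \<in> {x \<in> carrier_vec n. \<forall>i < n. x $ i \<in> S}"
    then have "x = vec n (restrict (\<lambda>i. x $ i) {..<n})" by (intro eq_vecI) auto
    then show "x \<in> vec n ` ({..<n} \<rightarrow>\<^sub>E S)" using x by auto
  qed
qed (auto intro: finite_PiE)

lemma finite_kernel_mod: "finite (carrier (kernel_mod p M))"
  by (rule finite_subset[OF _ finite_vecs_in[of "{0 ..< int p}" "dim_col M"]]) (auto simp: mem_kernel_mod_iff)

text \<open>The axioms are checked entrywise on representatives. They connect
  \<open>vectorspace.dim\<close>, through which \<open>nullity_mod\<close> is defined, with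
  bases.\<close>

lemma vectorspace_kernel_mod:
  assumes "prime p"
  shows "vectorspace (residue_ring (int p)) (kernel_mod p M)"
proof -
  let ?q = "int p" and ?V = "kernel_mod p M" and ?c = "dim_col M" and ?r = "dim_row M"
  have p: "?q > 1" using assms prime_gt_1_nat by simp
  interpret residues_prime p "residue_ring ?q" by (unfold_locales) (use assms p in auto)
  \<comment> \<open>Reducing the entries does not affect divisibility of the image by p, so closure
    becomes a statement about unreduced sums and multiples.\<close>
  have red: "map_vec (\<lambda>a. a mod ?q) x \<in> carrier ?V"
    if "x \<in> carrier_vec ?c" "\<And>i. i < ?r \<Longrightarrow> ?q dvd (M *\<^sub>v x) $ i" for x
    using that p by (auto simp: mem_kernel_mod_iff dvd_mult_mat_vec_mod simp del: index_mult_mat_vec)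
  have add: "?q dvd (M *\<^sub>v (x + y)) $ i"
    if "x \<in> carrier ?V" "y \<in> carrier ?V" "i < ?r" for x y i
    using that unfolding mem_kernel_mod_iff
    by (auto simp: mult_add_distrib_mat_vec[of _ ?r ?c] scalar_prod_add_distrib[of _ ?c])
  have smult: "?q dvd (M *\<^sub>v (c \<cdot>\<^sub>v x)) $ i" if "x \<in> carrier ?V" "i < ?r" for x c i
    using that unfolding mem_kernel_mod_iff
    by (auto simp: mult_mat_smult_vec[of _ ?r ?c] scalar_prod_smult_distrib[of _ ?c])
  have mem: "x \<in> carrier_vec ?c" "i < ?c \<Longrightarrow> x $ i mod ?q = x $ i" if "x \<in> carrier ?V" for x i
    using that by (auto simp: mem_kernel_mod_iff)
  have ops: "x \<oplus>\<^bsub>?V\<^esub> y = map_vec (\<lambda>a. a mod ?q) (x + y)"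
    "c \<odot>\<^bsub>?V\<^esub> x = map_vec (\<lambda>a. a mod ?q) (c \<cdot>\<^sub>v x)" "\<zero>\<^bsub>?V\<^esub> = 0\<^sub>v ?c" for x y c
    by (simp_all add: kernel_mod_def)
  have ring: "a \<oplus>\<^bsub>residue_ring ?q\<^esub> b = (a + b) mod ?q" "a \<otimes>\<^bsub>residue_ring ?q\<^esub> b = (a * b) mod ?q"
    "\<one>\<^bsub>residue_ring ?q\<^esub> = 1" for a b
    by (simp_all add: residue_ring_def)
  show ?thesis
  proof (rule vs_criteria; (intro allI ballI impI)?; (elim conjE)?)
    show "field (residue_ring ?q)" by (rule is_field)
    show "\<zero>\<^bsub>?V\<^esub> \<in> carrier ?V" using p by (auto simp: ops mem_kernel_mod_iff)
    fix x assume x: "x \<in> carrier ?V"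
    show "\<exists>y\<in>carrier ?V. x \<oplus>\<^bsub>?V\<^esub> y = \<zero>\<^bsub>?V\<^esub>"
    proof
      show "map_vec (\<lambda>a. a mod ?q) ((- 1) \<cdot>\<^sub>v x) \<in> carrier ?V"
        using x smult mem by (intro red) auto
      show "x \<oplus>\<^bsub>?V\<^esub> map_vec (\<lambda>a. a mod ?q) ((- 1) \<cdot>\<^sub>v x) = \<zero>\<^bsub>?V\<^esub>"
        using mem[OF x] by (intro eq_vecI) (auto simp: ops mod_simps)
    qed
    show "x \<oplus>\<^bsub>?V\<^esub> \<zero>\<^bsub>?V\<^esub> = x" "\<one>\<^bsub>residue_ring ?q\<^esub> \<odot>\<^bsub>?V\<^esub> x = x"
      using mem[OF x] by (auto simp: ops ring intro!: eq_vecI)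
    fix a assume a: "a \<in> carrier (residue_ring ?q)"
    show "a \<odot>\<^bsub>?V\<^esub> x \<in> carrier ?V" using x smult mem unfolding ops by (intro red) auto
    fix b assume b: "b \<in> carrier (residue_ring ?q)"
    show "(a \<otimes>\<^bsub>residue_ring ?q\<^esub> b) \<odot>\<^bsub>?V\<^esub> x = a \<odot>\<^bsub>?V\<^esub> (b \<odot>\<^bsub>?V\<^esub> x)"
      using mem[OF x] by (auto simp: ops ring mod_simps ac_simps intro!: eq_vecI)
    show "(a \<oplus>\<^bsub>residue_ring ?q\<^esub> b) \<odot>\<^bsub>?V\<^esub> x = (a \<odot>\<^bsub>?V\<^esub> x) \<oplus>\<^bsub>?V\<^esub> (b \<odot>\<^bsub>?V\<^esub> x)"
      using mem[OF x] by (auto simp: ops ring mod_simps algebra_simps intro!: eq_vecI)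
  next
    fix x y assume x: "x \<in> carrier ?V" and y: "y \<in> carrier ?V"
    show "x \<oplus>\<^bsub>?V\<^esub> y \<in> carrier ?V" using x y add mem unfolding ops by (intro red) auto
    show "x \<oplus>\<^bsub>?V\<^esub> y = y \<oplus>\<^bsub>?V\<^esub> x"
      using mem[OF x] mem[OF y] by (auto simp: ops ac_simps intro!: eq_vecI)
    fix z assume z: "z \<in> carrier ?V"
    show "(x \<oplus>\<^bsub>?V\<^esub> y) \<oplus>\<^bsub>?V\<^esub> z = x \<oplus>\<^bsub>?V\<^esub> (y \<oplus>\<^bsub>?V\<^esub> z)"
      using mem[OF x] mem[OF y] mem[OF z] by (auto simp: ops mod_simps ac_simps intro!: eq_vecI)
  next
    fix a x y assume "a \<in> carrier (residue_ring ?q)" and x: "x \<in> carrier ?V" and y: "y \<in> carrier ?V"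
    show "a \<odot>\<^bsub>?V\<^esub> (x \<oplus>\<^bsub>?V\<^esub> y) = (a \<odot>\<^bsub>?V\<^esub> x) \<oplus>\<^bsub>?V\<^esub> (a \<odot>\<^bsub>?V\<^esub> y)"
      using mem[OF x] mem[OF y] by (auto simp: ops mod_simps algebra_simps intro!: eq_vecI)
  qed
qed

text \<open>The finite carrier spans itself, so a finite basis exists; unique coordinates in F_p
  then identify the kernel with the functions from the basis to F_p. Nullities can now be compared
  by explicit bijections.\<close>

lemma card_kernel_mod:
  assumes "prime p"
  shows "card (carrier (kernel_mod p M)) = p ^ nullity_mod p M"
proof -
  let ?V = "kernel_mod p M" and ?K = "residue_ring (int p)"
  interpret vectorspace ?K ?V by (rule vectorspace_kernel_mod[OF assms])
  have fin_dim
    unfolding fin_dim_def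
    using finite_kernel_mod[of p M] in_own_span[of "carrier ?V"] span_is_subset2[of "carrier ?V"] by blast
  then obtain B where B: "finite B" "basis B" using finite_basis_exists by blast
  have BV: "B \<subseteq> carrier ?V" using B(2) by (simp add: basis_def)
  have "bij_betw (\<lambda>a. lincomb a B) (B \<rightarrow>\<^sub>E carrier ?K) (carrier ?V)"
  proof (rule bij_betwI')
    have ex1: "\<exists>!a. a \<in> B \<rightarrow>\<^sub>E carrier ?K \<and> lincomb a B = x" if "x \<in> carrier ?V" for x
      using basis_criterion[OF B(1) BV] B(2) that by blast
    have cl: "lincomb a B \<in> carrier ?V" if "a \<in> B \<rightarrow>\<^sub>E carrier ?K" for a
      using that BV by (intro lincomb_closed) auto
    fix a b assume "a \<in> B \<rightarrow>\<^sub>E carrier ?K" "b \<in> B \<rightarrow>\<^sub>E carrier ?K"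
    then show "lincomb a B = lincomb b B \<longleftrightarrow> a = b" using ex1 cl by metis
  next
    fix a assume "a \<in> B \<rightarrow>\<^sub>E carrier ?K"
    then show "lincomb a B \<in> carrier ?V" using BV by (intro lincomb_closed) auto
  next
    fix x assume "x \<in> carrier ?V"
    then show "\<exists>a \<in> B \<rightarrow>\<^sub>E carrier ?K. x = lincomb a B"
      using basis_criterion[OF B(1) BV] B(2) by metis
  qed
  then have "card (carrier ?V) = card (B \<rightarrow>\<^sub>E carrier ?K)" by (metis bij_betw_same_card)
  also have "\<dots> = p ^ card B" using B(1) by (simp add: card_PiE residue_ring_def)
  also have "card B = nullity_mod p M" using dim_basis[OF B] by (simp add: nullity_mod_def)
  finally show ?thesis .
qed

text \<open>From \<open>M x = Q (P M x)\<close> with \<open>Q\<close> the inverse of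
  \<open>P\<close>: both kernels are cut out by the same condition, so they agree even as
  sets.\<close>

lemma kernel_mod_mult_left:
  assumes P: "P \<in> carrier_mat n n" and det: "det P dvd 1" and M: "M \<in> carrier_mat n k"
  shows "carrier (kernel_mod p (P * M)) = carrier (kernel_mod p M)"
proof -
  from mat_inverse_of_unit_det[OF P det]
  obtain Q where Q: "Q \<in> carrier_mat n n" "Q * P = 1\<^sub>m n" by blast
  have "(\<forall>i<n. int p dvd (P * M *\<^sub>v x) $ i) \<longleftrightarrow> (\<forall>i<n. int p dvd (M *\<^sub>v x) $ i)"
    if x: "x \<in> carrier_vec k" for x
  proof -
    have y: "M *\<^sub>v x \<in> carrier_vec n" using M x by simp
    have PM: "P * M *\<^sub>v x = P *\<^sub>v (M *\<^sub>v x)" by (rule assoc_mult_mat_vec[OF P M x])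
    have "Q *\<^sub>v (P *\<^sub>v (M *\<^sub>v x)) = M *\<^sub>v x"
      using assoc_mult_mat_vec[OF Q(1) P y] Q(2) y by simp
    then have "M *\<^sub>v x = Q *\<^sub>v (P * M *\<^sub>v x)" unfolding PM ..
    then show ?thesis
      using dvd_mult_mat_vec[of "M *\<^sub>v x" P _ "int p"] dvd_mult_mat_vec[of "P * M *\<^sub>v x" Q _ "int p"]
        P Q(1) y PM mult_mat_vec_carrier[OF P y]
      by (metis carrier_matD carrier_vecD)
  qed
  then show ?thesis using P M by (auto simp: mem_kernel_mod_iff simp del: index_mult_mat_vec)
qed

text \<open>The map \<open>x \<mapsto> Q x mod p\<close> into the kernel of \<open>M\<close> is
  injective because \<open>Q\<close> has an integer inverse.\<close>

lemma card_kernel_mod_mult_right_le: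
  assumes Q: "Q \<in> carrier_mat k k" and det: "det Q dvd 1" and M: "M \<in> carrier_mat n k"
  shows "card (carrier (kernel_mod p (M * Q))) \<le> card (carrier (kernel_mod p M))"
\<comment> \<open>Reduction modulo p lands in \<open>{0..<p}\<close> only for positive p. For p = 0
  this range is empty, and so is every kernel when \<open>k > 0\<close>.\<close>
proof (cases "p = 0")
  case True
  show ?thesis
  proof (cases "k = 0")
    case True
    then have "M * Q = M" using M Q by (intro eq_matI) auto
    then show ?thesis by simp
  next
    case False
    then have "carrier (kernel_mod p (M * Q)) = {}" using Q True by (auto simp: mem_kernel_mod_iff)
    then show ?thesis by simp
  qed
next
  case False
  define F where "F = (\<lambda>x. map_vec (\<lambda>a. a mod int p) (Q *\<^sub>v x))"
  from mat_inverse_of_unit_det[OF Q det]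
  obtain R where R: "R \<in> carrier_mat k k" "R * Q = 1\<^sub>m k" by blast
  have mem: "x \<in> carrier_vec k" "\<And>i. i < k \<Longrightarrow> x $ i \<in> {0..<int p}"
      "\<And>i. i < n \<Longrightarrow> int p dvd (M *\<^sub>v (Q *\<^sub>v x)) $ i"
    if "x \<in> carrier (kernel_mod p (M * Q))" for x
    using that M Q assoc_mult_mat_vec[OF M Q]
    by (auto simp: mem_kernel_mod_iff simp del: index_mult_mat_vec)
  show ?thesis
  proof (rule card_inj_on_le)
    show "F ` carrier (kernel_mod p (M * Q)) \<subseteq> carrier (kernel_mod p M)"
    proof
      fix y assume "y \<in> F ` carrier (kernel_mod p (M * Q))"
      then obtain x where x: "x \<in> carrier (kernel_mod p (M * Q))" and y: "y = F x" by blast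
      show "y \<in> carrier (kernel_mod p M)"
        using mem[OF x] M Q False
        by (auto simp: y F_def mem_kernel_mod_iff dvd_mult_mat_vec_mod simp del: index_mult_mat_vec)
    qed
    show "inj_on F (carrier (kernel_mod p (M * Q)))"
    proof (rule inj_onI)
      fix x y assume x: "x \<in> carrier (kernel_mod p (M * Q))" and y: "y \<in> carrier (kernel_mod p (M * Q))"
        and F: "F x = F y"
      have Qxy: "[(Q *\<^sub>v x) $ i = (Q *\<^sub>v y) $ i] (mod int p)" if "i < k" for i
        using arg_cong[OF F, of "\<lambda>v. v $ i"] that Q
        by (simp add: F_def cong_def del: index_mult_mat_vec)
      have "[(R *\<^sub>v (Q *\<^sub>v x)) $ i = (R *\<^sub>v (Q *\<^sub>v y)) $ i] (mod int p)" if "i < k" for i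
        by (rule mult_mat_vec_cong) (use that Qxy Q R mem(1)[OF x] mem(1)[OF y] in \<open>auto simp del: index_mult_mat_vec\<close>)
      moreover have "R *\<^sub>v (Q *\<^sub>v z) = z" if "z \<in> carrier_vec k" for z
        using that assoc_mult_mat_vec[OF R(1) Q that] R(2) by simp
      ultimately have xy: "[x $ i = y $ i] (mod int p)" if "i < k" for i
        using that mem[OF x] mem[OF y] by simp
      have "x $ i = y $ i" if "i < k" for i
        using xy[OF that] mem(2)[OF x that] mem(2)[OF y that] by (simp add: cong_def)
      then show "x = y" using mem(1)[OF x] mem(1)[OF y] by (intro eq_vecI) auto
    qed
  qed (rule finite_kernel_mod)
qed

lemma card_kernel_mod_mult_right:
  assumes Q: "Q \<in> carrier_mat k k" and det: "det Q dvd 1" and M: "M \<in> carrier_mat n k"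
  shows "card (carrier (kernel_mod p (M * Q))) = card (carrier (kernel_mod p M))"
proof (rule antisym)
  from mat_inverse_of_unit_det[OF Q det]
  obtain R where R: "R \<in> carrier_mat k k" "Q * R = 1\<^sub>m k" by blast
  have "M = M * Q * R" using assoc_mult_mat[OF M Q R(1)] R(2) M by simp
  moreover have "det R dvd 1" using unit_det_of_right_inverse[OF Q R] by simp
  ultimately show "card (carrier (kernel_mod p M)) \<le> card (carrier (kernel_mod p (M * Q)))"
    using card_kernel_mod_mult_right_le[OF R(1) _ mult_carrier_mat[OF M Q], of p] by simp
qed (rule card_kernel_mod_mult_right_le[OF assms])

text \<open>\<open>M \<otimes> I\<close> acts separately on the m slices with fixed second
  coordinate, so a kernel vector is an m-tuple of kernel vectors of \<open>M\<close>;
  \<open>F\<close> glues the slices together along \<open>t\<close>.\<close>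

lemma card_kernel_mod_kron_id:
  assumes t: "bij_betw t {..<N} ({..<n} \<times> {..<m})" and M: "M \<in> carrier_mat n n"
  shows "card (carrier (kernel_mod p (kron_id N t t M))) = card (carrier (kernel_mod p M)) ^ m"
proof -
  define F :: "(nat \<Rightarrow> int vec) \<Rightarrow> int vec" where "F = (\<lambda>f. block_vec N t (\<lambda>a. f (snd a) $ fst a))"
  let ?K = "carrier (kernel_mod p M)"
  have tI: "fst (t I) < n" "snd (t I) < m" if "I < N" for I
    using bij_betwE[OF t] that by (auto simp: mem_Times_iff)
  have ex: "\<exists>I<N. t I = (i, h)" if "i < n" "h < m" for i h
  proof -
    have "(i, h) \<in> t ` {..<N}" using that bij_betw_imp_surj_on[OF t] by simp
    then show ?thesis by auto
  qed
  have all_pairs: "(\<forall>I<N. R (snd (t I)) (fst (t I))) \<longleftrightarrow> (\<forall>h<m. \<forall>i<n. R h i)" for R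
  proof (intro iffI allI impI)
    fix h i assume "\<forall>I<N. R (snd (t I)) (fst (t I))" "h < m" "i < n"
    then show "R h i" using ex[of i h] by force
  qed (use tI in blast)
  have F_idx: "F f $ I = f (snd (t I)) $ fst (t I)" if "I < N" for f I
    using that by (simp add: F_def block_vec_def)
  have dimF: "dim_vec (F f) = N" for f by (simp add: F_def block_vec_def)
  have kronF: "(kron_id N t t M *\<^sub>v F f) $ I = (M *\<^sub>v f (snd (t I))) $ fst (t I)"
    if "I < N" "\<And>h. h < m \<Longrightarrow> f h \<in> carrier_vec n" for I f
  proof -
    have "dim_vec (f (snd (t I))) = n" using that(2)[OF tI(2)[OF that(1)]] by simp
    then show ?thesis unfolding F_def kron_id_mult_vec[OF t t] using that(1) tI[OF that(1)] M
      by (simp add: block_vec_def scalar_prod_def atLeast0LessThan)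
  qed
  have mem: "F f \<in> carrier (kernel_mod p (kron_id N t t M)) \<longleftrightarrow> (\<forall>h<m. f h \<in> ?K)"
    if "\<And>h. h < m \<Longrightarrow> f h \<in> carrier_vec n" for f
  proof -
    have "F f \<in> carrier (kernel_mod p (kron_id N t t M)) \<longleftrightarrow>
      (\<forall>I<N. F f $ I \<in> {0..<int p} \<and> int p dvd (kron_id N t t M *\<^sub>v F f) $ I)"
    proof -
      have "F f \<in> carrier_vec N" by (simp add: F_def)
      then show ?thesis unfolding mem_kernel_mod_iff kron_id_dim by blast
    qed
    also have "\<dots> \<longleftrightarrow> (\<forall>I<N. f (snd (t I)) $ fst (t I) \<in> {0..<int p} \<and> int p dvd (M *\<^sub>v f (snd (t I))) $ fst (t I))"
      using kronF[OF _ that] F_idx by simp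
    also have "\<dots> \<longleftrightarrow> (\<forall>h<m. \<forall>i<n. f h $ i \<in> {0..<int p} \<and> int p dvd (M *\<^sub>v f h) $ i)"
      by (rule all_pairs[of "\<lambda>h i. f h $ i \<in> {0..<int p} \<and> int p dvd (M *\<^sub>v f h) $ i"])
    also have "\<dots> \<longleftrightarrow> (\<forall>h<m. f h \<in> ?K)"
      using that M
      by (simp add: mem_kernel_mod_iff del: index_mult_mat_vec atLeastLessThan_iff) blast
    finally show ?thesis .
  qed
  have "bij_betw F ({..<m} \<rightarrow>\<^sub>E ?K) (carrier (kernel_mod p (kron_id N t t M)))"
  proof (rule bij_betwI')
    fix f g assume f: "f \<in> {..<m} \<rightarrow>\<^sub>E ?K" and g: "g \<in> {..<m} \<rightarrow>\<^sub>E ?K"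
    have c: "f h \<in> carrier_vec n" "g h \<in> carrier_vec n" if "h < m" for h
      using f g M that by (auto simp: mem_kernel_mod_iff dest!: PiE_mem[of _ _ _ h])
    show "F f = F g \<longleftrightarrow> f = g"
    proof
      assume "F f = F g"
      have "f h = g h" if h: "h < m" for h
      proof (rule eq_vecI)
        fix i assume "i < dim_vec (g h)"
        then have "i < n" using c[OF h] by simp
        with ex h obtain I where "I < N" "t I = (i, h)" by blast
        then show "f h $ i = g h $ i" using F_idx[of I f] F_idx[of I g] \<open>F f = F g\<close> by simp
      qed (use c[OF h] in auto)
      then show "f = g" using f g by (intro PiE_ext) auto
    qed simp
  next
    fix f assume f: "f \<in> {..<m} \<rightarrow>\<^sub>E ?K"
    then have K: "f h \<in> ?K" if "h < m" for h using that by auto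
    then have "f h \<in> carrier_vec n" if "h < m" for h using M that by (auto simp: mem_kernel_mod_iff)
    then show "F f \<in> carrier (kernel_mod p (kron_id N t t M))" using mem K by blast
  next
    fix x assume x: "x \<in> carrier (kernel_mod p (kron_id N t t M))"
    then have dimx: "dim_vec x = N" by (simp add: mem_kernel_mod_iff)
    define f where "f = restrict (\<lambda>h. vec n (\<lambda>i. x $ inv_into {..<N} t (i, h))) {..<m}"
    have Ff: "F f = x"
    proof (rule eq_vecI)
      fix I assume "I < dim_vec x"
      then have I: "I < N" using dimx by simp
      then have "inv_into {..<N} t (t I) = I" using t by (simp add: bij_betw_def inv_into_f_f)
      then show "F f $ I = x $ I" using I tI[OF I] by (simp add: F_idx f_def)
    qed (simp add: dimx dimF)
    have "f h \<in> carrier_vec n" if "h < m" for h using that by (simp add: f_def)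
    with mem[of f] x Ff have "\<forall>h<m. f h \<in> ?K" by simp
    then have "f \<in> {..<m} \<rightarrow>\<^sub>E ?K" by (auto simp: f_def)
    with Ff show "\<exists>f \<in> {..<m} \<rightarrow>\<^sub>E ?K. x = F f" by blast
  qed
  then have "card (carrier (kernel_mod p (kron_id N t t M))) = card ({..<m} \<rightarrow>\<^sub>E ?K)"
    by (metis bij_betw_same_card)
  then show ?thesis by (simp add: card_PiE)
qed

section \<open>Bezout identities and greatest common divisors modulo a prime\<close>

text \<open>In the polynomial form of the Sylvester matrix, \<open>subresultant_mat 0\<close>, the
  last row consists of monomial multiples of \<open>f\<close> and \<open>g\<close>. Expansion along
  it writes the resultant as a combination of both with coefficients in the ring. Positive total
  degree guarantees that there is a last row.\<close>

lemma bezout_of_resultant: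
  fixes f g :: "'a::idom poly"
  assumes res: "resultant f g dvd 1" and deg: "0 < degree f + degree g"
  shows "\<exists>a b. a * f + b * g = 1"
proof -
  define n where "n = degree f + degree g"
  let ?S = "subresultant_mat 0 f g"
  have S: "?S \<in> carrier_mat n n" by (rule carrier_matI) (simp_all add: n_def)
  have "[:resultant f g:] = (\<Sum>j<n. ?S $$ (n - 1, j) * cofactor ?S (n - 1) j)"
    unfolding subresultant_resultant[symmetric] subresultant_def
    by (rule laplace_expansion_row[OF S]) (use deg in \<open>simp add: n_def\<close>)
  moreover have "\<exists>a b. a * f + b * g = (\<Sum>j\<in>J. ?S $$ (n - 1, j) * cofactor ?S (n - 1) j)"
    if "J \<subseteq> {..<n}" "finite J" for J
    using that(2,1)
  proof (induction J rule: finite_induct)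
    case empty
    then show ?case by (intro exI[of _ 0]) simp
  next
    case (insert j J)
    then obtain a b where ab: "a * f + b * g = (\<Sum>j\<in>J. ?S $$ (n - 1, j) * cofactor ?S (n - 1) j)"
      by auto
    have "\<exists>a' b'. ?S $$ (n - 1, j) = a' * f + b' * g"
    proof -
      have S_last: "?S $$ (n - 1, j) = (if j < degree g then Polynomial.monom 1 (degree g - 1 - j) * f
          else Polynomial.monom 1 (degree f - 1 - (j - degree g)) * g)"
        using insert.prems deg by (subst subresultant_index_mat) (simp_all add: n_def Let_def)
      show ?thesis
      proof (cases "j < degree g")
        case True
        then show ?thesis unfolding S_last
          by (intro exI[of _ "Polynomial.monom 1 (degree g - 1 - j)"] exI[of _ 0]) simp
      next
        case False
        then show ?thesis unfolding S_last
          by (intro exI[of _ 0] exI[of _ "Polynomial.monom 1 (degree f - 1 - (j - degree g))"]) simp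
      qed
    qed
    then obtain a' b' where eq: "?S $$ (n - 1, j) = a' * f + b' * g" by blast
    have "(\<Sum>j\<in>insert j J. ?S $$ (n - 1, j) * cofactor ?S (n - 1) j) =
        (a + a' * cofactor ?S (n - 1) j) * f + (b + b' * cofactor ?S (n - 1) j) * g"
      unfolding sum.insert[OF insert.hyps] eq ab[symmetric] by (simp only: algebra_simps)
    from this[symmetric] show ?case by blast
  qed
  from this[OF subset_refl finite_lessThan]
  obtain a b where "a * f + b * g = (\<Sum>j<n. ?S $$ (n - 1, j) * cofactor ?S (n - 1) j)" by blast
  ultimately have ab: "a * f + b * g = [:resultant f g:]" by (simp only:)
  from res obtain u where "1 = resultant f g * u" by (elim dvdE)
  then have "[:u:] * [:resultant f g:] = 1" by (simp add: mult.commute pCons_one)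
  then have "([:u:] * a) * f + ([:u:] * b) * g = 1"
    unfolding ab[symmetric] by (simp only: distrib_left mult.assoc)
  then show ?thesis by blast
qed

lemma monic_division:
  fixes d :: "'a::idom poly"
  assumes "lead_coeff d = 1"
  obtains q r where "f = d * q + r" "r = 0 \<or> degree r < degree d"
proof -
  obtain q r where qr: "pseudo_divmod f d = (q, r)" by fastforce
  have "d \<noteq> 0" using assms by auto
  from pseudo_divmod[OF this qr] that[of q r] assms show ?thesis by simp
qed

section \<open>Polynomials over F_p, represented by integer polynomials\<close>

context poly_mod_prime
begin

lemma Mp_eq_0_iff: "Mp f = 0 \<longleftrightarrow> (\<forall>i. p dvd coeff f i)"
  by (auto simp: poly_eq_iff Mp_coeff M_def dvd_eq_mod_eq_0)

text \<open>Turns a congruence into an equation with an explicit multiple of \<open>p\<close>, to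
  which ring normalisation applies.\<close>

lemma Mp_eq_iff: "Mp f = Mp g \<longleftrightarrow> (\<exists>r. f = g + smult p r)"
proof
  assume "Mp f = Mp g"
  then show "\<exists>r. f = g + smult p r"
    using Dp_Mp_eq[of f] Dp_Mp_eq[of g]
    by (intro exI[of _ "Dp f - Dp g"]) (simp add: smult_diff_right algebra_simps)
next
  assume "\<exists>r. f = g + smult p r"
  then obtain r where "f = g + smult p r" ..
  then show "Mp f = Mp g" using plus_Mp(2)[of g "smult p r"] by simp
qed

text \<open>The leading coefficient of \<open>d * Mp h\<close> is that of \<open>Mp h\<close>. It is
  already reduced, so it vanishes modulo \<open>p\<close> only if \<open>Mp h\<close> is
  zero.\<close>

lemma monic_mult_eq_0_mod:
  assumes d: "lead_coeff d = 1" and "Mp (d * h) = 0"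
  shows "Mp h = 0"
proof (rule ccontr)
  assume h: "Mp h \<noteq> 0"
  have "lead_coeff (d * Mp h) = lead_coeff (Mp h)" using d by (rule lead_coeff_monic_mult)
  then have "M (lead_coeff (Mp h)) = coeff (Mp (d * Mp h)) (degree (d * Mp h))"
    by (simp only: Mp_coeff)
  also have "Mp (d * Mp h) = 0" using assms(2) by (simp only: mult_Mp)
  finally have "lead_coeff (Mp h) = 0" by (metis M_M Mp_coeff coeff_0)
  then show False using h by simp
qed

text \<open>\<open>I\<close> is the preimage in \<int>[x] of the ideal generated by \<open>f\<close>
  and \<open>g\<close> modulo \<open>p\<close>. A monic element of least degree exists because
  \<open>f\<close> is monic; division by it is possible over \<int>, and minimality kills the
  remainder modulo \<open>p\<close>.\<close>

lemma monic_gcd_exists: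
  assumes f: "lead_coeff f = 1"
  obtains d u v where "Mp d = d" "lead_coeff d = 1" "d dvdm f" "d dvdm g" "Mp d = Mp (u * f + v * g)"
proof -
  define I where "I = {h. \<exists>u v. Mp h = Mp (u * f + v * g)}"
  have sub: "h - w * d \<in> I" if "h \<in> I" "d \<in> I" for h w d
  proof -
    from that obtain u v u' v' where "Mp h = Mp (u * f + v * g)" "Mp d = Mp (u' * f + v' * g)"
      by (auto simp: I_def)
    then obtain r r' where "h = u * f + v * g + smult p r" "d = u' * f + v' * g + smult p r'"
      unfolding Mp_eq_iff by auto
    then have "h - w * d = (u - w * u') * f + (v - w * v') * g + smult p (r - w * r')"
      by (simp add: algebra_simps smult_diff_right)
    then show ?thesis unfolding I_def Mp_eq_iff by blast
  qed
  have Mp_I: "Mp h \<in> I" if "h \<in> I" for h using that by (simp add: I_def)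
  have zero: "0 \<in> I" by (auto simp: I_def intro!: exI[of _ 0])
  have fI: "f \<in> I" unfolding I_def by (rule CollectI, rule exI[of _ 1], rule exI[of _ 0]) simp
  have gI: "g \<in> I" unfolding I_def by (rule CollectI, rule exI[of _ 0], rule exI[of _ 1]) simp
  obtain d where d: "d \<in> I" "lead_coeff d = 1"
    and min: "\<And>h. h \<in> I \<Longrightarrow> lead_coeff h = 1 \<Longrightarrow> degree d \<le> degree h"
    using ex_has_least_nat[of "\<lambda>h. h \<in> I \<and> lead_coeff h = 1" f degree] f fI by blast
  have dvd: "d dvdm h" if h: "h \<in> I" for h
  proof -
    obtain q r where qr: "h = d * q + r" "r = 0 \<or> degree r < degree d"
      using monic_division[OF d(2)] by blast
    have "r = h - q * d" using qr by simp
    then have rI: "r \<in> I" using sub h d by simp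
    have "Mp r = 0"
    proof (rule ccontr)
      assume r: "Mp r \<noteq> 0"
      define c where "c = lead_coeff (Mp r)"
      have "c mod p = c" unfolding c_def by (metis M_def Mp_Mp Mp_coeff)
      moreover have "c \<noteq> 0" using r by (simp add: c_def)
      ultimately have "\<not> p dvd c" by auto
      then have "algebraic_semidom_class.coprime c p" using prime_imp_coprime[OF prime] by (simp add: algebraic_semidom_class.coprime_commute)
      \<comment> \<open>A remainder that is non-zero modulo \<open>p\<close> becomes monic when
        multiplied by the inverse \<open>e\<close> of its leading coefficient, and would be an
        element of \<open>I\<close> of too small a degree.\<close>
      then obtain e where e: "[c * e = 1] (mod p)" using cong_solve_coprime_int by blast
      define h where "h = Mp (smult e (Mp r))"
      have "h = Mp (0 - [:- e:] * Mp r)" by (simp add: h_def)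
      then have hI: "h \<in> I" using Mp_I sub zero rI by metis
      have ch: "coeff h i = (e * coeff (Mp r) i) mod p" for i by (simp add: h_def Mp_coeff M_def mod_simps)
      have lead: "coeff h (degree (Mp r)) = 1"
        using e m1 unfolding ch c_def by (simp add: cong_def mult.commute)
      have "degree h \<le> degree (Mp r)" by (intro degree_le) (auto simp: ch coeff_eq_0)
      moreover have "degree (Mp r) \<le> degree h" using lead by (intro le_degree) simp
      ultimately have deg: "degree h = degree (Mp r)" by simp
      then have "lead_coeff h = 1" using lead by simp
      then have "degree d \<le> degree h" by (rule min[OF hI])
      also have "\<dots> \<le> degree r" using deg degree_m_le by simp
      finally show False using qr r by auto
    qed
    then have "Mp h = Mp (d * q)" using qr(1) plus_Mp(2)[of "d * q" r] by simp
    then show ?thesis by (auto simp: dvdm_def)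
  qed
  obtain u v where uv: "Mp d = Mp (u * f + v * g)" using d by (auto simp: I_def)
  show ?thesis
  proof (rule that)
    show "Mp (Mp d) = Mp d" "Mp d dvdm f" "Mp d dvdm g" using dvd[OF fI] dvd[OF gI] by simp_all
    show "lead_coeff (Mp d) = 1" by (rule monic_Mp[OF d(2)])
    show "Mp (Mp d) = Mp (u * f + v * g)" using uv by (simp only: Mp_Mp)
  qed
qed

text \<open>Mutual divisibility forces equal degrees. Then \<open>e - d\<close> is divisible by
  \<open>d\<close> modulo \<open>p\<close> although its leading terms have cancelled.\<close>

lemma monic_dvdm_antisym:
  assumes d: "Mp d = d" "lead_coeff d = 1" and e: "Mp e = e" "lead_coeff e = 1"
    and "d dvdm e" "e dvdm d"
  shows "d = e"
proof -
  have nz: "Mp d \<noteq> 0" "Mp e \<noteq> 0" using d e by auto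
  have deg: "degree d = degree e"
    using dvdm_degree[of d e] dvdm_degree[of e d] assms nz by simp
  have "d dvdm e - d"
    using dvdm_add[OF \<open>d dvdm e\<close>, of "- d"] dvd_imp_dvdm[of d d] by simp
  have "Mp (e - d) = 0"
  proof (rule ccontr)
    assume nz: "Mp (e - d) \<noteq> 0"
    have "degree d \<le> degree (e - d)" using dvdm_degree[OF d(2) \<open>d dvdm e - d\<close> nz] .
    moreover have "coeff (e - d) (degree d) = 0" using d(2) e(2) deg by simp
    moreover have "degree (e - d) \<le> degree d" using deg by (simp add: degree_diff_le)
    ultimately have "e - d = 0" by (metis le_antisym leading_coeff_0_iff)
    then show False using nz by simp
  qed
  then have "Mp e = Mp d" using minus_Mp[of e d] 
    by (metis Mp_eq_iff add.commute add_0 diff_add_cancel Dp_Mp_eq)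
  then show ?thesis using d e by simp
qed

end

lemma is_monic_gcd_mod_unique:
  assumes "prime p" "is_monic_gcd_mod p d f g"
  shows "(THE d. is_monic_gcd_mod p d f g) = d"
proof -
  interpret poly_mod_prime "int p" by unfold_locales (use assms in simp)
  show ?thesis
    using assms(2) by (intro the_equality) (auto simp: is_monic_gcd_mod_def intro: monic_dvdm_antisym)
qed

lemma is_monic_gcd_mod_exists:
  assumes p: "prime p" and f: "lead_coeff f = 1"
  shows "\<exists>d. is_monic_gcd_mod p d f g"
proof -
  interpret poly_mod_prime "int p" by unfold_locales (use p in simp)
  obtain d u v where d: "Mp d = d" "lead_coeff d = 1" "d dvdm f" "d dvdm g" "Mp d = Mp (u * f + v * g)"
    using monic_gcd_exists[OF f] by blast
  have "h dvdm d" if "h dvdm f" "h dvdm g" for h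
  proof -
    obtain a ra where "f = a * h + smult (int p) ra" using \<open>h dvdm f\<close> unfolding div_mod_iff_dvdm by blast
    moreover obtain b rb where "g = b * h + smult (int p) rb" using \<open>h dvdm g\<close> unfolding div_mod_iff_dvdm by blast
    moreover obtain r where "d = u * f + v * g + smult (int p) r" using d(5) unfolding Mp_eq_iff by blast
    ultimately have "d = (u * a + v * b) * h + smult (int p) (u * ra + v * rb + r)"
      by (simp add: algebra_simps smult_add_right)
    then show ?thesis unfolding div_mod_iff_dvdm by blast
  qed
  then show ?thesis using d unfolding is_monic_gcd_mod_def by blast
qed

text \<open>Canonical representatives of the polynomials over F_p of degree below \<open>n\<close>,
  zero included.\<close>

definition reduced_polys :: "nat \<Rightarrow> nat \<Rightarrow> int poly set" where
  "reduced_polys p n = {c. poly_mod.Mp (int p) c = c \<and> (\<forall>i\<ge>n. coeff c i = 0)}"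

lemma Mp_eq_self_iff: "poly_mod.Mp q c = c \<longleftrightarrow> (\<forall>i. coeff c i mod q = coeff c i)"
  by (simp add: poly_eq_iff poly_mod.Mp_coeff poly_mod.M_def)

lemma coeff_sum_monom: "coeff (\<Sum>j<n. Polynomial.monom (x j) j) i = (if i < n then x i else 0)"
  by (simp add: coeff_sum)

lemma bij_betw_reduced_polys:
  assumes "0 < p"
  shows "bij_betw (\<lambda>c. vec n (coeff c)) (reduced_polys p n)
    {x \<in> carrier_vec n. \<forall>i < n. x $ i \<in> {0 ..< int p}}"
proof (rule bij_betw_byWitness[where f' = "\<lambda>x. \<Sum>j<n. Polynomial.monom (x $ j) j"])
  have red: "coeff c i \<in> {0 ..< int p}" if "c \<in> reduced_polys p n" for c i
  proof -
    have "coeff c i mod int p = coeff c i" using that by (simp add: reduced_polys_def Mp_eq_self_iff)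
    then show ?thesis using assms pos_mod_bound[of "int p" "coeff c i"] pos_mod_sign[of "int p" "coeff c i"] by simp
  qed
  show "\<forall>c\<in>reduced_polys p n. (\<Sum>j<n. Polynomial.monom (vec n (coeff c) $ j) j) = c"
    by (auto simp: poly_eq_iff coeff_sum_monom reduced_polys_def not_less coeff_sum)
  show "\<forall>x\<in>{x \<in> carrier_vec n. \<forall>i<n. x $ i \<in> {0..<int p}}.
      vec n (coeff (\<Sum>j<n. Polynomial.monom (x $ j) j)) = x"
    by (auto simp: coeff_sum_monom intro!: eq_vecI)
  show "(\<lambda>c. vec n (coeff c)) ` reduced_polys p n \<subseteq> {x \<in> carrier_vec n. \<forall>i<n. x $ i \<in> {0..<int p}}"
    using red by fastforce
  show "(\<lambda>x. \<Sum>j<n. Polynomial.monom (x $ j) j) ` {x \<in> carrier_vec n. \<forall>i<n. x $ i \<in> {0..<int p}} \<subseteq>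
      reduced_polys p n"
    using assms by (auto simp: reduced_polys_def Mp_eq_self_iff coeff_sum_monom)
qed

lemma card_reduced_polys:
  assumes "0 < p"
  shows "card (reduced_polys p n) = p ^ n"
proof -
  have "bij_betw (\<lambda>f. vec n f) ({..<n} \<rightarrow>\<^sub>E {0 ..< int p}) {x \<in> carrier_vec n. \<forall>i < n. x $ i \<in> {0 ..< int p}}"
    by (rule bij_betw_byWitness[where f' = "\<lambda>x. restrict (\<lambda>i. x $ i) {..<n}"])
      (auto simp: PiE_def Pi_def extensional_def fun_eq_iff)
  then have "card {x \<in> carrier_vec n. \<forall>i < n. x $ i \<in> {0 ..< int p}} = p ^ n"
    by (simp add: bij_betw_same_card[symmetric] card_PiE)
  then show ?thesis using bij_betw_same_card[OF bij_betw_reduced_polys[OF assms]] by simp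
qed

text \<open>With \<open>F = f / d\<close> modulo p, \<open>f\<close> divides \<open>c g\<close>
  exactly when \<open>F\<close> divides \<open>c\<close>. The solutions of degree below
  \<open>n\<close> are the products \<open>F q\<close> with q of degree below
  \<open>degree d\<close>, and distinct q give distinct solutions.\<close>

lemma card_reduced_polys_dvdm:
  assumes p: "prime p" and f: "lead_coeff f = 1" "degree f = n"
    and d: "is_monic_gcd_mod p d f g"
  shows "card {c \<in> reduced_polys p n. poly_mod.dvdm (int p) f (c * g)} = p ^ degree d"
proof -
  interpret poly_mod_prime "int p" by unfold_locales (use p in simp)
  have p0: "0 < p" using p by (simp add: prime_gt_0_nat)
  have dm: "Mp d = d" "lead_coeff d = 1" and ddvd: "d dvdm f" "d dvdm g"
    using d by (auto simp: is_monic_gcd_mod_def)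
  \<comment> \<open>The defining property of a monic gcd carries no Bezout coefficients; they come
    from the generator \<open>e\<close> of the ideal, which is \<open>d\<close> by
    uniqueness.\<close>
  have "\<exists>u v. Mp d = Mp (u * f + v * g)"
  proof -
    obtain e u v where e: "Mp e = e" "lead_coeff e = 1" "e dvdm f" "e dvdm g" "Mp e = Mp (u * f + v * g)"
      using monic_gcd_exists[OF f(1)] by blast
    have "e dvdm d" using d e by (auto simp: is_monic_gcd_mod_def)
    moreover have "d dvdm e"
    proof -
      obtain a ra b rb r where "f = a * d + smult (int p) ra" "g = b * d + smult (int p) rb"
        "e = u * f + v * g + smult (int p) r"
        using ddvd e(5) unfolding div_mod_iff_dvdm Mp_eq_iff by auto
      then have "e = (u * a + v * b) * d + smult (int p) (u * ra + v * rb + r)"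
        by (simp add: algebra_simps smult_add_right)
      then show ?thesis unfolding div_mod_iff_dvdm by blast
    qed
    ultimately have "d = e" using monic_dvdm_antisym dm e by blast
    then show ?thesis using e by blast
  qed
  then obtain u v r0 where bez: "d = u * f + v * g + smult (int p) r0" unfolding Mp_eq_iff by auto
  \<comment> \<open>\<open>F\<close> lifts the quotient \<open>f / d\<close> modulo p; over \<int> a
    remainder \<open>R\<close> is left, which turns out to be a multiple of p.\<close>
  obtain F R where FR: "f = d * F + R" "R = 0 \<or> degree R < degree d"
    using monic_division[OF dm(2)] by blast
  have "d dvdm R"
  proof -
    obtain a ra where "f = a * d + smult (int p) ra" using ddvd(1) unfolding div_mod_iff_dvdm by auto
    then have "R = (a - F) * d + smult (int p) ra" using FR(1) by (simp add: algebra_simps)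
    then show ?thesis unfolding div_mod_iff_dvdm by blast
  qed
  then have "Mp R = 0" using dvdm_degree[OF dm(2), of R] FR(2) by fastforce
  then obtain R' where R': "R = smult (int p) R'" using Mp_eq_iff[of R 0] by auto
  have fnz: "f \<noteq> 0" and dnz: "d \<noteq> 0" using f dm by auto
  have ddeg: "degree d \<le> n"
    using dvdm_degree[OF dm(2) ddvd(1)] f monic_Mp[OF f(1)] by fastforce
  have dF: "d * F = f - R" using FR by simp
  have Rlt: "R \<noteq> 0 \<Longrightarrow> degree R < degree f" using FR(2) ddeg f by simp
  have dFdeg: "degree (d * F) = n" "lead_coeff (d * F) = 1"
  proof -
    have c: "coeff (d * F) n = 1" unfolding dF using f Rlt by (cases "R = 0") (auto simp: coeff_eq_0)
    moreover have "degree (d * F) \<le> n" unfolding dF using f Rlt by (cases "R = 0") (auto intro!: degree_diff_le)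
    ultimately show "degree (d * F) = n" "lead_coeff (d * F) = 1"
      using le_degree[of "d * F" n] by auto
  qed
  have Fl: "lead_coeff F = 1" using dFdeg(2) lead_coeff_monic_mult[OF dm(2), of F] by simp
  then have Fnz: "F \<noteq> 0" by auto
  have Fdeg: "degree d + degree F = n" using dFdeg(1) degree_mult_eq[OF dnz Fnz] by simp
  have "bij_betw (\<lambda>q. Mp (F * q)) (reduced_polys p (degree d)) {c \<in> reduced_polys p n. f dvdm c * g}"
  proof (rule bij_betwI')
    fix q q' assume q: "q \<in> reduced_polys p (degree d)" and q': "q' \<in> reduced_polys p (degree d)"
    show "Mp (F * q) = Mp (F * q') \<longleftrightarrow> q = q'"
    proof
      assume "Mp (F * q) = Mp (F * q')"
      then obtain r where "F * q = F * q' + smult (int p) r" unfolding Mp_eq_iff by auto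
      then have "F * (q - q') = 0 + smult (int p) r" by (simp add: algebra_simps)
      then have "Mp (F * (q - q')) = 0" using Mp_eq_iff[of "F * (q - q')" 0] by auto
      then have "Mp (q - q') = 0" by (rule monic_mult_eq_0_mod[OF Fl])
      then obtain r' where "q - q' = smult (int p) r'" using Mp_eq_iff[of "q - q'" 0] by auto
      then have "Mp q = Mp q'" unfolding Mp_eq_iff by (intro exI[of _ r']) (simp add: algebra_simps)
      then show "q = q'" using q q' by (simp add: reduced_polys_def)
    qed simp
  next
    fix q assume q: "q \<in> reduced_polys p (degree d)"
    have "coeff (Mp (F * q)) i = 0" if "i \<ge> n" for i
    proof (cases "q = 0")
      case False
      moreover have "coeff q i = 0" if "degree d \<le> i" for i using q that by (simp add: reduced_polys_def)
      ultimately have "degree q < degree d" by (metis leading_coeff_0_iff linorder_not_less)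
      then have "degree (F * q) < i" using that Fdeg degree_mult_le[of F q] by simp
      then show ?thesis by (simp add: Mp_coeff coeff_eq_0)
    qed simp
    moreover have "f dvdm Mp (F * q) * g"
    proof -
      obtain b rb where "g = b * d + smult (int p) rb" using ddvd(2) unfolding div_mod_iff_dvdm by auto
      then have "F * q * g = (q * b) * (d * F) + smult (int p) (F * q * rb)" by (simp add: algebra_simps)
      then have "F * q * g = (q * b) * f + smult (int p) (F * q * rb - q * b * R')"
        unfolding dF R' by (simp add: algebra_simps smult_diff_right)
      then have "f dvdm F * q * g" unfolding div_mod_iff_dvdm by blast
      then show ?thesis by (metis dvdm_Mp mult_Mp(1))
    qed
    ultimately show "Mp (F * q) \<in> {c \<in> reduced_polys p n. f dvdm c * g}" by (simp add: reduced_polys_def)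
  next
    fix c assume c: "c \<in> {c \<in> reduced_polys p n. f dvdm c * g}"
    then obtain a r1 where a: "c * g = a * f + smult (int p) r1" unfolding div_mod_iff_dvdm by auto
    \<comment> \<open>The Bezout identity times \<open>c\<close> shows that \<open>f\<close> divides
      \<open>c d\<close> modulo p; cancelling the monic \<open>d\<close> from \<open>f = d F\<close>
      leaves that \<open>F\<close> divides \<open>c\<close>.\<close>
    have "c * d = (c * u) * f + v * (c * g) + smult (int p) (c * r0)"
      by (subst bez) (simp add: algebra_simps)
    also have "\<dots> = (c * u + v * a) * (d * F + R) + smult (int p) (v * r1 + c * r0)"
      unfolding a FR(1)[symmetric] by (simp add: algebra_simps smult_add_right)
    finally have "d * (c - (c * u + v * a) * F) =
        0 + smult (int p) ((c * u + v * a) * R' + v * r1 + c * r0)"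
      unfolding R' by (simp add: algebra_simps smult_add_right)
    then have "Mp (d * (c - (c * u + v * a) * F)) = 0"
      using Mp_eq_iff[of "d * (c - (c * u + v * a) * F)" 0] by auto
    then have "Mp (c - (c * u + v * a) * F) = 0" by (rule monic_mult_eq_0_mod[OF dm(2)])
    then obtain r2 where "c - (c * u + v * a) * F = smult (int p) r2"
      using Mp_eq_iff[of "c - (c * u + v * a) * F" 0] by auto
    then have "Mp c = Mp (F * (c * u + v * a))"
      unfolding Mp_eq_iff by (intro exI[of _ r2]) (simp add: algebra_simps)
    define q where "q = Mp (c * u + v * a)"
    have cq: "c = Mp (F * q)" using c \<open>Mp c = _\<close> by (simp add: q_def reduced_polys_def)
    have "coeff q i = 0" if "i \<ge> degree d" for i
    proof (cases "q = 0")
      case False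
      have "lead_coeff q mod int p = lead_coeff q" unfolding q_def by (metis M_def Mp_Mp Mp_coeff)
      then have deg: "degree c = degree F + degree q"
        unfolding cq using False by (intro degree_m_mult_eq Fl m1) auto
      have "c \<noteq> 0"
      proof
        assume "c = 0"
        then have "Mp (F * q) = 0" unfolding cq[symmetric] .
        then have "Mp q = 0" by (rule monic_mult_eq_0_mod[OF Fl])
        moreover have "Mp q = q" by (simp add: q_def)
        ultimately show False using False by simp
      qed
      moreover have "coeff c i = 0" if "n \<le> i" for i using c that by (simp add: reduced_polys_def)
      ultimately have "degree c < n" by (metis leading_coeff_0_iff linorder_not_less)
      then show ?thesis using that deg Fdeg by (intro coeff_eq_0) simp
    qed simp
    then have "q \<in> reduced_polys p (degree d)" by (simp add: reduced_polys_def q_def)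
    with cq show "\<exists>q \<in> reduced_polys p (degree d). c = Mp (F * q)" by blast
  qed
  from bij_betw_same_card[OF this] show ?thesis by (simp only: card_reduced_polys[OF p0])
qed

section \<open>The degree of \<open>\<Phi>\<^sub>p\<close>\<close>

text \<open>Both sides are evaluated from the bordered matrix \<open>[1, e\<^sup>T; e, M]\<close>, once by eliminating its first
  column with the first row, once by multiplying it with \<open>[det M, 0; - adj(M) e, I]\<close>.\<close>

lemma det_minus_ones:
  fixes M :: "'a::idom mat"
  assumes M: "M \<in> carrier_mat n n" and nz: "det M \<noteq> 0"
  shows "det (M - mat n n (\<lambda>_. 1)) = det M - (\<Sum>i<n. \<Sum>j<n. adj_mat M $$ (i, j))"
proof -
  define e :: "'a mat" where "e = mat n 1 (\<lambda>_. 1)"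
  define eT :: "'a mat" where "eT = mat 1 n (\<lambda>_. 1)"
  define N where "N = four_block_mat (1\<^sub>m 1) eT e M"
  define k where "k = (\<Sum>i<n. \<Sum>j<n. adj_mat M $$ (i, j))"
  note adj = adj_mat[OF M]
  have e: "e \<in> carrier_mat n 1" and eT: "eT \<in> carrier_mat 1 n" by (auto simp: e_def eT_def)
  have J: "M - mat n n (\<lambda>_. 1) \<in> carrier_mat n n" by (rule minus_carrier_mat) simp
  have N: "N \<in> carrier_mat (1 + n) (1 + n)" unfolding N_def using M by (intro four_block_carrier_mat) auto
  have "N = four_block_mat (1\<^sub>m 1) (0\<^sub>m 1 n) e (1\<^sub>m n) * four_block_mat (1\<^sub>m 1) eT (0\<^sub>m n 1) (M - mat n n (\<lambda>_. 1))"
  proof -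
    have "e * eT + (M - mat n n (\<lambda>_. 1)) = M"
      using M by (intro eq_matI) (auto simp: e_def eT_def scalar_prod_def)
    then show ?thesis unfolding N_def
      using e eT M J
      by (subst mult_four_block_mat[of _ 1 1 _ n _ n _ _ 1 _ n])
        (auto simp: left_add_zero_mat[of _ 1 n] right_add_zero_mat[of _ n 1])
  qed
  then have "det N = det (four_block_mat (1\<^sub>m 1) (0\<^sub>m 1 n) e (1\<^sub>m n)) *
      det (four_block_mat (1\<^sub>m 1) eT (0\<^sub>m n 1) (M - mat n n (\<lambda>_. 1)))"
    using e eT J by (simp only:) (intro det_mult[of _ "1 + n"] four_block_carrier_mat; simp)
  also have "det (four_block_mat (1\<^sub>m 1) (0\<^sub>m 1 n) e (1\<^sub>m n)) = 1"
    using e by (subst det_four_block_mat_upper_right_zero[of _ 1 _ n]) auto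
  also have "det (four_block_mat (1\<^sub>m 1) eT (0\<^sub>m n 1) (M - mat n n (\<lambda>_. 1))) = det (M - mat n n (\<lambda>_. 1))"
    using eT J by (subst det_four_block_mat_lower_left_zero[of _ 1 _ n]) auto
  finally have 1: "det N = det (M - mat n n (\<lambda>_. 1))" by simp
  define Y where "Y = four_block_mat (det M \<cdot>\<^sub>m 1\<^sub>m 1) (0\<^sub>m 1 n) (- (adj_mat M * e)) (1\<^sub>m n)"
  have ae: "adj_mat M * e \<in> carrier_mat n 1" using adj e by (intro mult_carrier_mat[of _ n n])
  have Y: "Y \<in> carrier_mat (1 + n) (1 + n)" unfolding Y_def using ae by (intro four_block_carrier_mat) auto
  have NY: "N * Y = four_block_mat ((det M - k) \<cdot>\<^sub>m 1\<^sub>m 1) eT (0\<^sub>m n 1) M"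
  proof -
    have ul: "1\<^sub>m 1 * (det M \<cdot>\<^sub>m 1\<^sub>m 1) + eT * (- (adj_mat M * e)) = (det M - k) \<cdot>\<^sub>m 1\<^sub>m 1"
    proof (rule eq_matI)
      fix i j assume "i < dim_row ((det M - k) \<cdot>\<^sub>m 1\<^sub>m 1)" "j < dim_col ((det M - k) \<cdot>\<^sub>m 1\<^sub>m 1)"
      then have ij: "i = 0" "j = 0" by auto
      have "(eT * (- (adj_mat M * e))) $$ (0, 0) = - k"
        using adj(1) by (simp add: eT_def e_def k_def scalar_prod_def atLeast0LessThan sum_negf)
      then show "(1\<^sub>m 1 * (det M \<cdot>\<^sub>m 1\<^sub>m 1) + eT * (- (adj_mat M * e))) $$ (i, j) = ((det M - k) \<cdot>\<^sub>m 1\<^sub>m 1) $$ (i, j)"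
        unfolding ij using carrier_matD[OF eT] carrier_matD[OF ae] by simp
    qed (use eT ae in auto)
    have ll: "e * (det M \<cdot>\<^sub>m 1\<^sub>m 1) + M * (- (adj_mat M * e)) = 0\<^sub>m n 1"
    proof -
      have "M * (- (adj_mat M * e)) = - (M * (adj_mat M * e))"
        using M ae by (intro eq_matI) (auto simp: scalar_prod_uminus_right)
      also have "M * (adj_mat M * e) = det M \<cdot>\<^sub>m e"
        using M adj e by (simp add: assoc_mult_mat[of _ n n _ n _ 1, symmetric] mult_smult_assoc_mat[of _ n n _ 1])
      finally have "M * (- (adj_mat M * e)) = - (det M \<cdot>\<^sub>m e)" .
      moreover have "e * (det M \<cdot>\<^sub>m 1\<^sub>m 1) = det M \<cdot>\<^sub>m e"
        using e by (simp add: mult_smult_distrib[of _ n 1 _ 1])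
      ultimately show ?thesis using e by (auto intro!: eq_matI)
    qed
    have "N * Y = four_block_mat (1\<^sub>m 1 * (det M \<cdot>\<^sub>m 1\<^sub>m 1) + eT * (- (adj_mat M * e)))
        (1\<^sub>m 1 * 0\<^sub>m 1 n + eT * 1\<^sub>m n) (e * (det M \<cdot>\<^sub>m 1\<^sub>m 1) + M * (- (adj_mat M * e)))
        (e * 0\<^sub>m 1 n + M * 1\<^sub>m n)"
      unfolding N_def Y_def using e eT M ae by (intro mult_four_block_mat) auto
    moreover have "1\<^sub>m 1 * 0\<^sub>m 1 n + eT * 1\<^sub>m n = eT" "e * 0\<^sub>m 1 n + M * 1\<^sub>m n = M"
      using e eT M by (auto simp: right_mult_zero_mat[of _ n 1] right_mult_one_mat[of _ 1 n] left_add_zero_mat[of _ 1 n])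
    ultimately show ?thesis unfolding ul ll by simp
  qed
  have "det N * det Y = det (N * Y)" using det_mult[OF N Y] by simp
  also have "\<dots> = (det M - k) * det M"
    unfolding NY using eT M by (subst det_four_block_mat_lower_left_zero[of _ 1 _ n]) auto
  also have "det Y = det M"
    unfolding Y_def using ae by (subst det_four_block_mat_upper_right_zero[of _ 1 _ n]) auto
  finally have "det N = det M - k" using nz by simp
  then show ?thesis using 1 by (simp add: k_def)
qed

text \<open>The polynomial \<open>e^T adj(xI - A) u\<close>, that is, \<chi>(A) times
  \<open>e^T (xI - A)^(-1) u\<close>. The vector \<open>u\<close> is a parameter so that
  multiplication by x can be traded for applying \<open>A\<close> to it.\<close>

definition adj_sum :: "int mat \<Rightarrow> int vec \<Rightarrow> int poly" where
  "adj_sum A u = (\<Sum>i<dim_row A. \<Sum>j<dim_row A. smult (u $ j) (adj_mat (char_poly_matrix A) $$ (i, j)))"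

text \<open>The known coefficients of the adjugate are inserted; equivalently, \<chi>(A) is
  multiplied by the series with coefficient \<open>e^T A^l u\<close> at x^(-l-1).\<close>

lemma coeff_adj_sum:
  assumes A: "A \<in> carrier_mat n n" and u: "u \<in> carrier_vec n"
  shows "coeff (adj_sum A u) k =
    (\<Sum>l<n. coeff (char_poly A) (l + Suc k) * (\<Sum>i<n. (A ^\<^sub>m l *\<^sub>v u) $ i))"
proof (cases "n = 0")
  case False
  let ?P = "poly_shift (Suc k) (char_poly A)"
  have deg: "degree ?P < n"
  proof (rule le_less_trans[OF degree_le])
    show "\<forall>i>n - 1. coeff ?P i = 0"
      using degree_monic_char_poly[OF A] by (auto simp: coeff_poly_shift intro!: coeff_eq_0)
    show "n - 1 < n" using False by simp
  qed
  have "coeff (adj_sum A u) k = (\<Sum>i<n. \<Sum>j<n. poly_mat ?P A $$ (i, j) * u $ j)"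
    using A by (auto simp: adj_sum_def coeff_sum coeff_adj_char_poly_matrix[OF A] mult.commute intro!: sum.cong)
  also have "\<dots> = (\<Sum>i<n. (poly_mat ?P A *\<^sub>v u) $ i)"
    using A u by (auto simp: scalar_prod_def atLeast0LessThan)
  also have "\<dots> = (\<Sum>i<n. \<Sum>l<n. coeff ?P l * (A ^\<^sub>m l *\<^sub>v u) $ i)"
    using A u deg by (intro sum.cong refl poly_mat_mult_vec) auto
  also have "\<dots> = (\<Sum>l<n. coeff ?P l * (\<Sum>i<n. (A ^\<^sub>m l *\<^sub>v u) $ i))"
    by (subst sum.swap) (simp add: sum_distrib_left)
  finally show ?thesis by (simp add: coeff_poly_shift)
qed (use A in \<open>simp add: adj_sum_def\<close>)

lemma adj_sum_add:
  assumes "A \<in> carrier_mat n n" "u \<in> carrier_vec n" "w \<in> carrier_vec n"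
  shows "adj_sum A (u + w) = adj_sum A u + adj_sum A w"
  using assms by (simp add: adj_sum_def smult_add_left sum.distrib)

lemma adj_sum_smult:
  assumes "A \<in> carrier_mat n n" "u \<in> carrier_vec n"
  shows "adj_sum A (c \<cdot>\<^sub>v u) = smult c (adj_sum A u)"
  using assms by (simp add: adj_sum_def smult_sum2)

text \<open>The identity \<open>x adj(M) = adj(M) A + \<chi>(A) I\<close> for
  \<open>M = xI - A\<close>, taken between \<open>e^T\<close> and \<open>u\<close>.\<close>

lemma adj_sum_shift:
  assumes A: "A \<in> carrier_mat n n" and u: "u \<in> carrier_vec n"
  shows "[:0, 1:] * adj_sum A u = adj_sum A (A *\<^sub>v u) + char_poly A * [:\<Sum>i<n. u $ i:]"
proof -
  define M where "M = char_poly_matrix A"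
  have M: "M \<in> carrier_mat n n" using A by (simp add: M_def)
  note adj = adj_mat[OF M]
  have entry: "(\<Sum>l<n. adj_mat M $$ (i, l) * M $$ (l, j)) = (if i = j then char_poly A else 0)"
    if "i < n" "j < n" for i j
    using arg_cong[OF adj(3), of "\<lambda>Z. Z $$ (i, j)"] that adj(1) M
    by (simp add: scalar_prod_def atLeast0LessThan char_poly_def M_def[symmetric])
  have Mij: "M $$ (l, j) = (if l = j then [:0, 1:] else 0) - [:A $$ (l, j):]" if "l < n" "j < n" for l j
    using that A by (auto simp: M_def char_poly_matrix_def)
  have "char_poly A * [:\<Sum>i<n. u $ i:] = (\<Sum>i<n. smult (u $ i) (char_poly A))"
    by (simp add: smult_sum mult.commute)
  also have "\<dots> = (\<Sum>i<n. \<Sum>j<n. smult (u $ j) (if i = j then char_poly A else 0))"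
    by (intro sum.cong refl) (simp add: if_distrib[of "smult _"] cong: if_cong)
  also have "\<dots> = (\<Sum>i<n. \<Sum>j<n. smult (u $ j) (\<Sum>l<n. adj_mat M $$ (i, l) * M $$ (l, j)))"
    using entry by (intro sum.cong refl) auto
  also have "\<dots> = (\<Sum>i<n. \<Sum>j<n. smult (u $ j) ([:0, 1:] * adj_mat M $$ (i, j)))
      - (\<Sum>i<n. \<Sum>j<n. \<Sum>l<n. smult (u $ j * A $$ (l, j)) (adj_mat M $$ (i, l)))"
  proof -
    have "(\<Sum>l<n. adj_mat M $$ (i, l) * M $$ (l, j)) =
        [:0, 1:] * adj_mat M $$ (i, j) - (\<Sum>l<n. smult (A $$ (l, j)) (adj_mat M $$ (i, l)))"
      if "i < n" "j < n" for i j
    proof -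
      have "(\<Sum>l<n. adj_mat M $$ (i, l) * M $$ (l, j)) =
          (\<Sum>l<n. (if l = j then [:0, 1:] * adj_mat M $$ (i, l) else 0) - smult (A $$ (l, j)) (adj_mat M $$ (i, l)))"
        using that by (intro sum.cong refl) (auto simp: Mij algebra_simps)
      then show ?thesis using that by (simp add: sum_subtractf)
    qed
    then show ?thesis
      by (simp add: smult_diff_right sum_subtractf smult_sum2)
  qed
  also have "(\<Sum>i<n. \<Sum>j<n. smult (u $ j) ([:0, 1:] * adj_mat M $$ (i, j))) = [:0, 1:] * adj_sum A u"
    using A by (simp add: adj_sum_def M_def[symmetric] sum_distrib_left)
  also have "(\<Sum>i<n. \<Sum>j<n. \<Sum>l<n. smult (u $ j * A $$ (l, j)) (adj_mat M $$ (i, l))) = adj_sum A (A *\<^sub>v u)"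
  proof -
    have "(\<Sum>j<n. \<Sum>l<n. smult (u $ j * A $$ (l, j)) (adj_mat M $$ (i, l))) =
        (\<Sum>l<n. smult ((A *\<^sub>v u) $ l) (adj_mat M $$ (i, l)))" for i
      using A u by (subst sum.swap) (auto simp: scalar_prod_def atLeast0LessThan smult_sum mult.commute intro!: sum.cong)
    then show ?thesis using A by (simp add: adj_sum_def M_def[symmetric])
  qed
  finally show ?thesis by simp
qed

text \<open>One shift per Horner step. As \<open>adj_sum\<close> has no coefficients from x^n on,
  the polynomial \<open>adj_sum A (c(A) u)\<close> is the reduced representative of
  \<open>c * adj_sum A u\<close> modulo \<chi>(A).\<close>

lemma char_poly_dvd_adj_sum:
  assumes A: "A \<in> carrier_mat n n" and u: "u \<in> carrier_vec n"
  shows "char_poly A dvd c * adj_sum A u - adj_sum A (poly_mat c A *\<^sub>v u)"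
  using u
proof (induction c arbitrary: u)
  case 0
  have "poly_mat 0 A *\<^sub>v u = 0 \<cdot>\<^sub>v u" using A 0 by (intro eq_vecI) auto
  then show ?case using adj_sum_smult[OF A 0, of 0] by simp
next
  case (pCons a c)
  have Au: "A *\<^sub>v u \<in> carrier_vec n" using A pCons by simp
  have P: "poly_mat c A \<in> carrier_mat n n" using A by simp
  have PA: "poly_mat c A * A \<in> carrier_mat n n" using A P by (rule mult_carrier_mat[rotated])
  have "poly_mat (pCons a c) A *\<^sub>v u = (a \<cdot>\<^sub>m 1\<^sub>m n + poly_mat c A * A) *\<^sub>v u"
    using A by (simp add: poly_mat_pCons poly_mat_commute)
  also have "\<dots> = (a \<cdot>\<^sub>m 1\<^sub>m n) *\<^sub>v u + (poly_mat c A * A) *\<^sub>v u"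
    using PA pCons.prems by (intro add_mult_distrib_mat_vec[of _ n n]) auto
  also have "\<dots> = a \<cdot>\<^sub>v u + poly_mat c A *\<^sub>v (A *\<^sub>v u)"
    using pCons.prems by (simp only: smult_one_mat_mult_vec assoc_mult_mat_vec[OF P A])
  finally have "adj_sum A (poly_mat (pCons a c) A *\<^sub>v u) =
      smult a (adj_sum A u) + adj_sum A (poly_mat c A *\<^sub>v (A *\<^sub>v u))"
    by (simp only: adj_sum_add[OF A smult_carrier_vec[THEN iffD2, OF pCons.prems] mult_mat_vec_carrier[OF P Au]]
        adj_sum_smult[OF A pCons.prems])
  moreover have "pCons a c * adj_sum A u = smult a (adj_sum A u) + c * ([:0, 1:] * adj_sum A u)"
    by simp
  ultimately have eq: "pCons a c * adj_sum A u - adj_sum A (poly_mat (pCons a c) A *\<^sub>v u) =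
      (c * adj_sum A (A *\<^sub>v u) - adj_sum A (poly_mat c A *\<^sub>v (A *\<^sub>v u))) + char_poly A * ([:\<Sum>i<n. u $ i:] * c)"
  proof -
    have "(s + c * (t + x * y)) - (s + r) = (c * t - r) + x * (y * c)" for r s t x y
      by (simp add: algebra_simps)
    then show ?thesis
      unfolding \<open>adj_sum A (poly_mat (pCons a c) A *\<^sub>v u) = _\<close>
        \<open>pCons a c * adj_sum A u = _\<close> adj_sum_shift[OF A pCons.prems] .
  qed
  show ?case unfolding eq by (rule dvd_add[OF pCons.IH[OF Au] dvd_triv_left])
qed

lemma char_poly_add_ones:
  assumes A: "A \<in> carrier_mat n n"
  shows "char_poly (A + all_ones_mat n) = char_poly A - adj_sum A (vec n (\<lambda>_. 1))"
proof -
  have M: "char_poly_matrix A \<in> carrier_mat n n" using A by simp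
  have "lead_coeff (char_poly A) = 1" using degree_monic_char_poly[OF A] by simp
  then have nz: "det (char_poly_matrix A) \<noteq> 0" unfolding char_poly_def by auto
  have "char_poly_matrix (A + all_ones_mat n) = char_poly_matrix A - mat n n (\<lambda>_. 1)"
  proof (rule eq_matI)
    fix i j assume "i < dim_row (char_poly_matrix A - mat n n (\<lambda>_. 1))"
      "j < dim_col (char_poly_matrix A - mat n n (\<lambda>_. 1))"
    then have "i < n" "j < n" by auto
    moreover have "[:- (a + 1):] = [:- a:] - (1 :: int poly)" for a
      using diff_pCons[of "- a" 0 1 0] by (simp add: pCons_one)
    ultimately show "char_poly_matrix (A + all_ones_mat n) $$ (i, j) =
        (char_poly_matrix A - mat n n (\<lambda>_. 1)) $$ (i, j)"
      using A by (simp add: char_poly_matrix_def all_ones_mat_def)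
  qed (use A in \<open>auto simp: char_poly_matrix_def all_ones_mat_def\<close>)
  then show ?thesis using A det_minus_ones[OF M nz]
    by (simp add: char_poly_def adj_sum_def)
qed

text \<open>By symmetry of \<open>A\<close>, row l of the transposed walk matrix is
  \<open>e^T A^l\<close>.\<close>

lemma walk_mat_transpose_mult_vec:
  assumes A: "A \<in> carrier_mat n n" and sym: "A\<^sup>T = A" and u: "u \<in> carrier_vec n" and l: "l < n"
  shows "((walk_mat A)\<^sup>T *\<^sub>v u) $ l = (\<Sum>i<n. (A ^\<^sub>m l *\<^sub>v u) $ i)"
proof -
  have symp: "(A ^\<^sub>m l)\<^sup>T = A ^\<^sub>m l"
    using poly_mat_transpose[OF A, of "Polynomial.monom 1 l"] sym by (simp add: poly_mat_monom[OF A])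
  have sw: "(A ^\<^sub>m l) $$ (i, j) = (A ^\<^sub>m l) $$ (j, i)" if "i < n" "j < n" for i j
    using arg_cong[OF symp, of "\<lambda>Z. Z $$ (i, j)"] that A by simp
  have "((walk_mat A)\<^sup>T *\<^sub>v u) $ l = (\<Sum>i<n. (\<Sum>j<n. (A ^\<^sub>m l) $$ (i, j)) * u $ i)"
    using A u l by (simp add: scalar_prod_def atLeast0LessThan walk_mat_def Let_def)
  also have "\<dots> = (\<Sum>j<n. \<Sum>i<n. (A ^\<^sub>m l) $$ (j, i) * u $ i)"
    by (subst sum.swap) (auto simp: sum_distrib_right sw intro!: sum.cong)
  also have "\<dots> = (\<Sum>j<n. (A ^\<^sub>m l *\<^sub>v u) $ j)"
    using A u by (simp add: scalar_prod_def atLeast0LessThan)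
  finally show ?thesis .
qed

text \<open>The coefficients of \<open>e\<^sup>T adj(xI - A) u\<close>, from the top down, are obtained from the numbers
  \<open>e\<^sup>T A\<^sup>l u\<close> by a unitriangular transformation.\<close>

lemma adj_sum_mod_0_iff:
  assumes A: "A \<in> carrier_mat n n" and sym: "A\<^sup>T = A" and u: "u \<in> carrier_vec n"
  shows "(\<forall>k. p dvd coeff (adj_sum A u) k) \<longleftrightarrow> (\<forall>l<n. p dvd ((walk_mat A)\<^sup>T *\<^sub>v u) $ l)"
proof
  let ?s = "\<lambda>l. \<Sum>i<n. (A ^\<^sub>m l *\<^sub>v u) $ i" and ?X = "char_poly A"
  have X: "degree ?X = n" "coeff ?X n = 1" using degree_monic_char_poly[OF A] by auto
  note s = walk_mat_transpose_mult_vec[OF A sym u]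
  show "\<forall>l<n. p dvd ((walk_mat A)\<^sup>T *\<^sub>v u) $ l" if *: "\<forall>k. p dvd coeff (adj_sum A u) k"
  proof (intro allI impI)
    fix l assume "l < n"
    then show "p dvd ((walk_mat A)\<^sup>T *\<^sub>v u) $ l"
    proof (induction l rule: less_induct)
      case (less l)
      \<comment> \<open>In the coefficient of x^(n-1-l) the l-th term carries the leading
        coefficient 1 of \<chi>(A). The terms with j > l vanish for degree reasons, those with j < l
        are divisible by \<open>p\<close> by induction.\<close>
      let ?t = "\<lambda>j. coeff ?X (j + Suc (n - 1 - l)) * ?s j"
      have "coeff (adj_sum A u) (n - 1 - l) = (\<Sum>j<n. ?t j)"
        by (rule coeff_adj_sum[OF A u])
      also have "\<dots> = ?t l + (\<Sum>j\<in>{..<n} - {l}. ?t j)"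
        using less.prems by (intro sum.remove) auto
      finally have "coeff (adj_sum A u) (n - 1 - l) = ?s l + (\<Sum>j\<in>{..<n} - {l}. ?t j)"
        using less.prems X by (simp del: index_mult_mat_vec)
      moreover have "p dvd ?t j" if "j \<in> {..<n} - {l}" for j
      proof (cases "j < l")
        case True
        then have "j < n" using less.prems by simp
        have "p dvd ?s j" using less.IH[OF True \<open>j < n\<close>] unfolding s[OF \<open>j < n\<close>] .
        then show ?thesis by (rule dvd_mult)
      next
        case False
        then have "coeff ?X (j + Suc (n - 1 - l)) = 0" using that less.prems X by (intro coeff_eq_0) auto
        then show ?thesis by simp
      qed
      ultimately have "p dvd ?s l" using * by (metis (no_types, lifting) dvd_add_left_iff dvd_sum)
      then show ?case using s less.prems by simp
    qed
  qed
  show "\<forall>k. p dvd coeff (adj_sum A u) k" if "\<forall>l<n. p dvd ((walk_mat A)\<^sup>T *\<^sub>v u) $ l"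
  proof
    fix k
    have dvd: "p dvd ?s l" if "l < n" for l
      using \<open>\<forall>l<n. p dvd ((walk_mat A)\<^sup>T *\<^sub>v u) $ l\<close> that unfolding s[OF that, symmetric] by blast
    show "p dvd coeff (adj_sum A u) k"
      unfolding coeff_adj_sum[OF A u] by (rule dvd_sum, rule dvd_mult, rule dvd) (simp only: lessThan_iff)
  qed
qed

lemma coeff_adj_sum_eq_0:
  assumes A: "A \<in> carrier_mat n n" and u: "u \<in> carrier_vec n" and k: "n \<le> k"
  shows "coeff (adj_sum A u) k = 0"
proof -
  have "coeff (char_poly A) (l + Suc k) = 0" for l
    using degree_monic_char_poly[OF A] k by (intro coeff_eq_0) simp
  then show ?thesis by (simp add: coeff_adj_sum[OF A u])
qed

text \<open>For c of degree below n, \<open>u = c(A) e\<close> is \<open>W\<close> times the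
  coefficient vector of c. Modulo p, \<chi>(A) divides \<open>c (\<chi>(A) - k)\<close> iff it
  divides \<open>c k\<close>, iff it divides \<open>adj_sum A u\<close>, iff the latter is 0 for
  degree reasons, iff \<open>W^T u = 0\<close>. So coefficient vectors identify the polynomials
  counted by \<open>card_reduced_polys_dvdm\<close> with the kernel of the Gram matrix.\<close>

lemma card_kernel_mod_walk_gram:
  fixes A :: "int mat"
  assumes p: "prime p" and A: "A \<in> carrier_mat n n" and sym: "A\<^sup>T = A" and n: "0 < n"
    and d: "is_monic_gcd_mod p d (char_poly A) (char_poly (A + all_ones_mat n))"
  shows "card (carrier (kernel_mod p ((walk_mat A)\<^sup>T * walk_mat A))) = p ^ degree d"
proof -
  interpret poly_mod_prime "int p" by unfold_locales (use p in simp)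
  let ?X = "char_poly A" and ?e = "vec n (\<lambda>_. 1 :: int)" and ?W = "walk_mat A"
  define k where "k = adj_sum A ?e"
  have X: "degree ?X = n" "lead_coeff ?X = 1" using degree_monic_char_poly[OF A] by auto
  have W: "?W \<in> carrier_mat n n" and WT: "?W\<^sup>T \<in> carrier_mat n n" using A by auto
  have g: "char_poly (A + all_ones_mat n) = ?X - k" unfolding k_def by (rule char_poly_add_ones[OF A])
  have iff: "?X dvdm c * (?X - k) \<longleftrightarrow> (\<forall>l<n. int p dvd (?W\<^sup>T * ?W *\<^sub>v vec n (coeff c)) $ l)"
    if c: "\<And>i. n \<le> i \<Longrightarrow> coeff c i = 0" for c
  proof -
    define u where "u = poly_mat c A *\<^sub>v ?e"
    have u: "u \<in> carrier_vec n"
      unfolding u_def by (intro mult_mat_vec_carrier[of _ n n] poly_mat_carrier A vec_carrier)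
    have deg: "degree c < n"
    proof -
      have "degree c \<le> n - 1" using c n by (intro degree_le) auto
      then show ?thesis using n by simp
    qed
    have "u = ?W *\<^sub>v vec n (coeff c)"
    proof (rule eq_vecI)
      fix i assume "i < dim_vec (?W *\<^sub>v vec n (coeff c))"
      then have i: "i < n" using A by simp
      have "u $ i = (\<Sum>j<n. coeff c j * (A ^\<^sub>m j *\<^sub>v ?e) $ i)"
        unfolding u_def by (rule poly_mat_mult_vec[OF A _ i deg]) simp
      also have "\<dots> = (\<Sum>j<n. ?W $$ (i, j) * coeff c j)"
        by (intro sum.cong refl) (simp add: walk_mat_index[OF A _ i] mult.commute del: index_mult_mat_vec)
      also have "\<dots> = (?W *\<^sub>v vec n (coeff c)) $ i"
        using A i by (simp add: scalar_prod_def atLeast0LessThan)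
      finally show "u $ i = (?W *\<^sub>v vec n (coeff c)) $ i" .
    qed (use u W in auto)
    then have WWc: "?W\<^sup>T * ?W *\<^sub>v vec n (coeff c) = ?W\<^sup>T *\<^sub>v u"
      using assoc_mult_mat_vec[OF WT W] by simp
    obtain q where q: "c * k - adj_sum A u = ?X * q"
      using char_poly_dvd_adj_sum[OF A, of ?e c] by (auto simp: k_def u_def)
    have "?X dvdm c * (?X - k) \<longleftrightarrow> ?X dvdm adj_sum A u"
    proof -
      have "c * (?X - k) = (c - q) * ?X - adj_sum A u" "adj_sum A u = (c - q) * ?X - c * (?X - k)"
        using q by (simp_all add: algebra_simps)
      moreover have "?X dvdm a * ?X - b" if "?X dvdm b" for a b
        using dvdm_add[of ?X "a * ?X" "- b"] that dvd_imp_dvdm[of ?X "a * ?X"] by simp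
      ultimately show ?thesis by metis
    qed
    also have "\<dots> \<longleftrightarrow> Mp (adj_sum A u) = 0"
    proof
      assume dvd: "?X dvdm adj_sum A u"
      have "degree (adj_sum A u) \<le> n - 1"
        using coeff_adj_sum_eq_0[OF A u] n by (intro degree_le) auto
      then have "degree (adj_sum A u) < degree ?X" using n X by simp
      then show "Mp (adj_sum A u) = 0" using dvdm_degree[OF X(2) dvd] by fastforce
    next
      assume "Mp (adj_sum A u) = 0"
      then show "?X dvdm adj_sum A u" by (auto simp: dvdm_def intro: exI[of _ 0])
    qed
    also have "\<dots> \<longleftrightarrow> (\<forall>l<n. int p dvd (?W\<^sup>T *\<^sub>v u) $ l)"
      unfolding Mp_eq_0_iff by (rule adj_sum_mod_0_iff[OF A sym u])
    finally show ?thesis unfolding WWc .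
  qed
  have bij: "bij_betw (\<lambda>c. vec n (coeff c)) (reduced_polys p n)
      {x \<in> carrier_vec n. \<forall>i<n. x $ i \<in> {0..<int p}}"
    by (rule bij_betw_reduced_polys) (use p in \<open>simp add: prime_gt_0_nat\<close>)
  have "bij_betw (\<lambda>c. vec n (coeff c)) {c \<in> reduced_polys p n. ?X dvdm c * (?X - k)}
      (carrier (kernel_mod p (?W\<^sup>T * ?W)))"
  proof (rule bij_betw_subset[OF bij])
    have mem: "vec n (coeff c) \<in> carrier (kernel_mod p (?W\<^sup>T * ?W)) \<longleftrightarrow> ?X dvdm c * (?X - k)"
      if "c \<in> reduced_polys p n" for c
    proof -
      have "vec n (coeff c) \<in> {x \<in> carrier_vec n. \<forall>i<n. x $ i \<in> {0..<int p}}"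
        using bij_betwE[OF bij] that by blast
      moreover have "\<And>i. n \<le> i \<Longrightarrow> coeff c i = 0" using that by (simp add: reduced_polys_def)
      ultimately show ?thesis unfolding mem_kernel_mod_iff using iff[of c] A by auto
    qed
    have "carrier (kernel_mod p (?W\<^sup>T * ?W)) \<subseteq> (\<lambda>c. vec n (coeff c)) ` reduced_polys p n"
      unfolding bij_betw_imp_surj_on[OF bij] using A by (auto simp: mem_kernel_mod_iff)
    then show "(\<lambda>c. vec n (coeff c)) ` {c \<in> reduced_polys p n. ?X dvdm c * (?X - k)} =
        carrier (kernel_mod p (?W\<^sup>T * ?W))"
      using mem by blast
  qed auto
  from bij_betw_same_card[OF this] show ?thesis
    by (simp only: card_reduced_polys_dvdm[OF p X(2) X(1) d[unfolded g]])
qed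

section \<open>Adjacency matrices\<close>

text \<open>Only row \<open>k\<close> changes, and the cofactors along that row do not see
  it.\<close>

lemma det_diag_update:
  fixes M :: "'a::comm_ring_1 mat"
  assumes M: "M \<in> carrier_mat m m" and k: "k < m"
  shows "det (M + mat m m (\<lambda>(i, j). if i = j \<and> i = k then c else 0)) =
    det M + c * det (mat_delete M k k)"
proof -
  define E where "E = mat m m (\<lambda>(i, j). if i = j \<and> i = k then c else 0)"
  have ME: "M + E \<in> carrier_mat m m" using M by (simp add: E_def)
  have "mat_delete (M + E) k j = mat_delete M k j" if "j < m" for j
    using M k that by (intro eq_matI) (auto simp: mat_delete_def E_def)
  then have cof: "cofactor (M + E) k j = cofactor M k j" if "j < m" for j
    using that by (simp add: cofactor_def)
  have "det (M + E) = (\<Sum>j<m. (M + E) $$ (k, j) * cofactor (M + E) k j)"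
    by (rule laplace_expansion_row[OF ME k])
  also have "\<dots> = (\<Sum>j<m. M $$ (k, j) * cofactor M k j + (if j = k then c * cofactor M k j else 0))"
  proof (intro sum.cong refl)
    fix j assume "j \<in> {..<m}"
    then have j: "j < m" by simp
    have "(M + E) $$ (k, j) = M $$ (k, j) + (if j = k then c else 0)"
      using M k j by (simp add: E_def)
    then show "(M + E) $$ (k, j) * cofactor (M + E) k j =
        M $$ (k, j) * cofactor M k j + (if j = k then c * cofactor M k j else 0)"
      by (simp add: cof[OF j] algebra_simps)
  qed
  also have "\<dots> = det M + c * cofactor M k k"
    using k by (simp add: sum.distrib laplace_expansion_row[OF M k])
  also have "cofactor M k k = det (mat_delete M k k)" by (simp add: cofactor_def)
  finally show ?thesis by (simp add: E_def)
qed

lemma det_permute_both: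
  fixes M :: "'a::comm_ring_1 mat"
  assumes M: "M \<in> carrier_mat n n" and p: "p permutes {0..<n}"
  shows "det (mat n n (\<lambda>(i, j). M $$ (p i, p j))) = det M"
proof -
  define B where "B = mat n n (\<lambda>(i, j). M $$ (i, p j))"
  have B: "B \<in> carrier_mat n n" by (simp add: B_def)
  have pi: "p i < n" if "i < n" for i using permutes_in_image[OF p] that by (metis atLeastLessThan_iff zero_le)
  have "mat n n (\<lambda>(i, j). M $$ (p i, p j)) = mat n n (\<lambda>(i, j). B $$ (p i, j))"
    using pi by (intro eq_matI) (auto simp: B_def)
  then have 1: "det (mat n n (\<lambda>(i, j). M $$ (p i, p j))) = signof p * det B"
    using det_permute_rows[OF B p] by simp
  have "B\<^sup>T = mat n n (\<lambda>(i, j). M\<^sup>T $$ (p i, j))"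
    using pi M by (intro eq_matI) (auto simp: B_def)
  then have "det B = signof p * det M"
    using det_permute_rows[of "M\<^sup>T" n p] p M det_transpose[OF B] det_transpose[OF M] by simp
  moreover have "signof p * (signof p * det M) = det M" by (cases p rule: sign_cases) auto
  ultimately show ?thesis using 1 by simp
qed

text \<open>The enumeration is an argument because the order chosen for a vertex-deleted graph is
  unrelated to that of the original graph; only invariants such as the characteristic polynomial can
  be compared.\<close>

definition list_adjacency_mat :: "('a \<times> 'a) set \<Rightarrow> 'a list \<Rightarrow> int mat" where
  "list_adjacency_mat E xs = mat (length xs) (length xs) (\<lambda>(i, j). if (xs ! i, xs ! j) \<in> E then 1 else 0)"

lemma char_poly_list_adjacency_mat_cong:
  assumes "distinct xs" "distinct ys" "set xs = set ys"
  shows "char_poly (list_adjacency_mat E xs) = char_poly (list_adjacency_mat E ys)"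
proof -
  have "mset xs = mset ys" using assms by (simp add: set_eq_iff_mset_eq_distinct)
  then obtain p where p: "p permutes {..<length ys}" "permute_list p ys = xs"
    by (rule mset_eq_permutation)
  have len: "length xs = length ys" using p(2) by auto
  have p': "p permutes {0..<length ys}" using p(1) by (simp add: atLeast0LessThan)
  have pi: "p i < length ys" if "i < length ys" for i
    using permutes_in_image[OF p(1)] that by auto
  have inj: "p i = p j \<longleftrightarrow> i = j" for i j using permutes_inj[OF p(1)] by (auto dest: injD)
  let ?M = "char_poly_matrix (list_adjacency_mat E ys)"
  have M: "?M \<in> carrier_mat (length ys) (length ys)"
    by (rule char_poly_matrix_closed) (simp add: list_adjacency_mat_def)
  have nth: "xs ! i = ys ! p i" if "i < length ys" for i
    using permute_list_nth[OF p(1) that] p(2) by simp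
  have "char_poly_matrix (list_adjacency_mat E xs) = mat (length ys) (length ys) (\<lambda>(i, j). ?M $$ (p i, p j))"
    using len pi nth inj
    by (intro eq_matI) (auto simp: char_poly_matrix_def list_adjacency_mat_def)
  then show ?thesis using det_permute_both[OF M p'] by (simp add: char_poly_def)
qed

lemma vertex_list:
  assumes "finite (pverts G)"
  shows "distinct (vertex_list G)" "set (vertex_list G) = pverts G"
    "length (vertex_list G) = card (pverts G)"
proof -
  have "\<exists>xs. distinct xs \<and> set xs = pverts G" using finite_distinct_list[OF assms] by blast
  then have "distinct (vertex_list G) \<and> set (vertex_list G) = pverts G"
    unfolding vertex_list_def by (rule someI_ex)
  then show "distinct (vertex_list G)" "set (vertex_list G) = pverts G"
    "length (vertex_list G) = card (pverts G)" by (auto simp: distinct_card[symmetric])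
qed

lemma adjacency_mat_carrier [simp]:
  "adjacency_mat G \<in> carrier_mat (card (pverts G)) (card (pverts G))"
  by (simp add: adjacency_mat_def Let_def)

lemma adjacency_mat_eq_list:
  "finite (pverts G) \<Longrightarrow> adjacency_mat G = list_adjacency_mat (parcs G) (vertex_list G)"
  by (simp add: adjacency_mat_def list_adjacency_mat_def vertex_list Let_def)

lemma adjacency_mat_symmetric:
  assumes "pair_graph G"
  shows "(adjacency_mat G)\<^sup>T = adjacency_mat G"
proof -
  interpret pair_graph G by (rule assms)
  have "(a, b) \<in> parcs G \<Longrightarrow> (b, a) \<in> parcs G" for a b
    using pair_sym_arcs by (auto simp: symmetric_def dest: symD)
  then show ?thesis by (intro eq_matI) (auto simp: adjacency_mat_def Let_def)
qed

lemma insert_index_nth: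
  "k < length xs \<Longrightarrow> i < length xs - 1 \<Longrightarrow>
    (take k xs @ drop (Suc k) xs) ! i = xs ! (if i < k then i else Suc i)"
  by (auto simp: nth_append)

text \<open>Removing \<open>v\<close> from the list of \<open>H\<close> gives an enumeration whose
  matrix is literally \<open>mat_delete\<close>; the change to the chosen enumeration preserves the
  characteristic polynomial.\<close>

lemma char_poly_delete_vertex:
  assumes fin: "finite (pverts H)" and k: "k < card (pverts H)" and v: "vertex_list H ! k = v"
  shows "char_poly (adjacency_mat (delete_vertex H v)) = char_poly (mat_delete (adjacency_mat H) k k)"
proof -
  let ?vs = "vertex_list H"
  define ys where "ys = take k ?vs @ drop (Suc k) ?vs"
  note vl = vertex_list[OF fin]
  have kl: "k < length ?vs" using k vl by simp
  have split: "?vs = take k ?vs @ v # drop (Suc k) ?vs" using id_take_nth_drop[OF kl] v by simp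
  have ys: "distinct ys" "set ys = pverts H - {v}"
  proof -
    have "distinct (take k ?vs @ v # drop (Suc k) ?vs)" using vl(1) split by metis
    moreover have "set (take k ?vs @ v # drop (Suc k) ?vs) = pverts H" using vl(2) split by metis
    ultimately show "distinct ys" "set ys = pverts H - {v}" by (auto simp: ys_def)
  qed
  have len: "length ys = card (pverts H) - 1" using kl vl by (simp add: ys_def)
  have fin': "finite (pverts (delete_vertex H v))" using fin by (simp add: delete_vertex_def)
  note vl' = vertex_list[OF fin']
  have "adjacency_mat (delete_vertex H v) =
      list_adjacency_mat (parcs (delete_vertex H v)) (vertex_list (delete_vertex H v))"
    by (rule adjacency_mat_eq_list[OF fin'])
  moreover have "char_poly \<dots> = char_poly (list_adjacency_mat (parcs (delete_vertex H v)) ys)"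
    by (rule char_poly_list_adjacency_mat_cong) (use vl' ys in \<open>auto simp: delete_vertex_def\<close>)
  moreover have "list_adjacency_mat (parcs (delete_vertex H v)) ys = mat_delete (adjacency_mat H) k k"
  proof (rule eq_matI)
    fix i j assume "i < dim_row (mat_delete (adjacency_mat H) k k)" "j < dim_col (mat_delete (adjacency_mat H) k k)"
    then have ij: "i < card (pverts H) - 1" "j < card (pverts H) - 1" by (simp_all add: adjacency_mat_def Let_def)
    then have "ys ! i \<noteq> v" "ys ! j \<noteq> v" using ys(2) len nth_mem[of i ys] nth_mem[of j ys] by auto
    then have "list_adjacency_mat (parcs (delete_vertex H v)) ys $$ (i, j) =
        (if (ys ! i, ys ! j) \<in> parcs H then 1 else 0)"
      using ij len by (simp add: list_adjacency_mat_def delete_vertex_def)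
    also have "\<dots> = mat_delete (adjacency_mat H) k k $$ (i, j)"
      using ij kl vl(3) unfolding ys_def
      by (simp add: insert_index_nth mat_delete_def adjacency_mat_def Let_def)
    finally show "list_adjacency_mat (parcs (delete_vertex H v)) ys $$ (i, j) =
        mat_delete (adjacency_mat H) k k $$ (i, j)" .
  qed (use len in \<open>auto simp: list_adjacency_mat_def adjacency_mat_def Let_def\<close>)
  ultimately show ?thesis by simp
qed

lemma weighted_root_mat_carrier [simp]:
  "weighted_root_mat H v \<in> carrier_mat (card (pverts H)) (card (pverts H))"
  by (simp add: weighted_root_mat_def root_mat_def Let_def)

lemma const_poly_hom: "comm_ring_hom (\<lambda>a :: 'a::comm_ring_1. [:a:])"
  by unfold_locales (auto simp: pCons_one)

text \<open>Both follow from \<open>det_diag_update\<close> at the root position, with \<lambda>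
  added to the adjacency matrix and -\<lambda> to its characteristic matrix. Hence both are affine
  in \<lambda>, with slope given by H - v up to sign.\<close>

lemma
  assumes fin: "finite (pverts H)" and v: "v \<in> pverts H"
  shows det_weighted_root_mat: "det (weighted_root_mat H v) =
      [:det (adjacency_mat H), det (adjacency_mat (delete_vertex H v)):]"
    and char_poly_weighted_root_mat: "char_poly (weighted_root_mat H v) =
      map_poly (\<lambda>a. [:a:]) (char_poly (adjacency_mat H)) -
        smult [:0, 1:] (map_poly (\<lambda>a. [:a:]) (char_poly (adjacency_mat (delete_vertex H v))))"
proof -
  let ?A = "adjacency_mat H" and ?m = "card (pverts H)" and ?c = "map_mat (\<lambda>a :: int. [:a:])"
  note vl = vertex_list[OF fin]
  obtain k where k: "k < ?m" "vertex_list H ! k = v" using v vl by (metis in_set_conv_nth)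
  have root: "vertex_list H ! i = v \<longleftrightarrow> i = k" if "i < ?m" for i
    using that k vl by (metis nth_eq_iff_index_eq)
  have cA: "?c ?A \<in> carrier_mat ?m ?m" by simp
  have A': "mat_delete ?A k k \<in> carrier_mat (?m - 1) (?m - 1)" by (rule mat_delete_carrier) simp
  have w: "weighted_root_mat H v = ?c ?A + mat ?m ?m (\<lambda>(i, j). if i = j \<and> i = k then [:0, 1:] else 0)"
    by (intro eq_matI) (auto simp: weighted_root_mat_def root_mat_def Let_def root)
  have del: "mat_delete (?c ?A) k k = ?c (mat_delete ?A k k)"
    using k by (intro eq_matI) (auto simp: mat_delete_def adjacency_mat_def Let_def)
  have cp: "char_poly (adjacency_mat (delete_vertex H v)) = char_poly (mat_delete ?A k k)"
    by (rule char_poly_delete_vertex[OF fin k])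
  \<comment> \<open>The two matrices may differ by a permutation, so their determinants are compared
    as constant coefficients of equal characteristic polynomials.\<close>
  have "det (adjacency_mat (delete_vertex H v)) = det (mat_delete ?A k k)"
  proof -
    have "card (pverts (delete_vertex H v)) = ?m - 1" using fin v by (simp add: delete_vertex_def)
    then have D: "adjacency_mat (delete_vertex H v) \<in> carrier_mat (?m - 1) (?m - 1)"
      using adjacency_mat_carrier[of "delete_vertex H v"] by simp
    have "(- 1) ^ (?m - 1) * det (adjacency_mat (delete_vertex H v)) = (- 1) ^ (?m - 1) * det (mat_delete ?A k k)"
      using coeff_0_char_poly[OF D] coeff_0_char_poly[OF A'] cp by simp
    then show ?thesis by simp
  qed
  then show "det (weighted_root_mat H v) = [:det ?A, det (adjacency_mat (delete_vertex H v)):]"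
    unfolding w det_diag_update[OF cA k(1)] del comm_ring_hom.hom_det[OF const_poly_hom] by simp
  have const_poly_mult: "[:- x:] * q = - smult x q" for x :: "int poly" and q by simp
  have "char_poly_matrix (weighted_root_mat H v) = char_poly_matrix (?c ?A) +
      mat ?m ?m (\<lambda>(i, j). if i = j \<and> i = k then [:- [:0, 1:]:] else 0)"
    unfolding w by (intro eq_matI) (auto simp: char_poly_matrix_def adjacency_mat_def Let_def)
  then have "char_poly (weighted_root_mat H v) = char_poly (?c ?A) +
      [:- [:0, 1:]:] * det (mat_delete (char_poly_matrix (?c ?A)) k k)"
    unfolding char_poly_def using det_diag_update[of "char_poly_matrix (?c ?A)" ?m k] k(1) by simp
  also have "mat_delete (char_poly_matrix (?c ?A)) k k = char_poly_matrix (mat_delete (?c ?A) k k)"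
    using k by (intro eq_matI) (auto simp: mat_delete_def adjacency_mat_def Let_def char_poly_matrix_def)
  also have "det \<dots> = char_poly (?c (mat_delete ?A k k))" unfolding del by (simp add: char_poly_def)
  also have "\<dots> = map_poly (\<lambda>a. [:a:]) (char_poly (mat_delete ?A k k))"
    by (rule comm_ring_hom.char_poly_hom[OF const_poly_hom A'])
  also have "char_poly (?c ?A) = map_poly (\<lambda>a. [:a:]) (char_poly ?A)"
    by (rule comm_ring_hom.char_poly_hom[OF const_poly_hom adjacency_mat_carrier])
  finally show "char_poly (weighted_root_mat H v) = map_poly (\<lambda>a. [:a:]) (char_poly ?A) -
      smult [:0, 1:] (map_poly (\<lambda>a. [:a:]) (char_poly (adjacency_mat (delete_vertex H v))))"
    unfolding cp const_poly_mult by simp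
qed

section \<open>The rooted product as an evaluated block matrix\<close>

lemma pair_graph_rooted_product:
  assumes G: "pair_graph G" and H: "pair_graph H" and v: "v \<in> pverts H"
  shows "pair_graph (rooted_product G H v)"
proof -
  interpret G: pair_graph G by (rule G)
  interpret H: pair_graph H by (rule H)
  have symG: "(b, a) \<in> parcs G" if "(a, b) \<in> parcs G" for a b
    using G.pair_sym_arcs that by (auto simp: symmetric_def dest: symD)
  have symH: "(b, a) \<in> parcs H" if "(a, b) \<in> parcs H" for a b
    using H.pair_sym_arcs that by (auto simp: symmetric_def dest: symD)
  have inG: "a \<in> pverts G" "b \<in> pverts G" "a \<noteq> b" if "(a, b) \<in> parcs G" for a b
    using G.arc_fst_in_verts[OF that] G.arc_snd_in_verts[OF that] G.pair_no_loops[OF that] by auto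
  have inH: "a \<in> pverts H" "b \<in> pverts H" "a \<noteq> b" if "(a, b) \<in> parcs H" for a b
    using H.arc_fst_in_verts[OF that] H.arc_snd_in_verts[OF that] H.pair_no_loops[OF that] by auto
  let ?P = "rooted_product G H v"
  have wf: "fst e \<in> pverts ?P" "snd e \<in> pverts ?P" "fst e \<noteq> snd e" if "e \<in> parcs ?P" for e
    using that v inG inH by (auto simp: rooted_product_def)
  have fin: "finite (pverts ?P)"
    using G.pair_finite_verts H.pair_finite_verts by (simp add: rooted_product_def)
  have "parcs ?P \<subseteq> pverts ?P \<times> pverts ?P" using wf by (auto simp: mem_Times_iff)
  then have finp: "finite (parcs ?P)" using fin by (metis finite_SigmaI finite_subset)
  have symP: "sym (parcs ?P)" using symG symH by (auto simp: rooted_product_def intro!: symI)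
  have "arcs_ends (with_proj ?P) = parcs ?P" by (auto simp: arcs_ends_def arc_to_ends_def)
  then show ?thesis
    using wf fin finp symP by unfold_locales (auto simp: symmetric_def)
qed

text \<open>The arbitrary vertex order of the product induces \<open>s\<close>, by looking up each
  component in the list of its own graph. An entry \<open>[:a, r:]\<close> of
  \<open>weighted_root_mat\<close> becomes \<open>a I + r A(G)\<close>: copies of H along the
  diagonal, and G between the roots.\<close>

lemma adjacency_mat_rooted_product:
  assumes G: "pair_graph G" and H: "pair_graph H" and v: "v \<in> pverts H"
  defines "n \<equiv> card (pverts G)" and "m \<equiv> card (pverts H)"
  shows "\<exists>s. bij_betw s {..<n * m} ({..<n} \<times> {..<m}) \<and>
    adjacency_mat (rooted_product G H v) = block_eval (n * m) s s (adjacency_mat G) (weighted_root_mat H v)"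
proof -
  interpret G: pair_graph G by (rule G)
  interpret H: pair_graph H by (rule H)
  interpret P: pair_graph "rooted_product G H v" by (rule pair_graph_rooted_product[OF G H v])
  let ?gs = "vertex_list G" and ?hs = "vertex_list H" and ?ps = "vertex_list (rooted_product G H v)"
  note gl = vertex_list[OF G.pair_finite_verts] and hl = vertex_list[OF H.pair_finite_verts]
    and pl = vertex_list[OF P.pair_finite_verts]
  have verts: "pverts (rooted_product G H v) = pverts G \<times> pverts H" by (simp add: rooted_product_def)
  have card: "card (pverts (rooted_product G H v)) = n * m"
    by (simp add: verts card_cartesian_product n_def m_def)
  define gi where "gi = inv_into {..<n} ((!) ?gs)"
  define hi where "hi = inv_into {..<m} ((!) ?hs)"
  define s where "s = map_prod gi hi \<circ> (!) ?ps"
  have bg: "bij_betw ((!) ?gs) {..<n} (pverts G)" using gl by (intro bij_betw_nth) (auto simp: n_def)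
  have bh: "bij_betw ((!) ?hs) {..<m} (pverts H)" using hl by (intro bij_betw_nth) (auto simp: m_def)
  have "bij_betw ((!) ?ps) {..<n * m} (pverts G \<times> pverts H)"
    using pl card verts by (intro bij_betw_nth) auto
  then have s: "bij_betw s {..<n * m} ({..<n} \<times> {..<m})"
    unfolding s_def gi_def hi_def
    by (rule bij_betw_trans) (intro bij_betw_map_prod bij_betw_inv_into bg bh)
  have ps: "?ps ! I = (?gs ! fst (s I), ?hs ! snd (s I))" if "I < n * m" for I
  proof -
    have "?ps ! I \<in> pverts G \<times> pverts H" using that pl card verts by (metis nth_mem)
    then show ?thesis
      using bij_betw_inv_into_right[OF bg] bij_betw_inv_into_right[OF bh]
      by (auto simp: s_def gi_def hi_def)
  qed
  have arcG: "g \<noteq> g'" if "(g, g') \<in> parcs G" for g g' using G.pair_no_loops[OF that] by simp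
  have "adjacency_mat (rooted_product G H v) = block_eval (n * m) s s (adjacency_mat G) (weighted_root_mat H v)"
  proof (rule eq_matI)
    fix I J assume "I < dim_row (block_eval (n * m) s s (adjacency_mat G) (weighted_root_mat H v))"
      "J < dim_col (block_eval (n * m) s s (adjacency_mat G) (weighted_root_mat H v))"
    then have IJ: "I < n * m" "J < n * m" by auto
    obtain g h g' h' where sI: "s I = (g, h)" and sJ: "s J = (g', h')" by (metis surj_pair)
    have b: "g < n" "g' < n" "h < m" "h' < m"
      using bij_betwE[OF s] IJ sI sJ by (metis lessThan_iff mem_Sigma_iff)+
    define a :: int where "a = (if (?hs ! h, ?hs ! h') \<in> parcs H then 1 else 0)"
    define r :: int where "r = (if h = h' \<and> ?hs ! h = v then 1 else 0)"
    have "weighted_root_mat H v $$ (h, h') = [:a, r:]"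
      using b by (auto simp: weighted_root_mat_def adjacency_mat_def root_mat_def Let_def m_def a_def r_def pCons_one)
    then have "block_eval (n * m) s s (adjacency_mat G) (weighted_root_mat H v) $$ (I, J) =
        poly_mat [:a, r:] (adjacency_mat G) $$ (g, g')"
      using IJ by (simp add: block_eval_def block_mat_def sI sJ)
    also have "\<dots> = a * (if g = g' then 1 else 0) + r * adjacency_mat G $$ (g, g')"
    proof -
      note A = adjacency_mat_carrier[of G, folded n_def]
      have "poly_mat [:a, r:] (adjacency_mat G) = a \<cdot>\<^sub>m 1\<^sub>m n + r \<cdot>\<^sub>m adjacency_mat G"
        unfolding poly_mat_pCons[OF A, of a] poly_mat_const[OF A] mult_smult_distrib[OF A one_carrier_mat]
          right_mult_one_mat[OF A] ..
      then show ?thesis using b carrier_matD[OF A] by simp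
    qed
    \<comment> \<open>As \<open>G\<close> has no loops, the two summands are never both 1.\<close>
    also have "\<dots> = (if (?ps ! I, ?ps ! J) \<in> parcs (rooted_product G H v) then 1 else 0)"
    proof -
      have eqg: "?gs ! g = ?gs ! g' \<longleftrightarrow> g = g'" using b gl by (simp add: n_def nth_eq_iff_index_eq)
      have eqh: "?hs ! h = ?hs ! h' \<longleftrightarrow> h = h'" using b hl by (simp add: m_def nth_eq_iff_index_eq)
      have "?gs ! g \<in> pverts G" using b gl by (metis n_def nth_mem)
      moreover have "adjacency_mat G $$ (g, g') = (if (?gs ! g, ?gs ! g') \<in> parcs G then 1 else 0)"
        using b by (simp add: adjacency_mat_def Let_def n_def)
      ultimately show ?thesis
        using ps[OF IJ(1)] ps[OF IJ(2)] eqg eqh arcG[of "?gs ! g" "?gs ! g'"]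
        by (auto simp: sI sJ a_def r_def rooted_product_def)
    qed
    finally show "adjacency_mat (rooted_product G H v) $$ (I, J) =
        block_eval (n * m) s s (adjacency_mat G) (weighted_root_mat H v) $$ (I, J)"
      using IJ by (simp add: adjacency_mat_def Let_def card)
  qed (auto simp: adjacency_mat_def Let_def card)
  with s show ?thesis by blast
qed

section \<open>The rooted product\<close>

text \<open>In this order the diagonal of \<open>S \<otimes> I\<close> lists each diagonal entry of
  \<open>S\<close> m times in a row, so the divisibility chain of a Smith form survives. This is why
  a second enumeration \<open>t\<close> is carried next to that of the graph.\<close>

definition row_major :: "nat \<Rightarrow> nat \<Rightarrow> nat \<times> nat" where
  "row_major m I = (I div m, I mod m)"

lemma bij_betw_row_major:
  assumes "0 < m"
  shows "bij_betw (row_major m) {..<n * m} ({..<n} \<times> {..<m})"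
proof (rule bij_betw_byWitness[where f' = "\<lambda>(i, h). i * m + h"])
  show "(\<lambda>(i, h). i * m + h) ` ({..<n} \<times> {..<m}) \<subseteq> {..<n * m}"
  proof clarsimp
    fix i h assume "i < n" "h < m"
    then have "i * m + h < Suc i * m" by simp
    also have "\<dots> \<le> n * m" using \<open>i < n\<close> by (intro mult_le_mono1) simp
    finally show "i * m + h < n * m" .
  qed
  show "row_major m ` {..<n * m} \<subseteq> {..<n} \<times> {..<m}"
    using assms by (auto simp: row_major_def less_mult_imp_div_less)
qed (use assms in \<open>auto simp: row_major_def\<close>)

lemma det_mult_dvd_1:
  fixes P :: "'a::comm_ring_1 mat"
  assumes "P \<in> carrier_mat n n" "Q \<in> carrier_mat n n" "det P dvd 1" "det Q dvd 1"
  shows "det (P * Q) dvd 1"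
  using mult_dvd_mono[OF assms(3,4)] det_mult[OF assms(1,2)] by simp

lemma invertible_mat_iff_det:
  fixes P :: "'a::comm_ring_1 mat"
  assumes P: "P \<in> carrier_mat n n"
  shows "invertible_mat P \<longleftrightarrow> det P dvd 1"
proof
  assume "invertible_mat P"
  then obtain Q where PQ: "P * Q = 1\<^sub>m n" and QP: "Q * P = 1\<^sub>m (dim_row Q)"
    using P by (auto simp: invertible_mat_def inverts_mat_def)
  have "dim_col Q = n" using arg_cong[OF PQ, of dim_col] by simp
  moreover have "dim_row Q = n" using arg_cong[OF QP, of dim_col] P by simp
  ultimately have "Q \<in> carrier_mat n n" by auto
  then show "det P dvd 1" using unit_det_of_right_inverse[OF P _ PQ] by blast
next
  assume "det P dvd 1"
  from mat_inverse_of_unit_det[OF P this]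
  show "invertible_mat P" using P by (metis carrier_matD invertible_mat_def inverts_mat_def square_mat.simps)
qed

text \<open>If \<open>S = P W Q\<close>, then \<open>S \<otimes> I = (P \<otimes> I) X^(-1) (X (W
  \<otimes> I) Y) Y^(-1) (Q \<otimes> I)\<close>, and the outer factors are unimodular.\<close>

lemma is_smith_normal_form_kron_id:
  assumes S: "is_smith_normal_form W S" and W: "W \<in> carrier_mat n n"
    and X: "X \<in> carrier_mat (n * m) (n * m)" "det X dvd 1"
    and Y: "Y \<in> carrier_mat (n * m) (n * m)" "det Y dvd 1" and m: "0 < m"
  defines "K \<equiv> kron_id (n * m) (row_major m) (row_major m)"
  shows "is_smith_normal_form (X * K W * Y) (K S)"
proof -
  let ?N = "n * m"
  note t = bij_betw_row_major[OF m, of n]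
  have K: "K M \<in> carrier_mat ?N ?N" for M by (simp add: K_def)
  obtain P Q where P: "P \<in> carrier_mat n n" "det P dvd 1" and Q: "Q \<in> carrier_mat n n" "det Q dvd 1"
    and SPQ: "S = P * W * Q"
    using S W unfolding is_smith_normal_form_def by (auto simp: invertible_mat_iff_det)
  have Sc: "S \<in> carrier_mat n n" unfolding SPQ using P Q W by (intro mult_carrier_mat[of _ n n]) auto
  have diag: "diagonal_mat S" "\<And>i. i < n \<Longrightarrow> S $$ (i, i) \<ge> 0"
    "\<And>i. Suc i < n \<Longrightarrow> S $$ (i, i) dvd S $$ (Suc i, Suc i)"
    using S Sc by (auto simp: is_smith_normal_form_def)
  obtain X' where X': "X' \<in> carrier_mat ?N ?N" "X * X' = 1\<^sub>m ?N" "X' * X = 1\<^sub>m ?N"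
    using mat_inverse_of_unit_det[OF X] by blast
  obtain Y' where Y': "Y' \<in> carrier_mat ?N ?N" "Y * Y' = 1\<^sub>m ?N" "Y' * Y = 1\<^sub>m ?N"
    using mat_inverse_of_unit_det[OF Y] by blast
  note mult = mult_carrier_mat[of _ ?N ?N _ ?N]
  have KS: "K S = K P * X' * (X * K W * Y) * (Y' * K Q)"
  proof -
    have XKW: "X * K W \<in> carrier_mat ?N ?N" and XKWY: "X * K W * Y \<in> carrier_mat ?N ?N"
      and KPX: "K P * X' \<in> carrier_mat ?N ?N"
      using X Y X' K by (auto intro: mult)
    have "K P * X' * (X * K W * Y) * (Y' * K Q) = K P * (X' * (X * K W * Y) * (Y' * K Q))"
      using assoc_mult_mat[OF K X'(1) XKWY] assoc_mult_mat[OF K mult[OF X'(1) XKWY] mult[OF Y'(1) K]] by simp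
    also have "X' * (X * K W * Y) = K W * Y"
      unfolding assoc_mult_mat[OF X'(1) XKW Y(1), symmetric] assoc_mult_mat[OF X'(1) X(1) K, symmetric]
        X'(3) left_mult_one_mat[OF K] ..
    also have "K W * Y * (Y' * K Q) = K W * K Q"
      unfolding assoc_mult_mat[OF K Y(1) mult[OF Y'(1) K]] assoc_mult_mat[OF Y(1) Y'(1) K, symmetric]
        Y'(2) left_mult_one_mat[OF K] ..
    also have "K P * (K W * K Q) = K S"
      unfolding SPQ K_def using P Q W
      by (simp add: kron_id_mult[OF t t t] mult_carrier_mat[of _ n n _ n] assoc_mult_mat[of _ n n _ n _ n])
    finally show ?thesis by simp
  qed
  have inv: "K P * X' \<in> carrier_mat ?N ?N" "invertible_mat (K P * X')"
    "Y' * K Q \<in> carrier_mat ?N ?N" "invertible_mat (Y' * K Q)"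
  proof -
    have "det (K P) dvd 1" "det (K Q) dvd 1"
      unfolding K_def by (intro det_kron_id_dvd_1[OF t t] P Q)+
    moreover have "det X' dvd 1" "det Y' dvd 1"
      using unit_det_of_right_inverse(2)[OF X(1) X'(1,2)] unit_det_of_right_inverse(2)[OF Y(1) Y'(1,2)] .
    moreover show c: "K P * X' \<in> carrier_mat ?N ?N" "Y' * K Q \<in> carrier_mat ?N ?N"
      using K X' Y' by (auto intro: mult)
    ultimately show "invertible_mat (K P * X')" "invertible_mat (Y' * K Q)"
      unfolding invertible_mat_iff_det[OF c(1)] invertible_mat_iff_det[OF c(2)]
      by (blast intro: det_mult_dvd_1[OF K X'(1)] det_mult_dvd_1[OF Y'(1) K])+
  qed
  have entry: "K S $$ (I, J) = (if I mod m = J mod m then S $$ (I div m, J div m) else 0)"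
    if "I < ?N" "J < ?N" for I J
    using that by (simp add: K_def kron_id_def block_mat_def row_major_def)
  have div: "I div m < n" if "I < ?N" for I using that by (simp add: less_mult_imp_div_less)
  have "diagonal_mat (K S)"
    unfolding diagonal_mat_def
  proof (intro allI impI)
    fix I J assume "I < dim_row (K S)" "J < dim_col (K S)" "I \<noteq> J"
    then have IJ: "I < ?N" "J < ?N" "I \<noteq> J" using K[of S] by auto
    show "K S $$ (I, J) = 0"
    proof (cases "I mod m = J mod m")
      case True
      then have "I div m \<noteq> J div m" using IJ(3) by (metis div_mult_mod_eq)
      then show ?thesis using diag(1) Sc div IJ by (auto simp: entry diagonal_mat_def)
    qed (simp add: entry IJ)
  qed
  moreover have "K S $$ (I, I) dvd K S $$ (Suc I, Suc I)" if "Suc I < ?N" for I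
  \<comment> \<open>The next diagonal position holds either the same entry of \<open>S\<close> or
    the following one.\<close>
  proof (cases "Suc I div m = I div m")
    case True
    then show ?thesis using that by (simp add: entry)
  next
    case False
    then have "Suc I div m = Suc (I div m)" by (simp add: div_Suc split: if_splits)
    then show ?thesis using that div[OF that] diag(3) by (simp add: entry)
  qed
  moreover have "K S $$ (I, I) \<ge> 0" if "I < ?N" for I
    using that div[OF that] diag(2) by (simp add: entry)
  moreover have XKWY: "X * K W * Y \<in> carrier_mat ?N ?N" using X Y K by (auto intro: mult)
  ultimately show ?thesis
    unfolding is_smith_normal_form_def using KS inv K[of S] carrier_matD[OF XKWY] carrier_matD[OF K[of S]]
    by (metis square_mat.simps)
qed

lemma degree_Phi:
  assumes p: "prime p" and A: "adjacency_mat G \<in> carrier_mat n n" and G: "pair_graph G" and n: "0 < n"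
  shows "card (carrier (kernel_mod p ((walk_mat (adjacency_mat G))\<^sup>T * walk_mat (adjacency_mat G)))) =
    p ^ degree (Phi p G)"
proof -
  have card: "card (pverts G) = n" using A by (auto simp: adjacency_mat_def Let_def)
  have "lead_coeff (char_poly (adjacency_mat G)) = 1" using degree_monic_char_poly[OF A] by simp
  from is_monic_gcd_mod_exists[OF p this]
  obtain d where d: "is_monic_gcd_mod p d (char_poly (adjacency_mat G)) (char_poly (adjacency_mat G + all_ones_mat n))"
    by blast
  have "Phi p G = d" unfolding Phi_def card by (rule is_monic_gcd_mod_unique[OF p d])
  then show ?thesis
    using card_kernel_mod_walk_gram[OF p A adjacency_mat_symmetric[OF G] n d] by simp
qed

theorem theorem5p6:
  fixes H :: "'b pair_pre_digraph" and v :: 'b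
  assumes "pair_graph H" and "v \<in> pverts H"
    and C1: "det (adjacency_mat H) \<in> {1, -1} \<and> det (adjacency_mat (delete_vertex H v)) = 0 \<or>
             det (adjacency_mat H) = 0 \<and> det (adjacency_mat (delete_vertex H v)) \<in> {1, -1}"
    and C2: "resultant (char_poly (adjacency_mat H))
               (char_poly (adjacency_mat (delete_vertex H v))) \<in> {1, -1}"
    and C3: "\<exists>k. det (walk_mat (weighted_root_mat H v)) \<in> {Polynomial.monom 1 k, - Polynomial.monom 1 k}"
  shows "\<forall>G :: 'a pair_pre_digraph. G \<in> graph_family \<longrightarrow> rooted_product G H v \<in> graph_family"
proof (intro allI impI)
  fix G :: "'a pair_pre_digraph"
  assume "G \<in> graph_family"
  then obtain n where n: "even n" "0 < n" and G: "pair_graph G" "card (pverts G) = n"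
    and detA: "det (adjacency_mat G) \<in> {1, -1}"
    and detW: "det (walk_mat (adjacency_mat G)) \<noteq> 0"
    and snf: "squarefree_last_invariant_factor (walk_mat (adjacency_mat G))"
    and Phi: "\<And>p. prime p \<Longrightarrow> odd p \<Longrightarrow> int p dvd det (walk_mat (adjacency_mat G)) \<Longrightarrow>
        degree (Phi p G) = 2 * nullity_mod p (walk_mat (adjacency_mat G))"
    by (auto simp: graph_family_def graph_family_of_order_def)
  interpret H: pair_graph H by (rule assms)
  define m where "m = card (pverts H)"
  have m: "0 < m" using assms(2) H.pair_finite_verts by (auto simp: m_def card_gt_0_iff)
  let ?N = "n * m" and ?P = "rooted_product G H v"
  define t where "t = row_major m"
  have t: "bij_betw t {..<?N} ({..<n} \<times> {..<m})" unfolding t_def by (rule bij_betw_row_major[OF m])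
  define A where "A = adjacency_mat G"
  define B where "B = weighted_root_mat H v"
  define W where "W = walk_mat A"
  define K :: "int mat \<Rightarrow> int mat" where "K = kron_id ?N t t"
  have A: "A \<in> carrier_mat n n" using adjacency_mat_carrier[of G] G by (simp add: A_def)
  have B: "B \<in> carrier_mat m m" by (simp add: B_def m_def)
  have W: "W \<in> carrier_mat n n" using A by (simp add: W_def)
  have WB: "walk_mat B \<in> carrier_mat m m" using B by simp
  have K: "K M \<in> carrier_mat ?N ?N" for M by (simp add: K_def)
  have symA: "A\<^sup>T = A" unfolding A_def by (rule adjacency_mat_symmetric[OF G(1)])
  have detA1: "det A dvd 1" and nzW: "det W \<noteq> 0" using detA detW by (auto simp: A_def W_def)
  obtain s where s: "bij_betw s {..<?N} ({..<n} \<times> {..<m})"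
    and adj: "adjacency_mat ?P = block_eval ?N s s A B"
    using adjacency_mat_rooted_product[OF G(1) assms(1,2)] by (auto simp: A_def B_def m_def G(2))
  have P: "pair_graph ?P" by (rule pair_graph_rooted_product[OF G(1) assms(1,2)])
  have cardP: "card (pverts ?P) = ?N"
    using G(2) by (simp add: rooted_product_def card_cartesian_product m_def)
  have Pc: "adjacency_mat ?P \<in> carrier_mat ?N ?N" using adjacency_mat_carrier[of ?P] by (simp add: cardP)

  \<comment> \<open>The two alternatives of (C1) give the exponents 0 and 1 of \<lambda>.\<close>
  have "det B = Polynomial.monom 1 0 \<or> det B = - Polynomial.monom 1 0 \<or>
      det B = Polynomial.monom 1 1 \<or> det B = - Polynomial.monom 1 1"
    using C1 by (auto simp: B_def det_weighted_root_mat[OF H.pair_finite_verts assms(2)] monom_Suc monom_0 pCons_one)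
  then obtain e where "det B \<in> {Polynomial.monom 1 e, - Polynomial.monom 1 e}" by blast
  then have "det (adjacency_mat ?P) dvd 1"
    unfolding adj by (rule det_block_eval_dvd_1[OF s s A detA1 B])
  then have detP: "det (adjacency_mat ?P) \<in> {1, -1}" by (auto simp: zdvd1_eq abs_if split: if_splits)

  \<comment> \<open>\<chi>(H) has positive degree m, so the Sylvester matrix is non-empty even if H
    - v has no vertices.\<close>
  obtain a b where "a * char_poly (adjacency_mat H) + b * char_poly (adjacency_mat (delete_vertex H v)) = 1"
  proof -
    have "degree (char_poly (adjacency_mat H)) = m"
      using degree_monic_char_poly[OF adjacency_mat_carrier[of H]] by (simp add: m_def)
    then show ?thesis using bezout_of_resultant[of "char_poly (adjacency_mat H)"] C2 m that by fastforce
  qed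
  from kron_id_as_poly_mat[OF s s A B char_poly_weighted_root_mat[OF H.pair_finite_verts assms(2), folded B_def] this]
  obtain q where q: "kron_id ?N s s A = poly_mat q (block_eval ?N s s A B)" by blast
  obtain k where detWB: "det (walk_mat B) \<in> {Polynomial.monom 1 k, - Polynomial.monom 1 k}"
    using C3 by (auto simp: B_def)
  define U where "U = block_eval ?N s t A (walk_mat B)"
  have U: "U \<in> carrier_mat ?N ?N" by (simp add: U_def)
  have detU: "det U dvd 1" unfolding U_def by (rule det_block_eval_dvd_1[OF s t A detA1 WB detWB])
  obtain T where T: "T \<in> carrier_mat ?N ?N" "det T dvd 1"
    and fac: "walk_mat (adjacency_mat ?P) = U * K W * T"
    using walk_mat_block_eval_decomposition[OF s t A B n(2) m q detA1 nzW[unfolded W_def] detWB]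
    by (auto simp: adj U_def K_def W_def)
  have UK: "U * K W \<in> carrier_mat ?N ?N" by (rule mult_carrier_mat[OF U K])
  have detF: "det (walk_mat (adjacency_mat ?P)) = det U * det (K W) * det T"
    unfolding fac det_mult[OF UK T(1)] det_mult[OF U K] ..
  have detK: "det (K W) dvd det W ^ ?N" unfolding K_def by (rule det_kron_id_dvd[OF t W])
  have nzP: "det (walk_mat (adjacency_mat ?P)) \<noteq> 0"
  proof -
    have "det (K W) \<noteq> 0" using detK nzW by auto
    moreover have "det U \<noteq> 0" "det T \<noteq> 0" using detU T(2) by auto
    ultimately show ?thesis by (simp add: detF)
  qed
  \<comment> \<open>(iii) is known for \<open>G\<close> only at primes dividing
    \<open>det W\<close>; the product acquires no further ones.\<close>
  have dvdP: "int p dvd det W" if "prime p" "int p dvd det (walk_mat (adjacency_mat ?P))" for p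
  proof -
    have pp: "prime (int p)" using that(1) by simp
    have unit: "\<not> int p dvd x" if "x dvd 1" for x using that pp by (metis dvd_trans not_prime_unit)
    from that(2) have "int p dvd det (K W)"
      using unit[OF detU] unit[OF T(2)] by (simp add: detF prime_dvd_mult_iff[OF pp])
    then show ?thesis using detK pp by (metis dvd_trans prime_dvd_power)
  qed

  obtain S where S: "is_smith_normal_form W S" "squarefree (S $$ (n - 1, n - 1))"
    using snf W by (auto simp: squarefree_last_invariant_factor_def A_def[symmetric] W_def[symmetric])
  have snfP: "squarefree_last_invariant_factor (walk_mat (adjacency_mat ?P))"
  proof -
    have "is_smith_normal_form (U * K W * T) (K S)"
      unfolding K_def t_def by (rule is_smith_normal_form_kron_id[OF S(1) W U detU T m])
    moreover have "K S $$ (?N - 1, ?N - 1) = S $$ (n - 1, n - 1)"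
    proof -
      \<comment> \<open>The last position has quotient \<open>n - 1\<close> by m, so the last
        invariant factor is the one of \<open>G\<close>.\<close>
      have "?N - 1 = (m - 1) + (n - 1) * m" using n(2) m by (cases n) auto
      then have "(?N - 1) div m = n - 1" using m by (simp only: div_mult_self1) simp
      moreover have "?N - 1 < ?N" using n(2) m by simp
      ultimately show ?thesis by (simp add: K_def kron_id_def block_mat_def t_def row_major_def)
    qed
    ultimately show ?thesis
      using S(2) Pc unfolding squarefree_last_invariant_factor_def fac[symmetric] by auto
  qed

  have nullP: "card (carrier (kernel_mod p (walk_mat (adjacency_mat ?P)))) = card (carrier (kernel_mod p W)) ^ m" for p
    unfolding fac card_kernel_mod_mult_right[OF T UK] kernel_mod_mult_left[OF U detU K]
    unfolding K_def by (rule card_kernel_mod_kron_id[OF t W])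

  define C where "C = companion_mat (char_poly A)"
  have C: "C \<in> carrier_mat n n" using A by (simp add: C_def)
  have AW: "A * W = W * C" unfolding W_def C_def by (rule walk_mat_companion[OF A])
  have detC: "det C dvd 1"
  proof -
    have "det A * det W = det W * det C"
      unfolding det_mult[OF A W, symmetric] det_mult[OF W C, symmetric] AW ..
    then have "det C = det A" using nzW by simp
    then show ?thesis using detA1 by simp
  qed
  define R where "R = (walk_mat B)\<^sup>T * walk_mat B"
  have R: "R \<in> carrier_mat m m" unfolding R_def using WB by (intro mult_carrier_mat[of _ m m]) auto
  \<comment> \<open>The sign in (C3) disappears by squaring.\<close>
  have "det R = Polynomial.monom 1 (2 * k)"
  proof -
    have "det R = det (walk_mat B) * det (walk_mat B)"
      unfolding R_def using WB by (simp add: det_mult[of _ m] det_transpose[of _ m])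
    then show ?thesis using detWB by (auto simp: mult_monom mult_2)
  qed
  then have detE: "det (block_eval ?N t t C R) dvd 1"
    by (intro det_block_eval_dvd_1[OF t t C detC R, of "2 * k"]) simp
  have gram: "(walk_mat (adjacency_mat ?P))\<^sup>T * walk_mat (adjacency_mat ?P) =
      T\<^sup>T * (K (W\<^sup>T * W) * (block_eval ?N t t C R * T))"
  proof -
    let ?E = "block_eval ?N t t C R" and ?KW = "K W"
    have E: "?E \<in> carrier_mat ?N ?N" by simp
    have TT: "T\<^sup>T \<in> carrier_mat ?N ?N" and UT: "U\<^sup>T \<in> carrier_mat ?N ?N" and KT: "?KW\<^sup>T \<in> carrier_mat ?N ?N"
      using T(1) U K[of W] by auto
    note mult = mult_carrier_mat[of _ ?N ?N _ ?N]
    have "(U * ?KW * T)\<^sup>T = T\<^sup>T * (?KW\<^sup>T * U\<^sup>T)"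
      by (simp only: transpose_mult[OF UK T(1)] transpose_mult[OF U K])
    then have "(U * ?KW * T)\<^sup>T * (U * ?KW * T) = T\<^sup>T * (?KW\<^sup>T * U\<^sup>T) * (U * ?KW * T)" by simp
    also have "\<dots> = T\<^sup>T * (?KW\<^sup>T * (U\<^sup>T * U * ?KW) * T)"
      using assoc_mult_mat[OF TT mult[OF KT UT] mult[OF UK T(1)]] assoc_mult_mat[OF mult[OF KT UT] UK T(1)]
        assoc_mult_mat[OF KT UT UK] assoc_mult_mat[OF UT U K[of W]] by simp
    \<comment> \<open>The enumeration \<open>s\<close> of the product graph cancels here, and by
      symmetry of \<open>A\<close> the transpose of \<open>U\<close> is again an evaluation at
      \<open>A\<close>.\<close>
    also have "U\<^sup>T * U = block_eval ?N t t A R"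
    proof -
      have "U\<^sup>T = block_eval ?N t s A (walk_mat B)\<^sup>T"
        unfolding U_def block_eval_transpose[OF s t A WB] symA ..
      then show ?thesis using WB unfolding U_def R_def by (simp add: block_eval_mult[OF t s t A])
    qed
    also have "block_eval ?N t t A R * ?KW = ?KW * ?E"
      unfolding K_def by (rule block_eval_mult_kron_id[OF t t t A C W AW])
    also have "?KW\<^sup>T * (?KW * ?E) * T = K (W\<^sup>T * W) * (?E * T)"
    proof -
      have KK: "?KW\<^sup>T * ?KW = K (W\<^sup>T * W)"
        unfolding K_def kron_id_transpose[OF W t t] using W by (intro kron_id_mult[OF t t t]) auto
      show ?thesis
        using assoc_mult_mat[OF KT K[of W] E] assoc_mult_mat[OF K[of "W\<^sup>T * W"] E T(1)] by (simp add: KK)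
    qed
    finally show ?thesis unfolding fac .
  qed
  have gramP: "card (carrier (kernel_mod p ((walk_mat (adjacency_mat ?P))\<^sup>T * walk_mat (adjacency_mat ?P)))) =
      card (carrier (kernel_mod p (W\<^sup>T * W))) ^ m" for p
  proof -
    have E: "block_eval ?N t t C R \<in> carrier_mat ?N ?N" by simp
    have ET: "block_eval ?N t t C R * T \<in> carrier_mat ?N ?N" by (rule mult_carrier_mat[OF E T(1)])
    have "det (block_eval ?N t t C R * T) dvd 1"
      by (rule det_mult_dvd_1[OF E T(1) detE T(2)])
    moreover have "T\<^sup>T \<in> carrier_mat ?N ?N" "det T\<^sup>T dvd 1" using T by (auto simp: det_transpose)
    moreover have "W\<^sup>T * W \<in> carrier_mat n n" using W by (intro mult_carrier_mat[of _ n n]) auto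
    ultimately show ?thesis
      unfolding gram
      by (simp add: kernel_mod_mult_left[OF _ _ mult_carrier_mat[OF K ET]] card_kernel_mod_mult_right[OF ET _ K])
        (simp add: K_def card_kernel_mod_kron_id[OF t])
  qed

  have PhiP: "degree (Phi p ?P) = 2 * nullity_mod p (walk_mat (adjacency_mat ?P))"
    if p: "prime p" "odd p" and dvd: "int p dvd det (walk_mat (adjacency_mat ?P))" for p
  proof -
    have p1: "1 < p" by (rule prime_gt_1_nat[OF p(1)])
    have N0: "0 < ?N" using n m by simp
    \<comment> \<open>Degree and nullity are recovered from kernel cardinalities as exponents of p.
      Both are multiplied by m, so the relation for \<open>G\<close> carries over.\<close>
    have "p ^ degree (Phi p ?P) = (p ^ degree (Phi p G)) ^ m"
      using gramP[of p] degree_Phi[OF p(1) Pc P N0] degree_Phi[OF p(1) A[unfolded A_def] G(1) n(2)]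
      by (simp add: W_def A_def)
    then have "degree (Phi p ?P) = degree (Phi p G) * m" using p1 by (simp flip: power_mult)
    moreover have "p ^ nullity_mod p (walk_mat (adjacency_mat ?P)) = (p ^ nullity_mod p W) ^ m"
      using nullP[of p] by (simp add: card_kernel_mod[OF p(1)])
    then have "nullity_mod p (walk_mat (adjacency_mat ?P)) = nullity_mod p W * m"
      using p1 by (simp flip: power_mult)
    moreover have "degree (Phi p G) = 2 * nullity_mod p W"
      using Phi[OF p] dvdP[OF p(1) dvd] by (simp add: W_def A_def)
    ultimately show ?thesis by simp
  qed
  have "?P \<in> graph_family_of_order ?N"
    using P cardP detP nzP snfP PhiP by (simp add: graph_family_of_order_def)
  moreover have "even ?N" "0 < ?N" using n m by auto
  ultimately show "?P \<in> graph_family" unfolding graph_family_def by blast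
qed

end
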